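(* For all $2d\ge 4$ we have $\mathcal{S}\Sigma_{2d}\subsetneq\mathcal{S}\mathcal{P}_{2d}$, and for all $2d\ge 6$ we have $\mathcal{B}\Sigma_{2d}\subsetneq\mathcal{B}\mathcal{P}_{2d}$. Moreover, the sets $\mathcal{S}\mathcal{P}_{2d}$ ($2d\ge4$) and $\mathcal{B}\mathcal{P}_{2d}$ ($2d\ge 6$) are not semialgebraic, while the sets $\mathcal{S}\Sigma_{2d}$ and $\mathcal{B}\Sigma_{2d}$ are semialgebraic.
   Context: Let $\Lambda_{2d}$ be the set of partitions of $2d$ and $\Lambda_{2d}^{\varepsilon}$ the set of partitions of $2d$ all of whose parts are even. For $n\ge 1$ and a partition $\lambda$, $p_\lambda=\prod_i p_{\lambda_i}$ with $p_r=X_1^r+\cdots+X_n^r$. A vector $c=(c_\lambda)\in\mathbb{R}^{\Lambda_{2d}}$ is identified, for each $n\ge 2d$, with the symmetric form $f_c^{(n)}=\sum_\lambda c_\lambda p_\lambda(X_1,\dots,X_n)$ (the $p_\lambda$ form a basis of the symmetric forms of degree $2d$), and similarly a vector in $\mathbb{R}^{\Lambda_{2d}^\varepsilon}$ is identified with an even symmetric form (a symmetric form in $X_1^2,\dots,X_n^2$). $\mathcal{S}\Sigma_{2d}$ (respectively $\mathcal{S}\mathcal{P}_{2d}$) is the set of $c\in\mathbb{R}^{\Lambda_{2d}}$ such that for every $n\ge 2d$ the form $f_c^{(n)}$ is a sum of squares of real polynomials (respectively is nonnegative on $\mathbb{R}^n$). $\mathcal{B}\Sigma_{2d}$ and $\mathcal{B}\mathcal{P}_{2d}$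 are defined in the same way with $\Lambda_{2d}^{\varepsilon}$ in place of $\Lambda_{2d}$. Semialgebraicity is meant for subsets of the real coordinate spaces $\mathbb{R}^{\Lambda_{2d}}$, respectively $\mathbb{R}^{\Lambda_{2d}^\varepsilon}$. *)

theory Defs
  imports Complex_Main "HOL-Library.FuncSet" "HOL-Library.Multiset" "HOL-Library.Poly_Mapping"
begin

section \<open>Real polynomials in variables of an arbitrary type\<close>

type_synonym 'x mpoly = "('x \<Rightarrow>\<^sub>0 nat) \<Rightarrow>\<^sub>0 real"

definition Var :: "'x \<Rightarrow> 'x mpoly" where
  "Var i = Poly_Mapping.single (Poly_Mapping.single i 1) 1"

definition Const :: "real \<Rightarrow> 'x mpoly" where
  "Const a = Poly_Mapping.single 0 a"

definition polys_in :: "'x set \<Rightarrow> 'x mpoly set" where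
  "polys_in I = {p. \<forall>m \<in> Poly_Mapping.keys p. Poly_Mapping.keys m \<subseteq> I}"

definition poly_eval :: "('x \<Rightarrow> real) \<Rightarrow> 'x mpoly \<Rightarrow> real" where
  "poly_eval x p = (\<Sum>m \<in> Poly_Mapping.keys p. Poly_Mapping.lookup p m *
     (\<Prod>i \<in> Poly_Mapping.keys m. x i ^ Poly_Mapping.lookup m i))"


section \<open>Semialgebraic subsets of a real coordinate space\<close>

text \<open>The space of real vectors with coordinates indexed by \<open>I\<close>. Its elements are extensional
  functions, so that a vector is determined by its coordinates in \<open>I\<close>.\<close>

abbreviation coord_space :: "'x set \<Rightarrow> ('x \<Rightarrow> real) set" where
  "coord_space I \<equiv> I \<rightarrow>\<^sub>E UNIV"

text \<open>The smallest Boolean algebra of subsets of the coordinate space that contains all sets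
  \<open>p > 0\<close>. It contains the sets \<open>p = 0\<close> as well, namely as the complement of the union of
  \<open>p > 0\<close> and \<open>- p > 0\<close>. Only finite \<open>I\<close> is of interest.\<close>

inductive semialgebraic :: "'x set \<Rightarrow> ('x \<Rightarrow> real) set \<Rightarrow> bool" for I :: "'x set" where
  pos: "p \<in> polys_in I \<Longrightarrow> semialgebraic I {x \<in> coord_space I. poly_eval x p > 0}"
| compl: "semialgebraic I S \<Longrightarrow> semialgebraic I (coord_space I - S)"
| union: "semialgebraic I S \<Longrightarrow> semialgebraic I T \<Longrightarrow> semialgebraic I (S \<union> T)"


section \<open>Partitions and symmetric forms\<close>

definition partitions :: "nat \<Rightarrow> nat multiset set" where
  "partitions k = {\<mu>. 0 \<notin># \<mu> \<and> sum_mset \<mu> = k}"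

definition even_partitions :: "nat \<Rightarrow> nat multiset set" where
  "even_partitions k = {\<mu> \<in> partitions k. \<forall>r \<in># \<mu>. even r}"

text \<open>Finiteness matters because sums over infinite sets are \<open>0\<close> by convention.\<close>

lemma finite_partitions: "finite (partitions k)"
proof -
  have "partitions k \<subseteq> mset ` {xs. set xs \<subseteq> {..k} \<and> length xs \<le> k}"
  proof
    fix l assume l: "l \<in> partitions k"
    obtain xs where xs: "l = mset xs" by (metis ex_mset)
    have z: "0 \<notin> set xs" and s: "sum_list xs = k"
      using l xs by (auto simp: partitions_def sum_mset_sum_list)
    have "length ys \<le> sum_list ys" if "0 \<notin> set ys" for ys :: "nat list"
      using that by (induction ys) auto
    with z s have "length xs \<le> k" by blast
    moreover have "set xs \<subseteq> {..k}" using s member_le_sum_list by fastforce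
    ultimately show "l \<in> mset ` {xs. set xs \<subseteq> {..k} \<and> length xs \<le> k}" using xs by blast
  qed
  then show ?thesis
    by (rule finite_subset) (intro finite_imageI finite_lists_length_le, simp)
qed

lemma finite_even_partitions: "finite (even_partitions k)"
  by (rule finite_subset[OF _ finite_partitions]) (auto simp: even_partitions_def)

definition power_sum :: "nat \<Rightarrow> nat \<Rightarrow> nat mpoly" where
  "power_sum n r = (\<Sum>i \<in> {1..n}. Var i ^ r)"

definition power_sum_partition :: "nat \<Rightarrow> nat multiset \<Rightarrow> nat mpoly" where
  "power_sum_partition n \<mu> = (\<Prod>r \<in># \<mu>. power_sum n r)"

definition sym_form :: "nat multiset set \<Rightarrow> nat \<Rightarrow> (nat multiset \<Rightarrow> real) \<Rightarrow> nat mpoly" where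
  "sym_form L n c = (\<Sum>\<mu> \<in> L. Const (c \<mu>) * power_sum_partition n \<mu>)"


section \<open>Sums of squares and nonnegative forms in all numbers of variables\<close>

definition sum_of_squares :: "nat \<Rightarrow> nat mpoly \<Rightarrow> bool" where
  "sum_of_squares n f \<longleftrightarrow> (\<exists>qs. set qs \<subseteq> polys_in {1..n} \<and> f = (\<Sum>q \<leftarrow> qs. q ^ 2))"

definition nonneg :: "nat \<Rightarrow> nat mpoly \<Rightarrow> bool" where
  "nonneg n f \<longleftrightarrow> (\<forall>x \<in> coord_space {1..n}. poly_eval x f \<ge> 0)"

text \<open>In the following four sets the argument \<open>k\<close> is the degree, i.e. \<open>2 * d\<close>.\<close>

definition S_Sigma :: "nat \<Rightarrow> (nat multiset \<Rightarrow> real) set" where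
  "S_Sigma k = {c \<in> coord_space (partitions k).
     \<forall>n \<ge> k. sum_of_squares n (sym_form (partitions k) n c)}"

definition S_P :: "nat \<Rightarrow> (nat multiset \<Rightarrow> real) set" where
  "S_P k = {c \<in> coord_space (partitions k).
     \<forall>n \<ge> k. nonneg n (sym_form (partitions k) n c)}"

definition B_Sigma :: "nat \<Rightarrow> (nat multiset \<Rightarrow> real) set" where
  "B_Sigma k = {c \<in> coord_space (even_partitions k).
     \<forall>n \<ge> k. sum_of_squares n (sym_form (even_partitions k) n c)}"

definition B_P :: "nat \<Rightarrow> (nat multiset \<Rightarrow> real) set" where
  "B_P k = {c \<in> coord_space (even_partitions k).
     \<forall>n \<ge> k. nonneg n (sym_form (even_partitions k) n c)}"

end

theory Submission
  imports Defs "HOL-Computational_Algebra.Polynomial" "HOL-Combinatorics.Permutations" "HOL-Analysis.Convex"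
begin

text \<open>Nonnegative forms. With \<open>y\<^sub>i = x\<^sub>i\<^sup>2 / p\<^sub>2\<close> the even form \<open>p\<^sub>6 - 2 t p\<^sub>4 p\<^sub>2 + (t\<^sup>2 - \<epsilon>) p\<^sub>2\<^sup>3\<close> equals
  \<open>p\<^sub>2\<^sup>3 (\<Sum> y\<^sub>i (y\<^sub>i - t)\<^sup>2 - \<epsilon>)\<close>, where the \<open>y\<^sub>i\<close> are nonnegative with sum \<open>1\<close>. In arbitrarily many variables the sum
  vanishes for suitable \<open>y\<close> if \<open>t = 1/m\<close> and is bounded away from \<open>0\<close> otherwise, so for infinitesimal
  \<open>\<epsilon> > 0\<close> nonnegativity fails exactly at the points \<open>t = 1/m\<close>, which no semialgebraic set can achieve. For quartics
  one uses \<open>\<Sum> x\<^sub>i\<^sup>2 (x\<^sub>i - p\<^sub>1)\<^sup>2 + (p\<^sub>1\<^sup>2 - t p\<^sub>2)\<^sup>2 - \<epsilon> p\<^sub>2\<^sup>2\<close>, since many tiny coordinates change \<open>p\<^sub>1\<close> at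
  will without affecting the other power sums.

  Sums of squares. If a form is a sum of squares in any number \<open>n\<close> of variables, its Gram matrices can be made
  invariant under permutations. An invariant matrix has boundedly many different entries, and they stay bounded, so
  one may let \<open>n\<close> tend to infinity. Moebius inversion over the common variables of two monomials
  splits the limit into kernels attached to sets \<open>S\<close> of distinguished variables; each is positive semidefinite because
  infinitely many vectors of equal length with equal mutual inner products have a nonnegative inner product.
  Hence finitely many real parameters describe a representation as a sum of squares that is valid for all \<open>n\<close>, and
  the Tarski--Seidenberg theorem eliminates them. The strict inclusions follow, because only one of the two
  sets is semialgebraic.\<close>

section \<open>Signs of polynomials along the real line\<close>

text \<open>Positivity of the split kernels is proved with unboundedly many copies of a monomial in
  fresh variables. That is impossible for a fixed number of variables, so the limit kernel, valid
  for all numbers of variables at once, has to come first and is split afterwards. Finiteness has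
  two sources. A set S with more than d elements contains a variable missing from a given monomial
  of degree d, and then the Moebius sum over S is 0. And the infinitely many equations, one for each
  n and each point, are linear in the coefficients and in the products of two parameters, so
  finitely many of them imply the rest. The elimination of a real variable follows Cohen and
  Hoermander, but in place of a table of roots and intervals it keeps an increasing bijection of the
  line that matches the signs at two parameter values. For the nonnegative forms the order of the
  limits matters: \<epsilon> tends to 0 for fixed t, and only then does t tend to 0.\<close>

definition order_iso :: "(real \<Rightarrow> real) \<Rightarrow> bool" where
  "order_iso \<phi> \<longleftrightarrow> strict_mono \<phi> \<and> surj \<phi>"

lemma order_iso_less: "order_iso \<phi> \<Longrightarrow> \<phi> s < \<phi> t \<longleftrightarrow> s < t"
  by (simp add: order_iso_def strict_mono_less)

lemma order_iso_eq: "order_iso \<phi> \<Longrightarrow> \<phi> s = \<phi> t \<longleftrightarrow> s = t"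
  by (simp add: order_iso_def strict_mono_eq)

lemma order_iso_obtain:
  assumes "order_iso \<phi>" obtains t where "y = \<phi> t"
  using assms unfolding order_iso_def surj_def by blast

lemma order_iso_id: "order_iso (\<lambda>t. t)"
  by (auto simp: order_iso_def strict_mono_def)

lemma order_iso_compose: "order_iso \<phi> \<Longrightarrow> order_iso \<psi> \<Longrightarrow> order_iso (\<lambda>t. \<phi> (\<psi> t))"
  unfolding order_iso_def strict_mono_def surj_def by metis

lemma order_iso_inv:
  assumes "order_iso \<phi>" shows "order_iso (inv \<phi>)"
proof -
  have s: "surj \<phi>" and i: "inj \<phi>" using assms by (auto simp: order_iso_def strict_mono_imp_inj_on)
  have "inv \<phi> s < inv \<phi> t" if "s < t" for s t
    using that order_iso_less[OF assms, of "inv \<phi> s" "inv \<phi> t"] s by (simp add: surj_f_inv_f)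
  then show ?thesis using i by (auto simp: order_iso_def strict_mono_def inj_imp_surj_inv)
qed

lemma order_iso_reflect: "order_iso \<phi> \<Longrightarrow> order_iso (\<lambda>t. - \<phi> (- t))"
  unfolding order_iso_def strict_mono_def surj_def
  by (metis minus_minus neg_less_iff_less)

text \<open>The map is linear on [a, u] and on [u, b] with slopes \<open>m\<close> and
  \<open>k\<close>, and the identity elsewhere. It serves to move the image of one root onto its
  partner while everything outside the gap stays fixed.\<close>

lemma order_iso_move_point:
  fixes a b u v :: real
  assumes "a < u" "u < b" "a < v" "v < b"
  shows "\<exists>\<theta>. order_iso \<theta> \<and> \<theta> u = v \<and> (\<forall>x. x \<le> a \<or> b \<le> x \<longrightarrow> \<theta> x = x)"
proof -
  define m where "m = (v - a) / (u - a)"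
  define k where "k = (b - v) / (b - u)"
  have mk: "m > 0" "k > 0" using assms by (auto simp: m_def k_def)
  have e1: "a + m * (u - a) = v" "b - k * (b - u) = v" using assms by (auto simp: m_def k_def)
  define \<theta> where "\<theta> x = (if x \<le> a \<or> b \<le> x then x else if x \<le> u then a + m * (x - a) else b - k * (b - x))" for x
  have below: "a < \<theta> x \<and> \<theta> x \<le> v" if "a < x" "x \<le> u" for x
  proof -
    have "m * (x - a) \<le> m * (u - a)" using that mk by simp
    then show ?thesis using that mk assms e1 by (auto simp: \<theta>_def)
  qed
  have above: "v < \<theta> x \<and> \<theta> x < b" if "u < x" "x < b" for x
  proof -
    have "k * (b - x) < k * (b - u)" using that mk by simp
    then have "v < b - k * (b - x)" using e1 by linarith
    moreover have "k * (b - x) > 0" using that mk by simp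
    moreover have "\<theta> x = b - k * (b - x)" using that assms by (simp add: \<theta>_def)
    ultimately show ?thesis by linarith
  qed
  have sm: "strict_mono \<theta>"
  proof (rule strict_monoI)
    fix x y :: real assume xy: "x < y"
    consider "x \<le> a" | "a < x" "x \<le> u" | "u < x" "x < b" | "b \<le> x" by linarith
    then show "\<theta> x < \<theta> y"
    proof cases
      case 1
      then have "\<theta> x = x" by (simp add: \<theta>_def)
      moreover consider "y \<le> a" | "a < y" "y \<le> u" | "u < y" "y < b" | "b \<le> y" by linarith
      then have "y \<le> a \<and> \<theta> y = y \<or> \<theta> y > a \<or> y \<ge> b \<and> \<theta> y = y"
        using below above assms by cases (auto simp: \<theta>_def, force+)
      ultimately show ?thesis using 1 xy assms by auto
    next
      case 2
      consider "y \<le> u" | "u < y" "y < b" | "b \<le> y" by linarith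
      then show ?thesis
      proof cases
        case 1
        have "m * (x - a) < m * (y - a)" using xy mk by simp
        then show ?thesis using 1 2 xy assms by (auto simp: \<theta>_def)
      next
        case _: 2
        then show ?thesis using below[of x] above[of y] \<open>a < x\<close> \<open>x \<le> u\<close> by auto
      next
        case 3
        then show ?thesis using below[of x] 2 assms by (auto simp: \<theta>_def)
      qed
    next
      case 3
      have "k * (b - y) < k * (b - x)" using xy mk by simp
      moreover have "\<theta> x < b" using above 3 by blast
      ultimately show ?thesis using 3 xy assms by (auto simp: \<theta>_def)
    next
      case 4
      then show ?thesis using xy assms by (auto simp: \<theta>_def)
    qed
  qed
  have "\<exists>x. y = \<theta> x" for y
  proof -
    consider "y \<le> a \<or> b \<le> y" | "a < y" "y \<le> v" | "v < y" "y < b" by linarith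
    then show ?thesis
    proof cases
      case 1 then show ?thesis by (auto simp: \<theta>_def)
    next
      case 2
      define x where "x = a + (y - a) / m"
      have "(y - a) / m \<le> (v - a) / m" using 2 mk by (simp add: divide_right_mono)
      also have "(v - a) / m = u - a" using e1 mk by (simp add: field_simps)
      finally have "a < x" "x \<le> u" using 2 mk by (auto simp: x_def)
      moreover have "a + m * (x - a) = y" using mk by (simp add: x_def)
      ultimately show ?thesis using assms by (intro exI[of _ x]) (auto simp: \<theta>_def)
    next
      case 3
      define x where "x = b - (b - y) / k"
      have "(b - y) / k < (b - v) / k" using 3 mk by (simp add: divide_strict_right_mono)
      also have "(b - v) / k = b - u" using e1 mk by (simp add: field_simps)
      finally have "u < x" "x < b" using 3 mk by (auto simp: x_def)
      moreover have "b - k * (b - x) = y" using mk by (simp add: x_def)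
      ultimately show ?thesis using assms by (intro exI[of _ x]) (auto simp: \<theta>_def)
    qed
  qed
  then have "order_iso \<theta>" using sm by (auto simp: order_iso_def surj_def)
  moreover have "\<theta> u = v" using assms e1 by (auto simp: \<theta>_def)
  ultimately show ?thesis by (auto simp: \<theta>_def)
qed

section \<open>Signs of a polynomial, of its derivative, and far out on the line\<close>

lemma sgn_poly_constant:
  fixes p :: "real poly"
  assumes nz: "\<And>x. s \<le> x \<Longrightarrow> x \<le> t \<Longrightarrow> poly p x \<noteq> 0" and "s \<le> t"
  shows "sgn (poly p s) = sgn (poly p t)"
proof (rule ccontr)
  assume "\<not> ?thesis"
  then have "poly p s * poly p t < 0"
    using nz[of s] nz[of t] \<open>s \<le> t\<close> by (auto simp: sgn_if mult_less_0_iff split: if_splits)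
  moreover then have "s \<noteq> t" by (auto simp: mult_less_0_iff)
  ultimately obtain x where "s < x" "x < t" "poly p x = 0"
    using poly_IVT[of s t p] \<open>s \<le> t\<close> by auto
  then show False using nz[of x] by auto
qed

text \<open>An increasing function may stay negative forever, but for a polynomial the leading
  coefficient decides: if it were negative, so would be that of the derivative, against positivity
  of the derivative far to the right.\<close>

lemma poly_pderiv_pos_imp_eventually_pos:
  fixes p :: "real poly"
  assumes pos: "\<And>y. y \<ge> x \<Longrightarrow> poly (pderiv p) y > 0"
  shows "\<exists>y > x. poly p y > 0"
proof -
  have "pderiv p \<noteq> 0" using pos[of x] by auto
  then have deg: "degree p \<noteq> 0" by (auto simp: pderiv_eq_0_iff)
  have lc: "lead_coeff (pderiv q) = real (degree q) * lead_coeff q" if "degree q \<noteq> 0" for q :: "real poly"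
    using that by (cases "degree q") (simp_all add: degree_pderiv coeff_pderiv)
  show ?thesis
  proof (cases "lead_coeff p > 0")
    case True
    then obtain n where "\<And>y. y \<ge> n \<Longrightarrow> lead_coeff p \<le> poly p y" using poly_pinfty_gt_lc by blast
    from this[of "max n (x + 1)"] True show ?thesis by (intro exI[of _ "max n (x + 1)"]) auto
  next
    case False
    then have "lead_coeff p < 0" using deg by (metis degree_0 leading_coeff_0_iff linorder_neqE_linordered_idom)
    then have "lead_coeff (pderiv (- p)) > 0" using lc[of "- p"] deg by (auto simp: mult_less_0_iff)
    then obtain n where "\<And>y. y \<ge> n \<Longrightarrow> lead_coeff (pderiv (- p)) \<le> poly (pderiv (- p)) y"
      using poly_pinfty_gt_lc by blast
    from this[of "max n x"] pos[of "max n x"] \<open>lead_coeff (pderiv (- p)) > 0\<close>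
    have False by (auto simp: pderiv_minus)
    then show ?thesis ..
  qed
qed

lemma sgn_poly_above:
  fixes p :: "real poly"
  assumes nz: "\<And>y. y \<ge> x \<Longrightarrow> poly (pderiv p) y \<noteq> 0"
  shows "\<exists>y > x. sgn (poly p y) = sgn (poly (pderiv p) x)"
proof (cases "poly (pderiv p) x > 0")
  case True
  have "poly (pderiv p) y > 0" if "y \<ge> x" for y
    using sgn_poly_constant[of x y "pderiv p"] nz that True by (auto simp: sgn_if split: if_splits)
  from poly_pderiv_pos_imp_eventually_pos[of x, OF this] True show ?thesis by auto
next
  case False
  then have neg: "poly (pderiv p) x < 0" using nz[of x] by auto
  have "poly (pderiv (- p)) y > 0" if "y \<ge> x" for y
  proof -
    have "sgn (poly (pderiv p) x) = sgn (poly (pderiv p) y)"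
      by (rule sgn_poly_constant) (use nz that in auto)
    then show ?thesis using nz[OF that] neg by (auto simp: sgn_if pderiv_minus split: if_splits)
  qed
  from poly_pderiv_pos_imp_eventually_pos[of x, OF this] neg show ?thesis by auto
qed

lemma poly_reflect: "poly (p \<circ>\<^sub>p [:0, - 1:]) x = poly p (- x :: real)"
  by (simp add: poly_pcompose)

lemma poly_pderiv_reflect: "poly (pderiv (p \<circ>\<^sub>p [:0, - 1:])) x = - poly (pderiv p) (- x :: real)"
  by (simp add: pderiv_pcompose poly_pcompose pderiv_pCons)

text \<open>Reflection of the line reduces this to \<open>sgn_poly_above\<close>; the derivative
  changes its sign under reflection, whence the minus.\<close>

lemma sgn_poly_below:
  fixes p :: "real poly"
  assumes nz: "\<And>y. y \<le> x \<Longrightarrow> poly (pderiv p) y \<noteq> 0"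
  shows "\<exists>y < x. sgn (poly p y) = - sgn (poly (pderiv p) x)"
proof -
  have "poly (pderiv (p \<circ>\<^sub>p [:0, - 1:])) y \<noteq> 0" if "y \<ge> - x" for y
    using nz[of "- y"] that by (simp add: poly_pderiv_reflect)
  from sgn_poly_above[of "- x", OF this] obtain y where "y > - x" "sgn (poly p (- y)) = - sgn (poly (pderiv p) x)"
    by (auto simp: poly_reflect poly_pderiv_reflect sgn_minus)
  then show ?thesis by (intro exI[of _ "- y"]) auto
qed

section \<open>Matching the roots of two polynomials whose derivatives have matching signs\<close>

text \<open>Here \<open>p'\<close> is not the derivative of \<open>p\<close> but a second
  polynomial, later the member of the same family at another parameter. Since Z contains all
  critical points, \<open>p\<close> is monotone from a root \<rho> outside Z up to the next point of
  Z and has there the sign of its derivative at \<rho>; \<open>sgnZ\<close> carries this sign over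
  to \<open>p'\<close>. If there is no next point, the behaviour at infinity replaces it.\<close>

lemma sgn_matched_right:
  fixes p p' :: "real poly"
  assumes iso: "order_iso \<phi>" and fin: "finite Z"
    and der: "\<And>t. sgn (poly (pderiv p) t) = sgn (poly (pderiv p') (\<phi> t))"
    and crit: "\<And>t. poly (pderiv p) t = 0 \<Longrightarrow> t \<in> Z"
    and sgnZ: "\<And>z. z \<in> Z \<Longrightarrow> sgn (poly p z) = sgn (poly p' (\<phi> z))"
    and root: "poly p \<rho> = 0" "\<rho> \<notin> Z"
  shows "\<exists>b > \<rho>. sgn (poly p' (\<phi> b)) = sgn (poly (pderiv p) \<rho>) \<and> (\<forall>z\<in>Z. \<not> (\<rho> < z \<and> z < b))"
proof (cases "{z \<in> Z. \<rho> < z} = {}")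
  case True
  have "poly (pderiv p') y \<noteq> 0" if "y \<ge> \<phi> \<rho>" for y
  proof -
    obtain t where t: "y = \<phi> t" by (rule order_iso_obtain[OF iso])
    then have "t \<ge> \<rho>" using that order_iso_less[OF iso, of t \<rho>] by linarith
    then have "t \<notin> Z" using True root by force
    then have "poly (pderiv p) t \<noteq> 0" using crit by blast
    then show ?thesis using der[of t] t by (metis sgn_0_0)
  qed
  from sgn_poly_above[OF this] obtain y where y: "y > \<phi> \<rho>" "sgn (poly p' y) = sgn (poly (pderiv p') (\<phi> \<rho>))" by blast
  obtain b where "y = \<phi> b" by (rule order_iso_obtain[OF iso])
  then show ?thesis using y order_iso_less[OF iso] der[of \<rho>] True by (intro exI[of _ b]) auto
next
  case False
  define b where "b = Min {z \<in> Z. \<rho> < z}"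
  have b: "b \<in> Z" "\<rho> < b" "\<And>z. z \<in> Z \<Longrightarrow> \<rho> < z \<Longrightarrow> b \<le> z"
    using Min_in[of "{z \<in> Z. \<rho> < z}"] False fin by (auto simp: b_def)
  obtain \<xi> where \<xi>: "\<rho> < \<xi>" "\<xi> < b" "poly p b - poly p \<rho> = (b - \<rho>) * poly (pderiv p) \<xi>"
    using poly_MVT[OF b(2)] by blast
  have "sgn (poly (pderiv p) \<rho>) = sgn (poly (pderiv p) \<xi>)"
  proof (rule sgn_poly_constant)
    fix x assume "\<rho> \<le> x" "x \<le> \<xi>"
    then have "x \<notin> Z" using b(3)[of x] \<xi> root by fastforce
    then show "poly (pderiv p) x \<noteq> 0" using crit by blast
  qed (use \<xi> in auto)
  then have "sgn (poly p b) = sgn (poly (pderiv p) \<rho>)" using \<xi> root b by (simp add: sgn_mult)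
  then show ?thesis using b sgnZ[of b] by (intro exI[of _ b]) force
qed

lemma sgn_matched_left:
  fixes p p' :: "real poly"
  assumes iso: "order_iso \<phi>" and fin: "finite Z"
    and der: "\<And>t. sgn (poly (pderiv p) t) = sgn (poly (pderiv p') (\<phi> t))"
    and crit: "\<And>t. poly (pderiv p) t = 0 \<Longrightarrow> t \<in> Z"
    and sgnZ: "\<And>z. z \<in> Z \<Longrightarrow> sgn (poly p z) = sgn (poly p' (\<phi> z))"
    and root: "poly p \<rho> = 0" "\<rho> \<notin> Z"
  shows "\<exists>a < \<rho>. sgn (poly p' (\<phi> a)) = - sgn (poly (pderiv p) \<rho>) \<and> (\<forall>z\<in>Z. \<not> (a < z \<and> z < \<rho>))"
proof -
  have "\<exists>b > - \<rho>. sgn (poly (p' \<circ>\<^sub>p [:0, - 1:]) (- \<phi> (- b))) = sgn (poly (pderiv (p \<circ>\<^sub>p [:0, - 1:])) (- \<rho>))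
      \<and> (\<forall>z\<in>uminus ` Z. \<not> (- \<rho> < z \<and> z < b))"
  proof (rule sgn_matched_right[where \<phi> = "\<lambda>t. - \<phi> (- t)"])
    show "order_iso (\<lambda>t. - \<phi> (- t))" using order_iso_reflect[OF iso] .
    show "t \<in> uminus ` Z" if "poly (pderiv (p \<circ>\<^sub>p [:0, - 1:])) t = 0" for t
      using that crit[of "- t"] by (simp add: poly_pderiv_reflect) (metis add.inverse_inverse image_eqI)
  qed (use fin der sgnZ root in \<open>auto simp: poly_reflect poly_pderiv_reflect sgn_minus\<close>)
  then obtain b where b: "b > - \<rho>" "sgn (poly p' (\<phi> (- b))) = - sgn (poly (pderiv p) \<rho>)"
     "\<forall>z\<in>Z. \<not> (- \<rho> < - z \<and> - z < b)"
    by (auto simp: poly_reflect poly_pderiv_reflect sgn_minus)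
  then show ?thesis by (intro exI[of _ "- b"]) auto
qed

text \<open>A root outside Z is not critical, so \<open>p\<close> changes sign there, and
  \<open>p'\<close> has opposite signs at the images of suitable points on either side. The
  intermediate value theorem then gives \<rho>' in the corresponding gap of the images of Z.\<close>

lemma matched_root:
  fixes p p' :: "real poly"
  assumes iso: "order_iso \<phi>" and fin: "finite Z"
    and der: "\<And>t. sgn (poly (pderiv p) t) = sgn (poly (pderiv p') (\<phi> t))"
    and crit: "\<And>t. poly (pderiv p) t = 0 \<Longrightarrow> t \<in> Z"
    and sgnZ: "\<And>z. z \<in> Z \<Longrightarrow> sgn (poly p z) = sgn (poly p' (\<phi> z))"
    and root: "poly p \<rho> = 0" "\<rho> \<notin> Z"
  shows "\<exists>\<rho>'. poly p' \<rho>' = 0 \<and> (\<forall>z\<in>Z. (z < \<rho> \<longleftrightarrow> \<phi> z < \<rho>') \<and> \<phi> z \<noteq> \<rho>')"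
proof -
  obtain a where a: "a < \<rho>" "sgn (poly p' (\<phi> a)) = - sgn (poly (pderiv p) \<rho>)" "\<forall>z\<in>Z. \<not> (a < z \<and> z < \<rho>)"
    using sgn_matched_left[OF assms] by blast
  obtain b where b: "b > \<rho>" "sgn (poly p' (\<phi> b)) = sgn (poly (pderiv p) \<rho>)" "\<forall>z\<in>Z. \<not> (\<rho> < z \<and> z < b)"
    using sgn_matched_right[OF assms] by blast
  have "poly (pderiv p) \<rho> \<noteq> 0" using crit root by blast
  then have "poly p' (\<phi> a) * poly p' (\<phi> b) < 0"
    using a(2) b(2) by (auto simp: sgn_if mult_less_0_iff split: if_splits)
  moreover have "\<phi> a < \<phi> b" using a b order_iso_less[OF iso] by force
  ultimately obtain \<rho>' where r: "\<phi> a < \<rho>'" "\<rho>' < \<phi> b" "poly p' \<rho>' = 0" using poly_IVT by blast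
  have "(z < \<rho> \<longleftrightarrow> \<phi> z < \<rho>') \<and> \<phi> z \<noteq> \<rho>'" if z: "z \<in> Z" for z
  proof (cases "z < \<rho>")
    case True
    then have "\<phi> z \<le> \<phi> a" using a(3) z order_iso_less[OF iso, of a z] by force
    then show ?thesis using r True by auto
  next
    case False
    then have "\<phi> z \<ge> \<phi> b" using b(3) z root order_iso_less[OF iso, of z b] by force
    then show ?thesis using r False by auto
  qed
  then show ?thesis using r by blast
qed

text \<open>If \<psi> t = \<phi> s with s and t different, then no point of Z separates s from t,
  because both maps preserve the order and agree on Z; hence q has the same sign at s and t. The
  guard \<open>q \<noteq> 0\<close> is there because the zero polynomial has roots everywhere, which
  no finite Z can contain.\<close>

lemma sgn_matched_transfer:
  fixes q q' :: "real poly"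
  assumes iso: "order_iso \<phi>" "order_iso \<psi>"
    and eq: "\<And>z. z \<in> Z \<Longrightarrow> \<psi> z = \<phi> z"
    and roots: "\<And>t. q \<noteq> 0 \<Longrightarrow> poly q t = 0 \<Longrightarrow> t \<in> Z"
    and sgn: "\<And>t. sgn (poly q t) = sgn (poly q' (\<phi> t))"
  shows "sgn (poly q t) = sgn (poly q' (\<psi> t))"
proof -
  obtain s where s: "\<psi> t = \<phi> s" by (rule order_iso_obtain[OF iso(1)])
  have *: "sgn (poly q t) = sgn (poly q s)"
  proof (cases "q = 0 \<or> t \<in> Z")
    case True
    then show ?thesis using s eq order_iso_eq[OF iso(1)] by fastforce
  next
    case False
    have "x \<notin> Z" if "min s t \<le> x" "x \<le> max s t" for x
    proof
      assume x: "x \<in> Z"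
      then have "x \<noteq> t" using False by blast
      moreover have "x \<noteq> s" using s eq[OF x] x False order_iso_eq[OF iso(2), of x t] by force
      moreover have "x < t \<longleftrightarrow> x < s"
        using order_iso_less[OF iso(1), of x s] order_iso_less[OF iso(2), of x t] s eq[OF x] by simp
      ultimately show False using that by (auto simp: min_def max_def split: if_splits)
    qed
    then have nz: "poly q x \<noteq> 0" if "min s t \<le> x" "x \<le> max s t" for x using that roots False by blast
    have "sgn (poly q (min s t)) = sgn (poly q (max s t))" by (rule sgn_poly_constant) (use nz in auto)
    then show ?thesis by (auto simp: min_def max_def split: if_splits)
  qed
  then show ?thesis using sgn[of s] s by simp
qed

lemma finite_gap:
  fixes u v :: real
  assumes "finite W" "\<And>w. w \<in> W \<Longrightarrow> (w < u \<longleftrightarrow> w < v) \<and> w \<noteq> u \<and> w \<noteq> v"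
  shows "\<exists>a b. a < u \<and> u < b \<and> a < v \<and> v < b \<and> (\<forall>w\<in>W. w \<le> a \<or> b \<le> w)"
proof -
  define a where "a = Max (insert (min u v - 1) {w \<in> W. w < u})"
  define b where "b = Min (insert (max u v + 1) {w \<in> W. w > u})"
  have "a \<in> insert (min u v - 1) {w \<in> W. w < u}" unfolding a_def using assms(1) by (intro Max_in) auto
  then have "a < u \<and> a < v" using assms(2) by auto
  moreover have "b \<in> insert (max u v + 1) {w \<in> W. w > u}" unfolding b_def using assms(1) by (intro Min_in) auto
  then have "u < b \<and> v < b" using assms(2) by auto (metis linorder_neqE_linordered_idom order_less_asym)
  moreover have "w \<le> a \<or> b \<le> w" if "w \<in> W" for w
  proof (cases "w < u")
    case True
    then show ?thesis unfolding a_def using assms(1) that by (intro disjI1 Max_ge) auto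
  next
    case False
    then have "u < w" using assms(2)[OF that] by auto
    then show ?thesis unfolding b_def using assms(1) that by (intro disjI2 Min_le) auto
  qed
  ultimately show ?thesis by blast
qed

text \<open>The roots are treated one at a time. By Rolle two roots of \<open>p\<close> are
  separated by a critical point, which lies in Z. So between the present image of \<rho> and its
  intended image \<open>v\<close> there is neither an image of a point of Z nor that of a root
  treated before, and a local move disturbs none of them.\<close>

lemma match_roots:
  fixes p p' :: "real poly"
  assumes iso: "order_iso \<phi>" and fin: "finite Z"
    and der: "\<And>t. sgn (poly (pderiv p) t) = sgn (poly (pderiv p') (\<phi> t))"
    and crit: "\<And>t. poly (pderiv p) t = 0 \<Longrightarrow> t \<in> Z"
    and sgnZ: "\<And>z. z \<in> Z \<Longrightarrow> sgn (poly p z) = sgn (poly p' (\<phi> z))"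
    and M: "finite M" "M \<subseteq> {\<rho>. poly p \<rho> = 0 \<and> \<rho> \<notin> Z}"
  shows "\<exists>\<psi>. order_iso \<psi> \<and> (\<forall>z\<in>Z. \<psi> z = \<phi> z) \<and> (\<forall>\<rho>\<in>M. poly p' (\<psi> \<rho>) = 0)"
  using M
proof (induction M rule: finite_induct)
  case empty
  then show ?case using iso by blast
next
  case (insert \<rho> M)
  then obtain \<psi> where \<psi>: "order_iso \<psi>" "\<And>z. z \<in> Z \<Longrightarrow> \<psi> z = \<phi> z" "\<And>\<rho>. \<rho> \<in> M \<Longrightarrow> poly p' (\<psi> \<rho>) = 0"
    by auto
  have root: "poly p \<rho> = 0" "\<rho> \<notin> Z" using insert.prems by auto
  have der': "sgn (poly (pderiv p) t) = sgn (poly (pderiv p') (\<psi> t))" for t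
    by (rule sgn_matched_transfer[OF iso \<psi>(1) \<psi>(2) crit der])
  have sgnZ': "sgn (poly p z) = sgn (poly p' (\<psi> z))" if "z \<in> Z" for z using sgnZ \<psi>(2) that by simp
  from matched_root[OF \<psi>(1) fin der' crit sgnZ' root] obtain v where
    v: "poly p' v = 0" "\<And>z. z \<in> Z \<Longrightarrow> (z < \<rho> \<longleftrightarrow> \<psi> z < v) \<and> \<psi> z \<noteq> v" by auto
  have "(w < \<psi> \<rho> \<longleftrightarrow> w < v) \<and> w \<noteq> \<psi> \<rho> \<and> w \<noteq> v" if w: "w \<in> \<psi> ` Z \<union> \<psi> ` M" for w
  proof (cases "w \<in> \<psi> ` Z")
    case True
    then show ?thesis using v(2) root order_iso_less[OF \<psi>(1)] order_iso_eq[OF \<psi>(1)] by force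
  next
    case False
    then obtain \<rho>' where r: "w = \<psi> \<rho>'" "\<rho>' \<in> M" using w by auto
    have r0: "poly p \<rho>' = 0" using r insert.prems by auto
    have ne: "\<rho>' \<noteq> \<rho>" using r insert.hyps by auto
    have "\<exists>z. (\<rho> < z \<and> z < \<rho>' \<or> \<rho>' < z \<and> z < \<rho>) \<and> poly (pderiv p) z = 0"
    proof (cases "\<rho> < \<rho>'")
      case True
      from poly_MVT[OF True, of p] r0 root show ?thesis using True by auto
    next
      case False
      then have "\<rho>' < \<rho>" using ne by auto
      from poly_MVT[OF this, of p] r0 root this show ?thesis by auto
    qed
    then obtain z where z: "\<rho> < z \<and> z < \<rho>' \<or> \<rho>' < z \<and> z < \<rho>" "z \<in> Z" using crit by blast
    then show ?thesis using v(2)[OF z(2)] r order_iso_less[OF \<psi>(1), of \<rho> z] order_iso_less[OF \<psi>(1), of z \<rho>]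
      order_iso_less[OF \<psi>(1), of \<rho>' z] order_iso_less[OF \<psi>(1), of z \<rho>'] by force
  qed
  then obtain a b where ab: "a < \<psi> \<rho>" "\<psi> \<rho> < b" "a < v" "v < b" "\<And>w. w \<in> \<psi> ` Z \<union> \<psi> ` M \<Longrightarrow> w \<le> a \<or> b \<le> w"
    using finite_gap[of "\<psi> ` Z \<union> \<psi> ` M" "\<psi> \<rho>" v] fin insert.hyps by auto
  obtain \<theta> where \<theta>: "order_iso \<theta>" "\<theta> (\<psi> \<rho>) = v" "\<And>x. x \<le> a \<or> b \<le> x \<Longrightarrow> \<theta> x = x"
    using order_iso_move_point[OF ab(1-4)] by blast
  have "order_iso (\<lambda>t. \<theta> (\<psi> t))" using order_iso_compose \<theta> \<psi> by blast
  moreover have "\<forall>z\<in>Z. \<theta> (\<psi> z) = \<phi> z" using ab(5) \<theta>(3) \<psi>(2) by (metis UnI1 image_eqI)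
  moreover have "\<forall>r\<in>insert \<rho> M. poly p' (\<theta> (\<psi> r)) = 0"
    using ab(5) \<theta> \<psi>(3) v(1) by (metis UnI2 image_eqI insert_iff)
  ultimately show ?case by blast
qed

text \<open>The inductive step of the Cohen--Hoermander method: the sign behaviour of \<open>p\<close> along the line can be
  recovered from that of its derivative and from its signs at the roots of the other polynomials.\<close>

lemma sgn_matched_extend:
  fixes p p' :: "real poly"
  assumes iso: "order_iso \<phi>" and fin: "finite Z"
    and der: "\<And>t. sgn (poly (pderiv p) t) = sgn (poly (pderiv p') (\<phi> t))"
    and crit: "\<And>t. poly (pderiv p) t = 0 \<Longrightarrow> t \<in> Z"
    and sgnZ: "\<And>z. z \<in> Z \<Longrightarrow> sgn (poly p z) = sgn (poly p' (\<phi> z))"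
  shows "\<exists>\<psi>. order_iso \<psi> \<and> (\<forall>z\<in>Z. \<psi> z = \<phi> z) \<and> (\<forall>t. sgn (poly p t) = sgn (poly p' (\<psi> t)))"
proof -
  define N where "N = {\<rho>. poly p \<rho> = 0 \<and> \<rho> \<notin> Z}"
  have "p \<noteq> 0"
  proof
    assume "p = 0"
    then have "UNIV \<subseteq> Z" using crit by auto
    then show False using fin finite_subset infinite_UNIV_char_0[where 'a=real] by blast
  qed
  then have finN: "finite N" by (auto simp: N_def poly_roots_finite)
  from match_roots[OF iso fin der crit sgnZ finN] obtain \<psi> where
    \<psi>: "order_iso \<psi>" "\<And>z. z \<in> Z \<Longrightarrow> \<psi> z = \<phi> z" "\<And>\<rho>. \<rho> \<in> N \<Longrightarrow> poly p' (\<psi> \<rho>) = 0"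
    by (auto simp: N_def)
  have der': "sgn (poly (pderiv p) t) = sgn (poly (pderiv p') (\<psi> t))" for t
    by (rule sgn_matched_transfer[OF iso \<psi>(1) \<psi>(2) crit der])
  have crit': "z \<in> Z" if "poly (pderiv p') (\<psi> z) = 0" for z
    using der'[of z] that crit by (metis sgn_0_0)
  have sgnZ': "sgn (poly p z) = sgn (poly p' (\<psi> z))" if "z \<in> Z" for z using sgnZ \<psi>(2) that by simp
  have i: "inv \<psi> (\<psi> t) = t" for t using \<psi>(1) by (simp add: order_iso_def strict_mono_imp_inj_on)
  have i': "\<psi> (inv \<psi> t) = t" for t using \<psi>(1) by (simp add: order_iso_def surj_f_inv_f)
  \<comment> \<open>The converse direction: \<open>matched_root\<close> is applied to the inverse
    map with \<open>p\<close> and \<open>p'\<close> exchanged. It yields a root \<rho> of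
    \<open>p\<close> in the gap of t. The image of \<rho> is a root of \<open>p'\<close>, and by
    Rolle one gap cannot contain two roots of \<open>p'\<close>, so t = \<rho>.\<close>
  have roots': "poly p t = 0" if t: "poly p' (\<psi> t) = 0" for t
  proof (cases "t \<in> Z")
    case True
    then show ?thesis using sgnZ'[OF True] t by (metis sgn_0_0)
  next
    case False
    have "\<exists>\<rho>. poly p \<rho> = 0 \<and> (\<forall>z\<in>\<psi> ` Z. (z < \<psi> t \<longleftrightarrow> inv \<psi> z < \<rho>) \<and> inv \<psi> z \<noteq> \<rho>)"
    proof (rule matched_root)
      show "order_iso (inv \<psi>)" using order_iso_inv \<psi>(1) .
      show "s \<in> \<psi> ` Z" if "poly (pderiv p') s = 0" for s
        using crit'[of "inv \<psi> s"] that i'[of s] by (metis image_eqI)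
      show "sgn (poly (pderiv p') s) = sgn (poly (pderiv p) (inv \<psi> s))" for s using der'[of "inv \<psi> s"] i' by simp
      show "\<psi> t \<notin> \<psi> ` Z" using False order_iso_eq[OF \<psi>(1)] by auto
    qed (use fin sgnZ' i t in auto)
    then obtain \<rho> where \<rho>: "poly p \<rho> = 0" "\<And>z. z \<in> Z \<Longrightarrow> (z < t \<longleftrightarrow> z < \<rho>) \<and> z \<noteq> \<rho>"
      using i order_iso_less[OF \<psi>(1)] by auto
    then have "\<rho> \<in> N" by (auto simp: N_def)
    then have z0: "poly p' (\<psi> \<rho>) = 0" using \<psi> by blast
    have "t = \<rho>"
    proof (rule ccontr)
      assume "t \<noteq> \<rho>"
      then have "\<exists>s. poly (pderiv p') s = 0 \<and> (\<psi> t < s \<and> s < \<psi> \<rho> \<or> \<psi> \<rho> < s \<and> s < \<psi> t)"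
        using poly_MVT[of "\<psi> t" "\<psi> \<rho>" p'] poly_MVT[of "\<psi> \<rho>" "\<psi> t" p'] t z0 order_iso_less[OF \<psi>(1)]
        by (cases "t < \<rho>") fastforce+
      then obtain z where "z \<in> Z" "t < z \<and> z < \<rho> \<or> \<rho> < z \<and> z < t"
        using crit' order_iso_less[OF \<psi>(1)] by (metis i')
      then show False using \<rho>(2)[of z] by auto
    qed
    then show ?thesis using \<rho> by simp
  qed
  have roots: "poly p' (\<psi> t) = 0" if "poly p t = 0" for t
    using that \<psi>(3)[of t] sgnZ'[of t] by (cases "t \<in> Z") (auto simp: N_def, metis sgn_0_0 sgn_0)
  have "sgn (poly p t) = sgn (poly p' (\<psi> t))" for t
  proof (cases "t \<in> Z \<or> poly p t = 0")
    case True
    then show ?thesis using sgnZ' roots by auto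
  next
    case False
    \<comment> \<open>The sign at t is read off at the nearest point s of Z or N below t. It
      persists from s if s is no root; it is the sign of the derivative between s and t if s is a
      root; without such an s it comes from the behaviour at minus infinity.\<close>
    show ?thesis
    proof (cases "{s \<in> Z \<union> N. s < t} = {}")
      case True
      have above: "x \<notin> Z \<and> poly p x \<noteq> 0" if "x \<le> t" for x using that True False by (fastforce simp: N_def)
      obtain a where a: "a < t" "sgn (poly p a) = - sgn (poly (pderiv p) t)"
        using sgn_poly_below[of t p] above crit by blast
      have "poly (pderiv p') y \<noteq> 0" if "y \<le> \<psi> t" for y
        using crit'[of "inv \<psi> y"] above[of "inv \<psi> y"] that order_iso_less[OF \<psi>(1), of t "inv \<psi> y"] i' by force
      then obtain a' where a': "a' < \<psi> t" "sgn (poly p' a') = - sgn (poly (pderiv p') (\<psi> t))"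
        using sgn_poly_below[of "\<psi> t" p'] by blast
      have "sgn (poly p a) = sgn (poly p t)" using above a by (intro sgn_poly_constant) auto
      moreover have "sgn (poly p' a') = sgn (poly p' (\<psi> t))"
      proof (rule sgn_poly_constant)
        fix x assume "x \<le> \<psi> t"
        then show "poly p' x \<noteq> 0" using roots'[of "inv \<psi> x"] above[of "inv \<psi> x"] i' order_iso_less[OF \<psi>(1), of t "inv \<psi> x"] by force
      qed (use a' in auto)
      ultimately show ?thesis using a a' der'[of t] by simp
    next
      case nonempty: False
      define s where "s = Max {s \<in> Z \<union> N. s < t}"
      have "s \<in> {s \<in> Z \<union> N. s < t}" unfolding s_def using nonempty fin finN by (intro Max_in) auto
      then have s: "s \<in> Z \<union> N" "s < t" by auto
      have between: "x \<notin> Z \<and> poly p x \<noteq> 0" if "s < x" "x \<le> t" for x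
      proof (cases "x = t")
        case True
        then show ?thesis using False by auto
      next
        case ne: False
        have "x \<notin> Z \<union> N"
        proof
          assume "x \<in> Z \<union> N"
          then have "x \<le> s" unfolding s_def using fin finN that ne by (intro Max_ge) auto
          then show False using that by auto
        qed
        then show ?thesis by (auto simp: N_def)
      qed
      show ?thesis
      proof (cases "poly p s = 0")
        case True
        obtain \<xi> where \<xi>: "s < \<xi>" "\<xi> < t" "poly p t - poly p s = (t - s) * poly (pderiv p) \<xi>"
          using poly_MVT[OF s(2)] by blast
        obtain \<eta> where \<eta>: "\<psi> s < \<eta>" "\<eta> < \<psi> t" "poly p' (\<psi> t) - poly p' (\<psi> s) = (\<psi> t - \<psi> s) * poly (pderiv p') \<eta>"
          using poly_MVT[of "\<psi> s" "\<psi> t"] s order_iso_less[OF \<psi>(1)] by blast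
        obtain y where y: "\<eta> = \<psi> y" by (rule order_iso_obtain[OF \<psi>(1)])
        then have sy: "s < y" "y < t" using \<eta> order_iso_less[OF \<psi>(1)] by auto
        have const: "sgn (poly (pderiv p) x) = sgn (poly (pderiv p) t)" if "s < x" "x < t" for x
          by (rule sgn_poly_constant) (use that between crit in force)+
        have "sgn (poly p t) = sgn (poly (pderiv p) t)" using \<xi> True const[of \<xi>] s by (simp add: sgn_mult)
        moreover have "sgn (poly p' (\<psi> t)) = sgn (poly (pderiv p) t)"
          using \<eta> roots[OF True] const[OF sy] der'[of y] y by (simp add: sgn_mult)
        ultimately show ?thesis by simp
      next
        case nz: False
        then have "s \<in> Z" using s by (auto simp: N_def)
        have "sgn (poly p s) = sgn (poly p t)"
          by (rule sgn_poly_constant) (use between nz s order_le_less in blast)+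
        moreover have "sgn (poly p' (\<psi> s)) = sgn (poly p' (\<psi> t))"
        proof (rule sgn_poly_constant)
          fix x assume x: "\<psi> s \<le> x" "x \<le> \<psi> t"
          obtain y where y: "x = \<psi> y" by (rule order_iso_obtain[OF \<psi>(1)])
          then have "s \<le> y" "y \<le> t" using x order_iso_less[OF \<psi>(1)] by (meson not_le)+
          then have "poly p y \<noteq> 0" using between[of y] nz by (cases "y = s") auto
          then show "poly p' x \<noteq> 0" using roots'[of y] y by auto
        qed (use s order_iso_less[OF \<psi>(1), of s t] in auto)
        ultimately show ?thesis using sgnZ'[OF \<open>s \<in> Z\<close>] by simp
      qed
    qed
  qed
  then show ?thesis using \<psi> by blast
qed

section \<open>Projections of sets defined by sign conditions\<close>

text \<open>The Boolean algebra of \<open>semialgebraic\<close>, but without an ambient coordinate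
  space and over any set A of functions: complements become plain \<open>-\<close>, and the
  elimination can be carried out over an abstract ring of functions of the parameters.\<close>

inductive_set sign_algebra :: "('a \<Rightarrow> real) set \<Rightarrow> 'a set set" for A :: "('a \<Rightarrow> real) set" where
  pos: "f \<in> A \<Longrightarrow> {x. f x > 0} \<in> sign_algebra A"
| compl: "S \<in> sign_algebra A \<Longrightarrow> - S \<in> sign_algebra A"
| union: "S \<in> sign_algebra A \<Longrightarrow> T \<in> sign_algebra A \<Longrightarrow> S \<union> T \<in> sign_algebra A"

lemma sign_algebra_Int: "S \<in> sign_algebra A \<Longrightarrow> T \<in> sign_algebra A \<Longrightarrow> S \<inter> T \<in> sign_algebra A"
  using sign_algebra.compl[OF sign_algebra.union[OF sign_algebra.compl sign_algebra.compl], of S A T] by simp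

locale function_ring =
  fixes A :: "('a \<Rightarrow> real) set"
  assumes const: "(\<lambda>x. a) \<in> A"
    and add: "f \<in> A \<Longrightarrow> g \<in> A \<Longrightarrow> (\<lambda>x. f x + g x) \<in> A"
    and mult: "f \<in> A \<Longrightarrow> g \<in> A \<Longrightarrow> (\<lambda>x. f x * g x) \<in> A"
begin

lemma uminus: "f \<in> A \<Longrightarrow> (\<lambda>x. - f x) \<in> A"
  using mult[OF const[of "- 1"]] by simp

lemma sign_UNIV: "UNIV \<in> sign_algebra A"
  using sign_algebra.pos[OF const[of 1]] by simp

lemma sign_empty: "{} \<in> sign_algebra A"
  using sign_algebra.compl[OF sign_UNIV] by simp

lemma sign_zero: "f \<in> A \<Longrightarrow> {x. f x = 0} \<in> sign_algebra A"
proof -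
  assume f: "f \<in> A"
  have "{x. f x = 0} = - ({x. f x > 0} \<union> {x. - f x > 0})" by auto
  also have "\<dots> \<in> sign_algebra A" using f uminus by (intro sign_algebra.intros)
  finally show ?thesis .
qed

lemma sign_INT: "finite T \<Longrightarrow> (\<And>t. t \<in> T \<Longrightarrow> S t \<in> sign_algebra A) \<Longrightarrow> (\<Inter>t\<in>T. S t) \<in> sign_algebra A"
  by (induction T rule: finite_induct) (auto intro: sign_UNIV sign_algebra_Int)

text \<open>Finitely many sets cut the space into finitely many atoms, and X is a union of atoms.
  The induction splits X along S; \<open>Y\<close> is the saturation of either half with respect to
  the remaining sets.\<close>

lemma sign_saturated:
  assumes "finite \<S>" "\<S> \<subseteq> sign_algebra A"
    and "\<And>x y. (\<And>S. S \<in> \<S> \<Longrightarrow> x \<in> S \<longleftrightarrow> y \<in> S) \<Longrightarrow> x \<in> X \<Longrightarrow> y \<in> X"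
  shows "X \<in> sign_algebra A"
  using assms
proof (induction \<S> arbitrary: X rule: finite_induct)
  case empty
  then have "X = {} \<or> X = UNIV" by auto
  then show ?case using sign_empty sign_UNIV by auto
next
  case (insert S \<S>)
  define Y where "Y B = {y. \<exists>x\<in>X \<inter> B. \<forall>T\<in>\<S>. x \<in> T \<longleftrightarrow> y \<in> T}" for B
  have "Y B \<in> sign_algebra A" for B by (rule insert.IH) (use insert.prems in \<open>auto simp: Y_def\<close>)
  moreover have "S \<in> sign_algebra A" using insert.prems by auto
  moreover have "X = Y S \<inter> S \<union> Y (- S) \<inter> - S"
  proof
    show "X \<subseteq> Y S \<inter> S \<union> Y (- S) \<inter> - S" by (auto simp: Y_def)
    have "x \<in> X" if "x \<in> Y S \<inter> S \<union> Y (- S) \<inter> - S" for x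
    proof -
      obtain y where "y \<in> X" "\<forall>T\<in>\<S>. y \<in> T \<longleftrightarrow> x \<in> T" "y \<in> S \<longleftrightarrow> x \<in> S" using \<open>x \<in> _\<close> by (auto simp: Y_def)
      then show ?thesis using insert.prems(2)[of y x] by blast
    qed
    then show "Y S \<inter> S \<union> Y (- S) \<inter> - S \<subseteq> X" by blast
  qed
  ultimately show ?case
    by (metis sign_algebra.compl sign_algebra.union sign_algebra_Int)
qed

end

text \<open>Since \<open>g x / 0 = 0\<close>, quotients need no side condition on the denominator.\<close>

inductive_set rat_funs :: "('a \<Rightarrow> real) set \<Rightarrow> ('a \<Rightarrow> real) set" for A :: "('a \<Rightarrow> real) set" where
  quot: "g \<in> A \<Longrightarrow> h \<in> A \<Longrightarrow> (\<lambda>x. g x / h x) \<in> rat_funs A"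
| cond: "S \<in> sign_algebra A \<Longrightarrow> f \<in> rat_funs A \<Longrightarrow> g \<in> rat_funs A \<Longrightarrow>
    (\<lambda>x. if x \<in> S then f x else g x) \<in> rat_funs A"

context function_ring
begin

lemma rat_base: "f \<in> A \<Longrightarrow> f \<in> rat_funs A"
  using rat_funs.quot[OF _ const[of 1], of f] by simp

lemma rat_binop:
  assumes base: "\<And>g h g' h'. g \<in> A \<Longrightarrow> h \<in> A \<Longrightarrow> g' \<in> A \<Longrightarrow> h' \<in> A \<Longrightarrow>
      (\<lambda>x. B (g x / h x) (g' x / h' x)) \<in> rat_funs A"
    and "f1 \<in> rat_funs A" "f2 \<in> rat_funs A"
  shows "(\<lambda>x. B (f1 x) (f2 x) :: real) \<in> rat_funs A"
  using assms(2)
proof induction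
  case (quot g h)
  show ?case using assms(3)
  proof induction
    case (quot g' h')
    then show ?case using base \<open>g \<in> A\<close> \<open>h \<in> A\<close> by blast
  next
    case (cond S f g')
    have "(\<lambda>x. B (g x / h x) (if x \<in> S then f x else g' x)) =
       (\<lambda>x. if x \<in> S then B (g x / h x) (f x) else B (g x / h x) (g' x))" by auto
    then show ?case using rat_funs.cond[OF cond(1,4,5)] by simp
  qed
next
  case (cond S f g)
  have "(\<lambda>x. B (if x \<in> S then f x else g x) (f2 x)) =
       (\<lambda>x. if x \<in> S then B (f x) (f2 x) else B (g x) (f2 x))" by auto
  then show ?case using rat_funs.cond[OF cond(1,4,5)] by simp
qed

lemma rat_add:
  assumes "f1 \<in> rat_funs A" "f2 \<in> rat_funs A" shows "(\<lambda>x. f1 x + f2 x) \<in> rat_funs A"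
proof (rule rat_binop[OF _ assms])
  fix g h g' h' assume *: "g \<in> A" "h \<in> A" "g' \<in> A" "h' \<in> A"
  have "(\<lambda>x. g x / h x + g' x / h' x) = (\<lambda>x. if x \<in> {x. h x = 0} then g' x / h' x else
      if x \<in> {x. h' x = 0} then g x / h x else (g x * h' x + g' x * h x) / (h x * h' x))"
    by (auto simp: add_frac_eq)
  also have "\<dots> \<in> rat_funs A"
    using * by (intro rat_funs.intros sign_zero add mult)
  finally show "(\<lambda>x. g x / h x + g' x / h' x) \<in> rat_funs A" .
qed

lemma rat_mult:
  assumes "f1 \<in> rat_funs A" "f2 \<in> rat_funs A" shows "(\<lambda>x. f1 x * f2 x) \<in> rat_funs A"
proof (rule rat_binop[OF _ assms])
  fix g h g' h' assume *: "g \<in> A" "h \<in> A" "g' \<in> A" "h' \<in> A"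
  then show "(\<lambda>x. g x / h x * (g' x / h' x)) \<in> rat_funs A"
    using rat_funs.quot[OF mult mult, of g g' h h'] by simp
qed

lemma rat_divide:
  assumes "f1 \<in> rat_funs A" "f2 \<in> rat_funs A" shows "(\<lambda>x. f1 x / f2 x) \<in> rat_funs A"
proof (rule rat_binop[OF _ assms])
  fix g h g' h' assume *: "g \<in> A" "h \<in> A" "g' \<in> A" "h' \<in> A"
  then show "(\<lambda>x. g x / h x / (g' x / h' x)) \<in> rat_funs A"
    using rat_funs.quot[OF mult mult, of g h' h g'] by simp
qed

lemma rat_const: "(\<lambda>x. a) \<in> rat_funs A" by (rule rat_base[OF const])

lemma rat_uminus: "f \<in> rat_funs A \<Longrightarrow> (\<lambda>x. - f x) \<in> rat_funs A"
  using rat_mult[OF rat_const[of "- 1"]] by simp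

lemma rat_diff: "f \<in> rat_funs A \<Longrightarrow> g \<in> rat_funs A \<Longrightarrow> (\<lambda>x. f x - g x) \<in> rat_funs A"
  using rat_add[OF _ rat_uminus] by simp

lemma rat_sum: "(\<And>i. i \<in> I \<Longrightarrow> f i \<in> rat_funs A) \<Longrightarrow> (\<lambda>x. \<Sum>i\<in>I. f i x) \<in> rat_funs A"
  by (induction I rule: infinite_finite_induct) (auto intro: rat_const rat_add)

lemma rat_pos: "f \<in> rat_funs A \<Longrightarrow> {x. f x > 0} \<in> sign_algebra A"
proof (induction rule: rat_funs.induct)
  case (quot g h)
  have "{x. g x / h x > 0} = {x. g x * h x > 0}" by (auto simp: zero_less_divide_iff zero_less_mult_iff)
  then show ?case using sign_algebra.pos[OF mult[OF quot]] by simp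
next
  case (cond S f g)
  have "{x. (if x \<in> S then f x else g x) > 0} = (S \<inter> {x. f x > 0}) \<union> (- S \<inter> {x. g x > 0})" by auto
  then show ?case using cond by (simp add: sign_algebra.union sign_algebra.compl sign_algebra_Int)
qed

lemma rat_zero: "f \<in> rat_funs A \<Longrightarrow> {x. f x = 0} \<in> sign_algebra A"
proof -
  assume f: "f \<in> rat_funs A"
  have "{x. f x = 0} = - ({x. f x > 0} \<union> {x. - f x > 0})" by auto
  also have "\<dots> \<in> sign_algebra A"
    using rat_pos[OF f] rat_pos[OF rat_uminus[OF f]] by (intro sign_algebra.compl sign_algebra.union)
  finally show ?thesis .
qed

section \<open>Univariate polynomials with piecewise rational coefficients\<close>

text \<open>Only a bound for the degree is fixed, since the degree may drop at special parameters.
  Such drops turn into case distinctions under division with remainder, which is why the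
  coefficients range over \<open>rat_funs\<close> and not over A.\<close>

definition poly_family :: "nat \<Rightarrow> ('a \<Rightarrow> real poly) \<Rightarrow> bool" where
  "poly_family n P \<longleftrightarrow> (\<forall>x. degree (P x) \<le> n) \<and> (\<forall>i. (\<lambda>x. coeff (P x) i) \<in> rat_funs A)"

lemma poly_family_mono: "poly_family n P \<Longrightarrow> n \<le> m \<Longrightarrow> poly_family m P"
  unfolding poly_family_def by (meson le_trans)

lemma poly_family_const: "f \<in> rat_funs A \<Longrightarrow> poly_family 0 (\<lambda>x. [:f x:])"
proof -
  assume "f \<in> rat_funs A"
  then have "(\<lambda>x. coeff [:f x:] i) \<in> rat_funs A" for i by (cases i) (auto simp: rat_const)
  then show ?thesis by (auto simp: poly_family_def)
qed

lemma poly_family_pderiv: "poly_family n P \<Longrightarrow> poly_family (n - 1) (\<lambda>x. pderiv (P x))"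
  by (auto simp: poly_family_def degree_pderiv coeff_pderiv intro!: rat_mult rat_add rat_const diff_le_mono)

lemma poly_family_cond:
  "S \<in> sign_algebra A \<Longrightarrow> poly_family n P \<Longrightarrow> poly_family n Q \<Longrightarrow> poly_family n (\<lambda>x. if x \<in> S then P x else Q x)"
proof -
  assume *: "S \<in> sign_algebra A" "poly_family n P" "poly_family n Q"
  have "(\<lambda>x. coeff (if x \<in> S then P x else Q x) i) = (\<lambda>x. if x \<in> S then coeff (P x) i else coeff (Q x) i)" for i
    by auto
  then show ?thesis using * by (auto simp: poly_family_def intro: rat_funs.cond)
qed

lemma poly_family_add: "poly_family n P \<Longrightarrow> poly_family m Q \<Longrightarrow> poly_family (max n m) (\<lambda>x. P x + Q x)"
  by (auto simp: poly_family_def intro!: rat_add degree_add_le intro: max.coboundedI1 max.coboundedI2)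

lemma poly_family_diff: "poly_family n P \<Longrightarrow> poly_family m Q \<Longrightarrow> poly_family (max n m) (\<lambda>x. P x - Q x)"
  by (auto simp: poly_family_def intro!: rat_diff degree_diff_le intro: max.coboundedI1 max.coboundedI2)

lemma poly_family_mult: "poly_family n P \<Longrightarrow> poly_family m Q \<Longrightarrow> poly_family (n + m) (\<lambda>x. P x * Q x)"
  unfolding poly_family_def coeff_mult
  by (auto intro!: rat_sum rat_mult) (meson add_mono degree_mult_le le_trans)

lemma poly_family_monom: "f \<in> rat_funs A \<Longrightarrow> poly_family n (\<lambda>x. monom (f x) n)"
proof -
  assume "f \<in> rat_funs A"
  then have "(\<lambda>x. if n = i then f x else 0) \<in> rat_funs A" for i by (cases "n = i") (auto simp: rat_const)
  then show ?thesis by (auto simp: poly_family_def degree_monom_le)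
qed

lemma poly_family_degree: 
  assumes "poly_family n Q" shows "{x. Q x \<noteq> 0 \<and> degree (Q x) = l} \<in> sign_algebra A"
proof -
  have "{x. Q x \<noteq> 0 \<and> degree (Q x) = l} = - {x. coeff (Q x) l = 0} \<inter> (\<Inter>i\<in>{l<..n}. {x. coeff (Q x) i = 0})"
  proof (intro set_eqI iffI)
    fix x assume x: "x \<in> - {x. coeff (Q x) l = 0} \<inter> (\<Inter>i\<in>{l<..n}. {x. coeff (Q x) i = 0})"
    have "degree (Q x) \<le> n" using assms by (auto simp: poly_family_def)
    then have "coeff (Q x) i = 0" if "i > l" for i
      using that x by (cases "i \<le> n") (auto intro: coeff_eq_0)
    then have "degree (Q x) \<le> l" by (intro degree_le) auto
    moreover have "l \<le> degree (Q x)" using x by (intro le_degree) auto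
    ultimately show "x \<in> {x. Q x \<noteq> 0 \<and> degree (Q x) = l}" using x by auto
  qed (auto intro: coeff_eq_0)
  also have "\<dots> \<in> sign_algebra A" using assms
    by (intro sign_algebra_Int sign_algebra.compl sign_INT rat_zero) (auto simp: poly_family_def)
  finally show ?thesis .
qed

lemma poly_family_zero: "poly_family n (\<lambda>x. 0)"
  by (simp add: poly_family_def rat_const)

text \<open>Where \<open>Q\<close> has degree exactly l, its coefficient at l is nonzero and one
  step of long division is given by the same formula for all parameters. Elsewhere \<open>P'\<close>
  is set to 0, which keeps the degree bound for the induction.\<close>

lemma poly_family_mod_fixed_degree:
  assumes Q: "poly_family m Q"
  shows "poly_family n P \<Longrightarrow> \<exists>R. poly_family n R \<and> (\<forall>x. Q x \<noteq> 0 \<and> degree (Q x) = l \<longrightarrow> R x = P x mod Q x)"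
proof (induction n arbitrary: P)
  case 0
  show ?case
  proof (cases "l = 0")
    case True
    have "P x mod Q x = 0" if "Q x \<noteq> 0" "degree (Q x) = 0" for x
    proof -
      have "Q x dvd 1" using that by (simp add: is_unit_iff_degree)
      then show ?thesis by (rule dvd_imp_mod_0[OF unit_imp_dvd])
    qed
    then show ?thesis using True
      by (intro exI[of _ "\<lambda>x. 0"]) (simp add: poly_family_zero)
  next
    case False
    have "degree (P x) = 0" for x using 0 by (simp add: poly_family_def)
    then have "P x mod Q x = P x" if "degree (Q x) = l" for x using False that by (intro mod_poly_less) simp
    then show ?thesis using 0 by (intro exI[of _ P]) simp
  qed
next
  case (Suc n)
  show ?case
  proof (cases "Suc n < l")
    case True
    moreover have "degree (P x) \<le> Suc n" for x using Suc.prems by (simp add: poly_family_def)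
    ultimately have "P x mod Q x = P x" if "degree (Q x) = l" for x
      using that by (intro mod_poly_less) (metis le_less_trans)
    then show ?thesis using Suc.prems by (intro exI[of _ P]) simp
  next
    case False
    define E where "E = {x. Q x \<noteq> 0 \<and> degree (Q x) = l}"
    have E: "E \<in> sign_algebra A" using poly_family_degree[OF Q] by (simp add: E_def)
    define c where "c x = coeff (P x) (Suc n) / coeff (Q x) l" for x
    define P' where "P' x = (if x \<in> E then P x - monom (c x) (Suc n - l) * Q x else 0)" for x
    have "c \<in> rat_funs A" unfolding c_def
      using Suc.prems Q by (auto simp: poly_family_def intro!: rat_divide)
    from poly_family_cond[OF E poly_family_diff[OF Suc.prems poly_family_mult[OF poly_family_monom[OF this] Q]] poly_family_zero]
    have "poly_family (max (Suc n) (Suc n - l + m)) P'" unfolding P'_def .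
    moreover have "degree (P' x) \<le> n" for x
    proof (cases "x \<in> E")
      case True
      then have Qx: "Q x \<noteq> 0" "degree (Q x) = l" by (auto simp: E_def)
      have *: "P' x = P x - monom (c x) (Suc n - l) * Q x" using True by (simp add: P'_def)
      have "degree (monom (c x) (Suc n - l) * Q x) \<le> Suc n"
        using False Qx degree_mult_le[of "monom (c x) (Suc n - l)" "Q x"] degree_monom_le[of "c x" "Suc n - l"] by linarith
      then have "degree (P' x) \<le> Suc n" using Suc.prems * by (auto simp: poly_family_def intro!: degree_diff_le)
      moreover have "coeff (P' x) (Suc n) = 0"
        using False Qx by (auto simp: * coeff_monom_mult c_def)
      ultimately show ?thesis by (metis degree_0 le_SucE leading_coeff_0_iff le0)
    qed (simp add: P'_def)
    ultimately have "poly_family n P'" by (auto simp: poly_family_def)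
    from Suc.IH[OF this] obtain R where R: "poly_family n R" "\<And>x. x \<in> E \<Longrightarrow> R x = P' x mod Q x"
      by (auto simp: E_def)
    have "P' x mod Q x = P x mod Q x" if "x \<in> E" for x
    proof -
      have "P' x = P x + Q x * - monom (c x) (Suc n - l)" using that by (simp add: P'_def algebra_simps)
      then show ?thesis by (simp only: mod_mult_self2)
    qed
    then have "\<forall>x. Q x \<noteq> 0 \<and> degree (Q x) = l \<longrightarrow> R x = P x mod Q x" using R(2) by (simp add: E_def)
    then show ?thesis using poly_family_mono[OF R(1), of "Suc n"] by (intro exI[of _ R] conjI) simp_all
  qed
qed

lemma poly_family_sum:
  "(\<And>i. i \<in> I \<Longrightarrow> poly_family n (P i)) \<Longrightarrow> poly_family n (\<lambda>x. \<Sum>i\<in>I. P i x)"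
proof (induction I rule: infinite_finite_induct)
  case (insert i I)
  then show ?case using poly_family_add[of n "P i" n] by simp
qed (auto simp: poly_family_def rat_const)

text \<open>The remainder is set to \<open>0\<close> where the divisor vanishes, so that its degree always drops.\<close>

lemma poly_family_mod:
  assumes P: "poly_family n P" and Q: "poly_family m Q"
  shows "poly_family (m - 1) (\<lambda>x. if Q x = 0 then 0 else P x mod Q x)"
proof -
  obtain R where R: "\<And>l. poly_family n (R l)" "\<And>l x. Q x \<noteq> 0 \<and> degree (Q x) = l \<Longrightarrow> R l x = P x mod Q x"
    using poly_family_mod_fixed_degree[OF Q P] by metis
  have eq: "(\<lambda>x. if Q x = 0 then 0 else P x mod Q x) =
     (\<lambda>x. \<Sum>l\<le>m. if x \<in> {x. Q x \<noteq> 0 \<and> degree (Q x) = l} then R l x else 0)"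
  proof
    fix x
    have d: "degree (Q x) \<le> m" using Q by (auto simp: poly_family_def)
    show "(if Q x = 0 then 0 else P x mod Q x) = (\<Sum>l\<le>m. if x \<in> {x. Q x \<noteq> 0 \<and> degree (Q x) = l} then R l x else 0)"
    proof (cases "Q x = 0")
      case False
      then have "(\<Sum>l\<le>m. if x \<in> {x. Q x \<noteq> 0 \<and> degree (Q x) = l} then R l x else 0) = (\<Sum>l\<le>m. if degree (Q x) = l then R l x else 0)"
        by (intro sum.cong) auto
      then show ?thesis using False d R(2)[of x] by simp
    qed simp
  qed
  have *: "poly_family n (\<lambda>x. if Q x = 0 then 0 else P x mod Q x)"
    unfolding eq by (rule poly_family_sum, rule poly_family_cond[OF poly_family_degree[OF Q] R(1) poly_family_zero])
  have "degree (P x mod Q x) \<le> m - 1" if "Q x \<noteq> 0" for x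
  proof -
    have "P x mod Q x = 0 \<or> degree (P x mod Q x) < degree (Q x)" using that degree_mod_less by blast
    moreover have "degree (Q x) \<le> m" using Q by (auto simp: poly_family_def)
    ultimately show ?thesis by auto
  qed
  with * show ?thesis by (auto simp: poly_family_def)
qed

section \<open>Sign patterns of finite families along the line\<close>

text \<open>Finitely many conditions on the parameters determine the signs of all members along the
  line up to an increasing change of variable. That is enough to decide whether a point with
  prescribed signs exists.\<close>

definition tame :: "('a \<Rightarrow> real poly) set \<Rightarrow> bool" where
  "tame \<P> \<longleftrightarrow> (\<exists>\<S>. finite \<S> \<and> \<S> \<subseteq> sign_algebra A \<and> (\<forall>x y. (\<forall>S\<in>\<S>. x \<in> S \<longleftrightarrow> y \<in> S) \<longrightarrow>
     (\<exists>\<phi>. order_iso \<phi> \<and> (\<forall>P\<in>\<P>. \<forall>t. sgn (poly (P x) t) = sgn (poly (P y) (\<phi> t))))))"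

lemma tame_constant:
  assumes "finite \<P>" "\<And>P. P \<in> \<P> \<Longrightarrow> poly_family 0 P"
  shows "tame \<P>"
  unfolding tame_def
proof (intro exI conjI allI impI)
  let ?\<S> = "(\<lambda>P. {x. coeff (P x) 0 > 0}) ` \<P> \<union> (\<lambda>P. {x. coeff (P x) 0 = 0}) ` \<P>"
  show "finite ?\<S>" using assms by auto
  show "?\<S> \<subseteq> sign_algebra A" using assms(2) by (auto simp: poly_family_def intro!: rat_pos rat_zero)
  fix x y assume xy: "\<forall>S\<in>?\<S>. x \<in> S \<longleftrightarrow> y \<in> S"
  have *: "sgn (coeff (P x) 0) = sgn (coeff (P y) 0)" if "P \<in> \<P>" for P
  proof -
    have "x \<in> {x. coeff (P x) 0 > 0} \<longleftrightarrow> y \<in> {x. coeff (P x) 0 > 0}"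
      by (rule bspec[OF xy]) (use that in blast)
    moreover have "x \<in> {x. coeff (P x) 0 = 0} \<longleftrightarrow> y \<in> {x. coeff (P x) 0 = 0}"
      by (rule bspec[OF xy]) (use that in blast)
    ultimately show ?thesis by (simp add: sgn_if)
  qed
  have **: "P x = [:coeff (P x) 0:]" if "P \<in> \<P>" for P x
  proof -
    have "degree (P x) = 0" using assms(2)[OF that] by (simp add: poly_family_def)
    then show ?thesis by (metis coeff_pCons_0 degree_eq_zeroE)
  qed
  have "sgn (poly (P x) t) = sgn (poly (P y) t)" if "P \<in> \<P>" for P t
    by (subst **[OF that, of x], subst **[OF that, of y]) (simp add: *[OF that])
  then show "order_iso (\<lambda>t. t)" "\<forall>P\<in>\<P>. \<forall>t. sgn (poly (P x) t) = sgn (poly (P y) t)"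
    using order_iso_id by blast+
qed

text \<open>At a root z of \<open>Q\<close> the value of \<open>P\<close> equals that of
  \<open>P mod Q\<close>. So the remainders supply the signs of \<open>P\<close> at the roots of its
  derivative and of the other members, as \<open>sgn_matched_extend\<close> requires. The constant
  coefficient settles the case in which the derivative vanishes identically.\<close>

lemma tame_extend:
  assumes fin: "finite \<P>"
    and tame: "tame (insert (\<lambda>x. [:coeff (P x) 0:]) (insert (\<lambda>x. pderiv (P x)) \<P> \<union>
       (\<lambda>Q x. if Q x = 0 then 0 else P x mod Q x) ` (insert (\<lambda>x. pderiv (P x)) \<P>)))"
  shows "tame (insert P \<P>)"
proof -
  let ?\<P> = "insert (\<lambda>x. pderiv (P x)) \<P>"
  obtain \<S> where \<S>: "finite \<S>" "\<S> \<subseteq> sign_algebra A"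
    and eq: "\<forall>x y. (\<forall>S\<in>\<S>. x \<in> S \<longleftrightarrow> y \<in> S) \<longrightarrow>
     (\<exists>\<phi>. order_iso \<phi> \<and> (\<forall>R\<in>insert (\<lambda>x. [:coeff (P x) 0:]) (?\<P> \<union> (\<lambda>Q x. if Q x = 0 then 0 else P x mod Q x) ` ?\<P>).
       \<forall>t. sgn (poly (R x) t) = sgn (poly (R y) (\<phi> t))))"
    using tame unfolding tame_def by (elim exE conjE) (rule that)
  have "\<exists>\<psi>. order_iso \<psi> \<and> (\<forall>Q\<in>insert P \<P>. \<forall>t. sgn (poly (Q x) t) = sgn (poly (Q y) (\<psi> t)))"
    if xy: "\<forall>S\<in>\<S>. x \<in> S \<longleftrightarrow> y \<in> S" for x y
  proof -
    obtain \<phi> where \<phi>: "order_iso \<phi>"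
      and R: "\<forall>R\<in>insert (\<lambda>x. [:coeff (P x) 0:]) (?\<P> \<union> (\<lambda>Q x. if Q x = 0 then 0 else P x mod Q x) ` ?\<P>).
       \<forall>t. sgn (poly (R x) t) = sgn (poly (R y) (\<phi> t))"
      using eq[THEN spec, THEN spec, THEN mp, OF xy] by (elim exE conjE) (rule that)
    have const: "sgn (coeff (P x) 0) = sgn (coeff (P y) 0)"
      using R[THEN bspec, OF insertI1, THEN spec, of 0] by simp
    have sgnQ: "sgn (poly (Q x) t) = sgn (poly (Q y) (\<phi> t))" if "Q \<in> ?\<P>" for Q t
      by (rule R[THEN bspec, OF insertI2[OF UnI1[OF that]], THEN spec])
    have sgnR: "sgn (poly (if Q x = 0 then 0 else P x mod Q x) t) = sgn (poly (if Q y = 0 then 0 else P y mod Q y) (\<phi> t))"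
      if "Q \<in> ?\<P>" for Q t
      by (rule R[THEN bspec, OF insertI2[OF UnI2[OF imageI[OF that]]], THEN spec])
    have zero: "Q x = 0 \<longleftrightarrow> Q y = 0" if "Q \<in> ?\<P>" for Q
    proof -
      have "poly (Q x) t = 0 \<longleftrightarrow> poly (Q y) (\<phi> t) = 0" for t using sgnQ[OF that, of t] by (metis sgn_0_0)
      moreover have "\<exists>t. s = \<phi> t" for s using \<phi> by (auto simp: order_iso_def surj_def)
      ultimately show ?thesis by (metis poly_0 poly_eq_poly_eq_iff ext)
    qed
    have der: "sgn (poly (pderiv (P x)) t) = sgn (poly (pderiv (P y)) (\<phi> t))" for t
      using sgnQ[of "\<lambda>x. pderiv (P x)"] by simp
    show ?thesis
    proof (cases "pderiv (P x) = 0")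
      case True
      moreover then have "pderiv (P y) = 0" using zero[of "\<lambda>x. pderiv (P x)"] by simp
      ultimately have "degree (P x) = 0" "degree (P y) = 0" by (auto simp: pderiv_eq_0_iff)
      then obtain a b where "P x = [:a:]" "P y = [:b:]" by (metis degree_eq_zeroE)
      then have "sgn (poly (P x) t) = sgn (poly (P y) (\<phi> t))" for t using const by simp
      then show ?thesis using \<phi> sgnQ by blast
    next
      case False
      define Z where "Z = (\<Union>Q\<in>{Q \<in> ?\<P>. Q x \<noteq> 0}. {t. poly (Q x) t = 0})"
      have finZ: "finite Z" using fin by (auto simp: Z_def intro: poly_roots_finite)
      have crit: "t \<in> Z" if "poly (pderiv (P x)) t = 0" for t using that False by (auto simp: Z_def)
      have sgnZ: "sgn (poly (P x) z) = sgn (poly (P y) (\<phi> z))" if z: "z \<in> Z" for z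
      proof -
        obtain Q where Q: "Q \<in> ?\<P>" "Q x \<noteq> 0" "poly (Q x) z = 0" using z unfolding Z_def by blast
        have "Q y \<noteq> 0" using Q zero by blast
        moreover have "poly (Q y) (\<phi> z) = 0" using sgnQ[OF Q(1), of z] Q(3) by (metis sgn_0_0 sgn_0)
        ultimately show ?thesis using sgnR[OF Q(1), of z] Q by (simp add: poly_mod)
      qed
      from sgn_matched_extend[OF \<phi> finZ der crit sgnZ] obtain \<psi> where \<psi>: "order_iso \<psi>"
        "\<And>z. z \<in> Z \<Longrightarrow> \<psi> z = \<phi> z" "\<And>t. sgn (poly (P x) t) = sgn (poly (P y) (\<psi> t))" by blast
      have "sgn (poly (Q x) t) = sgn (poly (Q y) (\<psi> t))" if "Q \<in> \<P>" for Q t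
      proof (rule sgn_matched_transfer[OF \<phi> \<psi>(1) \<psi>(2)])
        show "t \<in> Z" if "Q x \<noteq> 0" "poly (Q x) t = 0" for t using that \<open>Q \<in> \<P>\<close> unfolding Z_def by blast
        show "sgn (poly (Q x) t) = sgn (poly (Q y) (\<phi> t))" for t by (rule sgnQ) (use that in simp)
      qed
      then have "\<forall>Q\<in>insert P \<P>. \<forall>t. sgn (poly (Q x) t) = sgn (poly (Q y) (\<psi> t))" using \<psi>(3) by simp
      with \<psi>(1) show ?thesis by (intro exI[of _ \<psi>] conjI)
    qed
  qed
  then show ?thesis using \<S> unfolding tame_def by blast
qed

text \<open>Termination: a member of top degree is traded for its derivative, its constant
  coefficient and remainders, all of smaller degree bound. Hence an outer induction on the degree
  bound and an inner one on the number of members of top degree, with the set \<open>\<Q>\<close> of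
  lower members left arbitrary.\<close>

lemma tame_poly_families:
  assumes "finite \<P>" "\<And>P. P \<in> \<P> \<Longrightarrow> \<exists>n. poly_family n P"
  shows "tame \<P>"
proof -
  have main: "tame \<Q>" if "finite \<Q>" "\<And>P. P \<in> \<Q> \<Longrightarrow> poly_family n P" for n \<Q>
    using that
  proof (induction n arbitrary: \<Q>)
    case 0
    then show ?case by (simp add: tame_constant)
  next
    case (Suc n)
    have "tame (\<P> \<union> \<Q>)" if "finite \<P>" "finite \<Q>"
      "\<And>P. P \<in> \<P> \<Longrightarrow> poly_family (Suc n) P" "\<And>P. P \<in> \<Q> \<Longrightarrow> poly_family n P" for \<P> \<Q>
      using that
    proof (induction \<P> arbitrary: \<Q> rule: finite_induct)
      case empty
      then show ?case using Suc.IH[of \<Q>] by simp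
    next
      case (insert P \<P>)
      let ?\<P> = "insert (\<lambda>x. pderiv (P x)) (\<P> \<union> \<Q>)"
      let ?rem = "\<lambda>Q x. if Q x = 0 then 0 else P x mod Q x"
      have P: "poly_family (Suc n) P" using insert by simp
      have PQ: "poly_family (Suc n) Q" if "Q \<in> ?\<P>" for Q
        using that insert.prems poly_family_pderiv[OF P] poly_family_mono[of n _ "Suc n"] by auto
      have "tame (\<P> \<union> (insert (\<lambda>x. [:coeff (P x) 0:]) (insert (\<lambda>x. pderiv (P x)) \<Q> \<union> ?rem ` ?\<P>)))"
      proof (rule insert.IH)
        show "poly_family n Q" if "Q \<in> insert (\<lambda>x. [:coeff (P x) 0:]) (insert (\<lambda>x. pderiv (P x)) \<Q> \<union> ?rem ` ?\<P>)" for Q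
          using that insert.prems(3) poly_family_pderiv[OF P] poly_family_mod[OF P PQ]
            poly_family_const[THEN poly_family_mono, of _ n] P
          by (auto simp: poly_family_def[of _ P])
      qed (use insert in auto)
      then show ?case using tame_extend[of "\<P> \<union> \<Q>" P] insert by (simp add: Un_ac)
    qed
    from this[of \<Q> "{}"] Suc.prems show ?case by simp
  qed
  obtain deg where deg: "\<And>P. P \<in> \<P> \<Longrightarrow> poly_family (deg P) P" using assms(2) by metis
  have "poly_family (Max (deg ` \<P>)) P" if "P \<in> \<P>" for P
    using deg[OF that] that assms(1) by (auto intro: poly_family_mono)
  then show ?thesis using main[of \<P> "Max (deg ` \<P>)"] assms(1) by simp
qed

end

section \<open>Projection of sets defined by polynomial functions\<close>

inductive_set poly_funs :: "'x set \<Rightarrow> (('x \<Rightarrow> real) \<Rightarrow> real) set" for I :: "'x set" where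
  const: "(\<lambda>x. a) \<in> poly_funs I"
| coord: "i \<in> I \<Longrightarrow> (\<lambda>x. x i) \<in> poly_funs I"
| add: "f \<in> poly_funs I \<Longrightarrow> g \<in> poly_funs I \<Longrightarrow> (\<lambda>x. f x + g x) \<in> poly_funs I"
| mult: "f \<in> poly_funs I \<Longrightarrow> g \<in> poly_funs I \<Longrightarrow> (\<lambda>x. f x * g x) \<in> poly_funs I"

interpretation PF: function_ring "poly_funs I"
proof
  show "(\<lambda>x. a) \<in> poly_funs I" for a by (rule poly_funs.const)
  show "(\<lambda>x. f x + g x) \<in> poly_funs I" if "f \<in> poly_funs I" "g \<in> poly_funs I" for f g
    using that by (rule poly_funs.add)
  show "(\<lambda>x. f x * g x) \<in> poly_funs I" if "f \<in> poly_funs I" "g \<in> poly_funs I" for f g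
    using that by (rule poly_funs.mult)
qed

lemma poly_funs_as_family:
  assumes "f \<in> poly_funs (insert j I)"
  shows "\<exists>P n. PF.poly_family I n P \<and> (\<forall>x t. f (x(j := t)) = poly (P x) t)"
  using assms
proof induction
  case (const a)
  show ?case
    by (intro exI[of _ "\<lambda>x. [:a:]"] exI[of _ 0]) (simp add: PF.poly_family_const PF.rat_const)
next
  case (coord i)
  show ?case
  proof (cases "i = j")
    case True
    then show ?thesis
      by (intro exI[of _ "\<lambda>x. [:0, 1:]"] exI[of _ 1])
        (auto simp: PF.poly_family_def PF.rat_const)
  next
    case False
    then have "i \<in> I" using coord by auto
    then show ?thesis using False
      by (intro exI[of _ "\<lambda>x. [:x i:]"] exI[of _ 0])
        (simp add: PF.poly_family_const PF.rat_base poly_funs.coord)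
  qed
next
  case (add f g)
  from add.IH(1) obtain P n where P: "PF.poly_family I n P" "\<forall>x t. f (x(j := t)) = poly (P x) t"
    by (elim exE conjE) (rule that)
  from add.IH(2) obtain Q m where Q: "PF.poly_family I m Q" "\<forall>x t. g (x(j := t)) = poly (Q x) t"
    by (elim exE conjE) (rule that)
  show ?case using PF.poly_family_add[OF P(1) Q(1)] P(2) Q(2)
    by (intro exI[of _ "\<lambda>x. P x + Q x"] exI[of _ "max n m"]) (simp del: fun_upd_apply)
next
  case (mult f g)
  from mult.IH(1) obtain P n where P: "PF.poly_family I n P" "\<forall>x t. f (x(j := t)) = poly (P x) t"
    by (elim exE conjE) (rule that)
  from mult.IH(2) obtain Q m where Q: "PF.poly_family I m Q" "\<forall>x t. g (x(j := t)) = poly (Q x) t"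
    by (elim exE conjE) (rule that)
  show ?case using PF.poly_family_mult[OF P(1) Q(1)] P(2) Q(2)
    by (intro exI[of _ "\<lambda>x. P x * Q x"] exI[of _ "n + m"]) (simp del: fun_upd_apply)
qed

text \<open>Whether \<open>x(j := t)\<close> lies in S depends only on the signs at t of finitely
  many polynomials whose coefficients do not involve coordinate j. If x and y agree on the finitely
  many sets given by tameness, an order isomorphism carries a witness t for x to one for y; so the
  projection is saturated.\<close>

theorem sign_algebra_project:
  assumes "S \<in> sign_algebra (poly_funs (insert j I))"
  shows "{x. \<exists>t. x(j := t) \<in> S} \<in> sign_algebra (poly_funs I)"
proof -
  have "\<exists>\<P>. finite \<P> \<and> (\<forall>P\<in>\<P>. \<exists>n. PF.poly_family I n P) \<and>
     (\<forall>x y t s. (\<forall>P\<in>\<P>. sgn (poly (P x) t) = sgn (poly (P y) s)) \<longrightarrow> (x(j := t) \<in> S \<longleftrightarrow> y(j := s) \<in> S))" (is "\<exists>\<P>. ?det \<P>")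
    using assms
  proof induction
    case (pos f)
    from poly_funs_as_family[OF pos] obtain P n where
      P: "PF.poly_family I n P" "\<forall>x t. f (x(j := t)) = poly (P x) t" by (elim exE conjE) (rule that)
    have "(0 < a) = (0 < b)" if "sgn a = sgn b" for a b :: real using that by (metis sgn_greater)
    then have "(0 < f (x(j := t))) = (0 < f (y(j := s)))" if "sgn (poly (P x) t) = sgn (poly (P y) s)" for x y t s
      unfolding P(2)[rule_format] using that by blast
    then show ?case using P(1) by (intro exI[of _ "{P}"]) blast
  next
    case (compl S)
    then show ?case by auto
  next
    case (union S T)
    from union.IH(1) obtain \<P> where P: "finite \<P> \<and> (\<forall>P\<in>\<P>. \<exists>n. PF.poly_family I n P) \<and>
        (\<forall>x y t s. (\<forall>P\<in>\<P>. sgn (poly (P x) t) = sgn (poly (P y) s)) \<longrightarrow> (x(j := t) \<in> S \<longleftrightarrow> y(j := s) \<in> S))"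
      by (elim exE) (rule that)
    from union.IH(2) obtain \<Q> where Q: "finite \<Q> \<and> (\<forall>P\<in>\<Q>. \<exists>n. PF.poly_family I n P) \<and>
        (\<forall>x y t s. (\<forall>P\<in>\<Q>. sgn (poly (P x) t) = sgn (poly (P y) s)) \<longrightarrow> (x(j := t) \<in> T \<longleftrightarrow> y(j := s) \<in> T))"
      by (elim exE) (rule that)
    have "x(j := t) \<in> S \<union> T \<longleftrightarrow> y(j := s) \<in> S \<union> T"
      if *: "\<forall>P\<in>\<P> \<union> \<Q>. sgn (poly (P x) t) = sgn (poly (P y) s)" for x y t s
    proof -
      have "x(j := t) \<in> S \<longleftrightarrow> y(j := s) \<in> S"
        by (rule P[THEN conjunct2, THEN conjunct2, rule_format]) (use * in simp)
      moreover have "x(j := t) \<in> T \<longleftrightarrow> y(j := s) \<in> T"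
        by (rule Q[THEN conjunct2, THEN conjunct2, rule_format]) (use * in simp)
      ultimately show ?thesis by (simp del: fun_upd_apply)
    qed
    then show ?case using P Q by (intro exI[of _ "\<P> \<union> \<Q>"]) blast
  qed
  then obtain \<P> where "?det \<P>" by (elim exE) (rule that)
  then have \<P>: "finite \<P>" "\<And>P. P \<in> \<P> \<Longrightarrow> \<exists>n. PF.poly_family I n P"
    and det: "\<And>x y t s. \<forall>P\<in>\<P>. sgn (poly (P x) t) = sgn (poly (P y) s) \<Longrightarrow> x(j := t) \<in> S \<longleftrightarrow> y(j := s) \<in> S"
    by (simp_all del: fun_upd_apply)
  obtain \<S> where \<S>: "finite \<S>" "\<S> \<subseteq> sign_algebra (poly_funs I)"
    and iso: "\<And>x y. \<forall>S\<in>\<S>. x \<in> S \<longleftrightarrow> y \<in> S \<Longrightarrow>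
     \<exists>\<phi>. order_iso \<phi> \<and> (\<forall>P\<in>\<P>. \<forall>t. sgn (poly (P x) t) = sgn (poly (P y) (\<phi> t)))"
    using PF.tame_poly_families[OF \<P>] unfolding PF.tame_def by blast
  show ?thesis
  proof (rule PF.sign_saturated[OF \<S>])
    fix x y assume xy: "\<And>S. S \<in> \<S> \<Longrightarrow> x \<in> S \<longleftrightarrow> y \<in> S" and "x \<in> {x. \<exists>t. x(j := t) \<in> S}"
    then obtain t where t: "x(j := t) \<in> S" by blast
    obtain \<phi> where "\<forall>P\<in>\<P>. \<forall>t. sgn (poly (P x) t) = sgn (poly (P y) (\<phi> t))" using iso xy by blast
    then have "y(j := \<phi> t) \<in> S" using det[of x t y "\<phi> t"] t by blast
    then show "y \<in> {x. \<exists>t. x(j := t) \<in> S}" by blast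
  qed
qed

section \<open>Evaluation of polynomials\<close>

definition monom_eval :: "'x set \<Rightarrow> ('x \<Rightarrow> nat) \<Rightarrow> ('x \<Rightarrow> real) \<Rightarrow> real" where
  "monom_eval N \<alpha> x = (\<Prod>i\<in>N. x i ^ \<alpha> i)"

lemma monom_eval_keys:
  assumes "finite N" "Poly_Mapping.keys m \<subseteq> N"
  shows "(\<Prod>i \<in> Poly_Mapping.keys m. x i ^ Poly_Mapping.lookup m i) = monom_eval N (Poly_Mapping.lookup m) x"
  unfolding monom_eval_def using assms by (intro prod.mono_neutral_left) (auto simp: in_keys_iff)

lemma poly_eval_superset:
  assumes "finite K" "Poly_Mapping.keys p \<subseteq> K"
  shows "poly_eval x p = (\<Sum>m\<in>K. Poly_Mapping.lookup p m * (\<Prod>i \<in> Poly_Mapping.keys m. x i ^ Poly_Mapping.lookup m i))"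
  unfolding poly_eval_def using assms by (intro sum.mono_neutral_left) (auto simp: in_keys_iff)

lemma poly_eval_zero [simp]: "poly_eval x 0 = 0"
  by (simp add: poly_eval_def)

lemma poly_eval_add: "poly_eval x (p + q) = poly_eval x p + poly_eval x q"
proof -
  let ?K = "Poly_Mapping.keys p \<union> Poly_Mapping.keys q"
  have "Poly_Mapping.keys (p + q) \<subseteq> ?K" by (rule Poly_Mapping.keys_add)
  then show ?thesis
    by (simp add: poly_eval_superset[of ?K] lookup_add sum.distrib distrib_right)
qed

lemma poly_eval_sum: "poly_eval x (\<Sum>i\<in>I. f i) = (\<Sum>i\<in>I. poly_eval x (f i))"
  by (induction I rule: infinite_finite_induct) (simp_all add: poly_eval_add)

lemma poly_eval_single:
  "poly_eval x (Poly_Mapping.single m a) = a * (\<Prod>i \<in> Poly_Mapping.keys m. x i ^ Poly_Mapping.lookup m i)"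
  by (cases "a = 0") (simp_all add: poly_eval_def)

lemma poly_mapping_sum_singles: "p = (\<Sum>m\<in>Poly_Mapping.keys p. Poly_Mapping.single m (Poly_Mapping.lookup p m))"
proof (rule poly_mapping_eqI)
  fix k
  have "(\<Sum>m\<in>Poly_Mapping.keys p. Poly_Mapping.lookup (Poly_Mapping.single m (Poly_Mapping.lookup p m)) k) =
    (\<Sum>m\<in>Poly_Mapping.keys p. if k = m then Poly_Mapping.lookup p k else 0)"
    by (intro sum.cong) (auto simp: lookup_single when_def)
  also have "\<dots> = Poly_Mapping.lookup p k" by (simp add: in_keys_iff)
  finally show "Poly_Mapping.lookup p k = Poly_Mapping.lookup (\<Sum>m\<in>Poly_Mapping.keys p. Poly_Mapping.single m (Poly_Mapping.lookup p m)) k"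
    by (simp add: lookup_sum)
qed

lemma poly_eval_mult_single:
  "poly_eval x (Poly_Mapping.single m a * Poly_Mapping.single m' b) =
    poly_eval x (Poly_Mapping.single m a) * poly_eval x (Poly_Mapping.single m' b)"
proof -
  let ?N = "Poly_Mapping.keys m \<union> Poly_Mapping.keys m'"
  have "(\<Prod>i \<in> Poly_Mapping.keys (m + m'). x i ^ Poly_Mapping.lookup (m + m') i) = monom_eval ?N (Poly_Mapping.lookup (m + m')) x"
    by (rule monom_eval_keys) (simp_all add: Poly_Mapping.keys_add)
  also have "\<dots> = monom_eval ?N (Poly_Mapping.lookup m) x * monom_eval ?N (Poly_Mapping.lookup m') x"
    by (simp add: monom_eval_def lookup_add power_add prod.distrib)
  finally show ?thesis
    by (simp add: mult_single poly_eval_single monom_eval_keys[of ?N])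
qed

lemma poly_eval_mult: "poly_eval x (p * q) = poly_eval x p * poly_eval x q"
proof -
  let ?s = "\<lambda>p m. Poly_Mapping.single m (Poly_Mapping.lookup p m)"
  have "poly_eval x (p * q) = poly_eval x ((\<Sum>m\<in>Poly_Mapping.keys p. ?s p m) * (\<Sum>m\<in>Poly_Mapping.keys q. ?s q m))"
    using poly_mapping_sum_singles[of p] poly_mapping_sum_singles[of q] by simp
  also have "\<dots> = (\<Sum>m\<in>Poly_Mapping.keys p. \<Sum>m'\<in>Poly_Mapping.keys q. poly_eval x (?s p m) * poly_eval x (?s q m'))"
    by (simp add: sum_product poly_eval_sum poly_eval_mult_single)
  also have "\<dots> = poly_eval x (\<Sum>m\<in>Poly_Mapping.keys p. ?s p m) * poly_eval x (\<Sum>m\<in>Poly_Mapping.keys q. ?s q m)"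
    by (simp only: poly_eval_sum sum_product)
  finally show ?thesis using poly_mapping_sum_singles[of p] poly_mapping_sum_singles[of q] by simp
qed

lemma poly_eval_Const: "poly_eval x (Const a) = a"
  by (simp add: Const_def poly_eval_single)

lemma poly_eval_one: "poly_eval x 1 = 1"
  using poly_eval_Const[of x 1] by (simp add: Const_def)

lemma poly_eval_Var: "poly_eval x (Var i) = x i"
  by (simp add: Var_def poly_eval_single)

lemma poly_eval_power: "poly_eval x (p ^ k) = poly_eval x p ^ k"
  by (induction k) (simp_all add: poly_eval_one poly_eval_mult)

lemma poly_eval_prod_mset: "poly_eval x (\<Prod>r\<in>#\<mu>. f r) = (\<Prod>r\<in>#\<mu>. poly_eval x (f r))"
  by (induction \<mu>) (simp_all add: poly_eval_one poly_eval_mult)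

lemma poly_eval_sum_list: "poly_eval x (\<Sum>q\<leftarrow>qs. f q) = (\<Sum>q\<leftarrow>qs. poly_eval x (f q))"
  by (induction qs) (simp_all add: poly_eval_add)

lemma polys_in_zero: "0 \<in> polys_in I" by (simp add: polys_in_def)

lemma polys_in_add: "p \<in> polys_in I \<Longrightarrow> q \<in> polys_in I \<Longrightarrow> p + q \<in> polys_in I"
  using Poly_Mapping.keys_add[of p q] by (auto simp: polys_in_def)

lemma polys_in_sum: "(\<And>i. i \<in> J \<Longrightarrow> f i \<in> polys_in I) \<Longrightarrow> (\<Sum>i\<in>J. f i) \<in> polys_in I"
  by (induction J rule: infinite_finite_induct) (auto intro: polys_in_add polys_in_zero)

lemma polys_in_single: "Poly_Mapping.keys m \<subseteq> I \<Longrightarrow> Poly_Mapping.single m a \<in> polys_in I"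
  by (simp add: polys_in_def)

lemma polys_in_Const: "Const a \<in> polys_in I"
  unfolding Const_def by (rule polys_in_single) simp

lemma polys_in_Var: "i \<in> I \<Longrightarrow> Var i \<in> polys_in I"
  unfolding Var_def by (rule polys_in_single) simp

lemma polys_in_mult:
  assumes "p \<in> polys_in I" "q \<in> polys_in I" shows "p * q \<in> polys_in I"
proof -
  have "Poly_Mapping.keys m \<subseteq> I" if "m \<in> Poly_Mapping.keys (p * q)" for m
  proof -
    from that Poly_Mapping.keys_mult[of p q] obtain a b where
      m: "m = a + b" "a \<in> Poly_Mapping.keys p" "b \<in> Poly_Mapping.keys q" by blast
    then have "Poly_Mapping.keys a \<subseteq> I" "Poly_Mapping.keys b \<subseteq> I" using assms by (auto simp: polys_in_def)
    then show ?thesis using Poly_Mapping.keys_add[of a b] m(1) by blast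
  qed
  then show ?thesis by (simp add: polys_in_def)
qed

lemma polys_in_one: "1 \<in> polys_in I"
  using polys_in_Const[of 1 I] by (simp add: Const_def)

lemma polys_in_power: "p \<in> polys_in I \<Longrightarrow> p ^ k \<in> polys_in I"
  by (induction k) (simp_all add: polys_in_mult polys_in_one)

lemma polys_in_prod_mset: "(\<And>r. f r \<in> polys_in I) \<Longrightarrow> (\<Prod>r\<in>#\<mu>. f r) \<in> polys_in I"
  by (induction \<mu>) (simp_all add: polys_in_mult polys_in_one)

lemma polys_in_sum_list: "(\<And>q. q \<in> set qs \<Longrightarrow> f q \<in> polys_in I) \<Longrightarrow> (\<Sum>q\<leftarrow>qs. f q) \<in> polys_in I"
  by (induction qs) (simp_all add: polys_in_add polys_in_zero)

lemma poly_eval_cong: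
  assumes "p \<in> polys_in I" "\<And>i. i \<in> I \<Longrightarrow> x i = y i"
  shows "poly_eval x p = poly_eval y p"
  unfolding poly_eval_def using assms by (intro sum.cong arg_cong2[where f = times] prod.cong refl arg_cong2[where f = power])
    (auto simp: polys_in_def)

section \<open>Polynomial functions and semialgebraic subsets of the coordinate space\<close>

lemma poly_funs_imp_polys_in:
  assumes "f \<in> poly_funs I" shows "\<exists>p\<in>polys_in I. \<forall>x. f x = poly_eval x p"
  using assms
proof induction
  case (const a) then show ?case using polys_in_Const poly_eval_Const by metis
next
  case (coord i) then show ?case using polys_in_Var poly_eval_Var by metis
next
  case (add f g) then show ?case using polys_in_add poly_eval_add by metis
next
  case (mult f g) then show ?case using polys_in_mult poly_eval_mult by metis
qed

lemma poly_funs_sum: "(\<And>i. i \<in> J \<Longrightarrow> f i \<in> poly_funs I) \<Longrightarrow> (\<lambda>x. \<Sum>i\<in>J. f i x) \<in> poly_funs I"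
  by (induction J rule: infinite_finite_induct) (simp_all add: poly_funs.const poly_funs.add)

lemma poly_funs_prod: "(\<And>i. i \<in> J \<Longrightarrow> f i \<in> poly_funs I) \<Longrightarrow> (\<lambda>x. \<Prod>i\<in>J. f i x) \<in> poly_funs I"
  by (induction J rule: infinite_finite_induct) (simp_all add: poly_funs.const poly_funs.mult)

lemma poly_funs_power: "f \<in> poly_funs I \<Longrightarrow> (\<lambda>x. f x ^ k) \<in> poly_funs I"
  by (induction k) (simp_all add: poly_funs.const poly_funs.mult)

lemma polys_in_imp_poly_funs:
  assumes "p \<in> polys_in I" shows "(\<lambda>x. poly_eval x p) \<in> poly_funs I"
  unfolding poly_eval_def
proof (rule poly_funs_sum)
  fix m assume "m \<in> Poly_Mapping.keys p"
  then have "Poly_Mapping.keys m \<subseteq> I" using assms by (auto simp: polys_in_def)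
  then have "(\<lambda>x. \<Prod>i\<in>Poly_Mapping.keys m. x i ^ Poly_Mapping.lookup m i) \<in> poly_funs I"
    by (intro poly_funs_prod poly_funs_power poly_funs.coord) auto
  then show "(\<lambda>x. Poly_Mapping.lookup p m * (\<Prod>i\<in>Poly_Mapping.keys m. x i ^ Poly_Mapping.lookup m i)) \<in> poly_funs I"
    by (rule poly_funs.mult[OF poly_funs.const])
qed

lemma semialgebraic_if_sign_algebra:
  assumes "S \<in> sign_algebra (poly_funs I)"
  shows "semialgebraic I (S \<inter> coord_space I)"
  using assms
proof induction
  case (pos f)
  then obtain p where p: "p \<in> polys_in I" "\<And>x. f x = poly_eval x p" using poly_funs_imp_polys_in by meson
  have "{x. f x > 0} \<inter> coord_space I = {x \<in> coord_space I. poly_eval x p > 0}" by (auto simp: p(2))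
  then show ?case using semialgebraic.pos[OF p(1)] by simp
next
  case (compl S)
  have "- S \<inter> coord_space I = coord_space I - S \<inter> coord_space I" by auto
  then show ?case using semialgebraic.compl[OF compl.IH] by simp
next
  case (union S T)
  then show ?case using semialgebraic.union by (simp add: Int_Un_distrib2)
qed

lemma sign_algebra_if_semialgebraic:
  assumes "semialgebraic I S"
  shows "\<exists>T\<in>sign_algebra (poly_funs I). S = T \<inter> coord_space I"
  using assms
proof induction
  case (pos p)
  show ?case
    by (rule bexI[OF _ sign_algebra.pos[OF polys_in_imp_poly_funs[OF pos]]]) auto
next
  case (compl S)
  then obtain T where T: "T \<in> sign_algebra (poly_funs I)" "S = T \<inter> coord_space I" by blast
  show ?case by (rule bexI[OF _ sign_algebra.compl[OF T(1)]]) (auto simp: T(2))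
next
  case (union S T)
  then obtain S' T' where T: "S' \<in> sign_algebra (poly_funs I)" "S = S' \<inter> coord_space I"
    "T' \<in> sign_algebra (poly_funs I)" "T = T' \<inter> coord_space I" by blast
  show ?case by (rule bexI[OF _ sign_algebra.union[OF T(1,3)]]) (auto simp: T(2,4))
qed

lemma sign_algebra_vimage:
  assumes "S \<in> sign_algebra (poly_funs I)" "\<And>i. i \<in> I \<Longrightarrow> (\<lambda>y. g y i) \<in> poly_funs J"
  shows "{y. g y \<in> S} \<in> sign_algebra (poly_funs J)"
  using assms(1)
proof induction
  case (pos f)
  have "(\<lambda>y. f (g y)) \<in> poly_funs J" using pos
  proof induction
    case (coord i) then show ?case by (rule assms(2))
  qed (simp_all add: poly_funs.const poly_funs.add poly_funs.mult)
  then show ?case using sign_algebra.pos by fastforce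
next
  case (compl S)
  then show ?case using sign_algebra.compl[OF compl.IH] by (simp add: Collect_neg_eq)
next
  case (union S T)
  then show ?case using sign_algebra.union[OF union.IH] by (simp add: Collect_disj_eq)
qed

lemma sign_algebra_project_finite:
  assumes "finite J" "S \<in> sign_algebra (poly_funs (I \<union> J))"
  shows "{x. \<exists>y. (\<lambda>i. if i \<in> J then y i else x i) \<in> S} \<in> sign_algebra (poly_funs I)"
  using assms
proof (induction J arbitrary: S rule: finite_induct)
  case empty
  then show ?case by simp
next
  case (insert j J)
  have "{x. \<exists>t. x(j := t) \<in> S} \<in> sign_algebra (poly_funs (I \<union> J))"
    using sign_algebra_project[of S j "I \<union> J"] insert.prems by simp
  from insert.IH[OF this]
  have "{x. \<exists>y t. (\<lambda>i. if i \<in> J then y i else x i)(j := t) \<in> S} \<in> sign_algebra (poly_funs I)" by simp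
  moreover have "(\<exists>y t. (\<lambda>i. if i \<in> J then y i else x i)(j := t) \<in> S) \<longleftrightarrow> (\<exists>y. (\<lambda>i. if i \<in> insert j J then y i else x i) \<in> S)" for x
  proof
    assume "\<exists>y t. (\<lambda>i. if i \<in> J then y i else x i)(j := t) \<in> S"
    then obtain y t where yt: "(\<lambda>i. if i \<in> J then y i else x i)(j := t) \<in> S" by blast
    have "(\<lambda>i. if i \<in> insert j J then (y(j := t)) i else x i) = (\<lambda>i. if i \<in> J then y i else x i)(j := t)"
      using insert.hyps by auto
    then show "\<exists>y. (\<lambda>i. if i \<in> insert j J then y i else x i) \<in> S" using yt by metis
  next
    assume "\<exists>y. (\<lambda>i. if i \<in> insert j J then y i else x i) \<in> S"
    then obtain y where y: "(\<lambda>i. if i \<in> insert j J then y i else x i) \<in> S" by blast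
    have "(\<lambda>i. if i \<in> insert j J then y i else x i) = (\<lambda>i. if i \<in> J then y i else x i)(j := y j)"
      using insert.hyps by auto
    then show "\<exists>y t. (\<lambda>i. if i \<in> J then y i else x i)(j := t) \<in> S" using y by metis
  qed
  ultimately show ?case by simp
qed

section \<open>Recovering coefficients from values on a grid\<close>

text \<open>The weight at t is the coefficient of X^e in the Lagrange basis polynomial
  \<open>L t\<close> for the nodes 0, ..., D. Interpolation reproduces X^k for k \<le> D, and
  comparing the coefficients at e gives the claim.\<close>

lemma interpolation_weights:
  "\<exists>w :: nat \<Rightarrow> real. \<forall>k\<le>D. (\<Sum>t\<le>D. w t * real t ^ k) = (if k = e then 1 else 0)"
proof -
  define L where "L t = (\<Prod>u\<in>{..D} - {t}. smult (1 / (real t - real u)) [:- real u, 1:])" for t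
  have L: "poly (L t) (real s) = (if s = t then 1 else 0)" if "s \<le> D" "t \<le> D" for s t
  proof (cases "s = t")
    case True
    have "poly (smult (1 / (real t - real u)) [:- real u, 1:]) (real t) = 1" if "u \<in> {..D} - {t}" for u
      using that by (simp add: diff_divide_distrib[symmetric])
    then have "poly (L t) (real t) = 1" unfolding L_def poly_prod by (intro prod.neutral) blast
    then show ?thesis using True by simp
  next
    case False
    then show ?thesis unfolding L_def poly_prod using that by (auto intro!: prod_zero bexI[of _ s])
  qed
  have deg: "degree (L t) \<le> D" if "t \<le> D" for t
  proof -
    have "degree (L t) \<le> (\<Sum>u\<in>{..D} - {t}. degree (smult (1 / (real t - real u)) [:- real u, 1:]))"
      unfolding L_def by (rule order_trans[OF degree_prod_sum_le]) (simp_all add: comp_def)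
    also have "\<dots> \<le> (\<Sum>u\<in>{..D} - {t}. 1)" by (intro sum_mono) simp
    also have "\<dots> = D" using that by simp
    finally show ?thesis .
  qed
  have "(\<Sum>t\<le>D. coeff (L t) e * real t ^ k) = (if k = e then 1 else 0)" if "k \<le> D" for k
  proof -
    have "(\<Sum>t\<le>D. smult (real t ^ k) (L t)) = monom 1 k"
    proof (rule poly_eqI_degree)
      let ?A = "real ` {..D}"
      show "degree (\<Sum>t\<le>D. smult (real t ^ k) (L t)) < card ?A"
      proof -
        have "degree (\<Sum>t\<le>D. smult (real t ^ k) (L t)) \<le> D"
        proof (rule degree_sum_le)
          show "degree (smult (real t ^ k) (L t)) \<le> D" if "t \<in> {..D}" for t
            using that by (intro order_trans[OF degree_smult_le] deg) simp
        qed simp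
        then show ?thesis by (simp add: card_image)
      qed
      show "degree (monom (1::real) k) < card ?A" using that by (simp add: card_image degree_monom_eq)
      fix x assume "x \<in> ?A"
      then obtain s where s: "x = real s" "s \<le> D" by auto
      have "poly (\<Sum>t\<le>D. smult (real t ^ k) (L t)) x = (\<Sum>t\<le>D. if s = t then real t ^ k else 0)"
        unfolding poly_sum s by (intro sum.cong refl) (simp add: L[OF s(2)])
      then show "poly (\<Sum>t\<le>D. smult (real t ^ k) (L t)) x = poly (monom 1 k) x"
        using s by (simp add: poly_monom)
    qed
    then have "coeff (\<Sum>t\<le>D. smult (real t ^ k) (L t)) e = (if k = e then 1 else 0)" by simp
    then show ?thesis by (simp add: coeff_sum mult.commute)
  qed
  then show ?thesis by (intro exI[of _ "\<lambda>t. coeff (L t) e"]) simp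
qed

text \<open>The weights are products of one-variable weights. They do not depend on the coefficients
  \<open>a\<close>, so the same functional also bounds coefficients uniformly over all polynomials
  with exponents in B.\<close>

lemma coefficient_extraction:
  assumes "finite N" "finite B" and D: "\<And>\<beta> i. \<beta> \<in> B \<Longrightarrow> i \<in> N \<Longrightarrow> \<beta> i \<le> D"
    and supp: "\<And>\<beta> i. \<beta> \<in> B \<Longrightarrow> i \<notin> N \<Longrightarrow> \<beta> i = 0" and \<alpha>: "\<alpha> \<in> B"
  shows "\<exists>\<omega>. \<forall>a :: _ \<Rightarrow> real.
    (\<Sum>t \<in> N \<rightarrow>\<^sub>E {..D}. \<omega> t * (\<Sum>\<beta>\<in>B. a \<beta> * monom_eval N \<beta> (\<lambda>i. real (t i)))) = a \<alpha>"
proof -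
  obtain w :: "nat \<Rightarrow> nat \<Rightarrow> real" where w: "\<And>e k. k \<le> D \<Longrightarrow> (\<Sum>t\<le>D. w e t * real t ^ k) = (if k = e then 1 else 0)"
    using interpolation_weights[of D] by metis
  define \<omega> where "\<omega> t = (\<Prod>i\<in>N. w (\<alpha> i) (t i))" for t
  have orth: "(\<Sum>t \<in> N \<rightarrow>\<^sub>E {..D}. \<omega> t * monom_eval N \<beta> (\<lambda>i. real (t i))) = (if \<forall>i\<in>N. \<beta> i = \<alpha> i then 1 else 0)"
    if "\<beta> \<in> B" for \<beta>
  proof -
    have "(\<Sum>t \<in> N \<rightarrow>\<^sub>E {..D}. \<omega> t * monom_eval N \<beta> (\<lambda>i. real (t i))) =
       (\<Sum>t \<in> N \<rightarrow>\<^sub>E {..D}. \<Prod>i\<in>N. w (\<alpha> i) (t i) * real (t i) ^ \<beta> i)"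
      by (simp add: \<omega>_def monom_eval_def prod.distrib)
    also have "\<dots> = (\<Prod>i\<in>N. \<Sum>t\<le>D. w (\<alpha> i) t * real t ^ \<beta> i)"
      using assms(1) by (intro prod_sum_PiE[symmetric]) auto
    also have "\<dots> = (\<Prod>i\<in>N. if \<beta> i = \<alpha> i then 1 else 0)"
      using D[OF that] by (intro prod.cong refl) (simp add: w)
    also have "\<dots> = (if \<forall>i\<in>N. \<beta> i = \<alpha> i then 1 else 0)"
      using assms(1) by (auto intro: prod.neutral prod_zero)
    finally show ?thesis .
  qed
  have "(\<Sum>t \<in> N \<rightarrow>\<^sub>E {..D}. \<omega> t * (\<Sum>\<beta>\<in>B. a \<beta> * monom_eval N \<beta> (\<lambda>i. real (t i)))) = a \<alpha>" for a
  proof -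
    have "(\<Sum>t \<in> N \<rightarrow>\<^sub>E {..D}. \<omega> t * (\<Sum>\<beta>\<in>B. a \<beta> * monom_eval N \<beta> (\<lambda>i. real (t i)))) =
       (\<Sum>\<beta>\<in>B. a \<beta> * (\<Sum>t \<in> N \<rightarrow>\<^sub>E {..D}. \<omega> t * monom_eval N \<beta> (\<lambda>i. real (t i))))"
      by (simp add: sum_distrib_left mult.left_commute) (rule sum.swap)
    also have "\<dots> = (\<Sum>\<beta>\<in>B. if \<beta> = \<alpha> then a \<alpha> else 0)"
    proof (rule sum.cong[OF refl])
      fix \<beta> assume b: "\<beta> \<in> B"
      have "(\<forall>i\<in>N. \<beta> i = \<alpha> i) \<longleftrightarrow> \<beta> = \<alpha>" using supp b \<alpha> by (metis ext)
      then show "a \<beta> * (\<Sum>t \<in> N \<rightarrow>\<^sub>E {..D}. \<omega> t * monom_eval N \<beta> (\<lambda>i. real (t i))) = (if \<beta> = \<alpha> then a \<alpha> else 0)"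
        using orth[OF b] by simp
    qed
    also have "\<dots> = a \<alpha>" using \<alpha> assms(2) by simp
    finally show ?thesis .
  qed
  then show ?thesis by (intro exI[of _ \<omega>] allI)
qed

lemma poly_eval_lookup:
  assumes "finite N" "p \<in> polys_in N"
  shows "poly_eval x p = (\<Sum>\<beta>\<in>Poly_Mapping.lookup ` Poly_Mapping.keys p.
    Poly_Mapping.lookup p (Abs_poly_mapping \<beta>) * monom_eval N \<beta> x)"
proof -
  have "inj_on Poly_Mapping.lookup (Poly_Mapping.keys p)" by (meson inj_onI lookup_inject)
  then show ?thesis
    using assms by (auto simp: poly_eval_def sum.reindex lookup_inverse polys_in_def monom_eval_keys intro!: sum.cong)
qed

text \<open>Sums of squares will be found as identities between values, whereas
  \<open>sum_of_squares\<close> asks for an identity between formal polynomials; this lemma is the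
  bridge.\<close>

lemma poly_eval_injective:
  assumes "finite N" "p \<in> polys_in N" "q \<in> polys_in N" and eq: "\<And>x. poly_eval x p = poly_eval x q"
  shows "p = q"
proof -
  define r where "r = p + Const (- 1) * q"
  have r: "r \<in> polys_in N" "poly_eval x r = 0" for x
    using assms by (auto simp: r_def poly_eval_add poly_eval_mult poly_eval_Const intro!: polys_in_add polys_in_mult polys_in_Const)
  have "r = 0"
  proof (rule ccontr)
    assume "r \<noteq> 0"
    then obtain m where m: "m \<in> Poly_Mapping.keys r" by (metis all_not_in_conv keys_eq_empty)
    let ?B = "Poly_Mapping.lookup ` Poly_Mapping.keys r"
    let ?V = "(\<lambda>(\<beta>, i). \<beta> i) ` (?B \<times> N)"
    have "finite ?V" using assms by simp
    then have D: "\<beta> i \<le> Max ?V" if "\<beta> \<in> ?B" "i \<in> N" for \<beta> i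
      using that by (intro Max_ge) force+
    have supp: "\<beta> i = 0" if "\<beta> \<in> ?B" "i \<notin> N" for \<beta> i
    proof -
      show ?thesis using that r(1) by (auto simp: polys_in_def not_in_keys_iff_lookup_eq_zero[symmetric]) blast
    qed
    have "\<exists>\<omega>. \<forall>a. (\<Sum>t \<in> N \<rightarrow>\<^sub>E {..Max ?V}. \<omega> t * (\<Sum>\<beta>\<in>?B. a \<beta> * monom_eval N \<beta> (\<lambda>i. real (t i)))) = a (Poly_Mapping.lookup m)"
      by (rule coefficient_extraction) (use assms(1) D supp m in simp_all)
    then obtain \<omega> where "(\<Sum>t \<in> N \<rightarrow>\<^sub>E {..Max ?V}. \<omega> t * (\<Sum>\<beta>\<in>?B. a \<beta> * monom_eval N \<beta> (\<lambda>i. real (t i)))) = a (Poly_Mapping.lookup m)" for a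
      by blast
    from this[of "\<lambda>\<beta>. Poly_Mapping.lookup r (Abs_poly_mapping \<beta>)"] m
    have "Poly_Mapping.lookup r m = 0"
      using poly_eval_lookup[OF assms(1) r(1)] r(2) by (simp add: lookup_inverse)
    then show False using m by (simp add: in_keys_iff)
  qed
  then have "p + Const (- 1) * q + q = q" by (simp add: r_def)
  moreover have "Const (- 1) * q + q = 0"
  proof -
    have "Const (- 1) + (1 :: 'a mpoly) = 0" by (simp add: Const_def single_uminus)
    then have "(Const (- 1) + 1) * q = 0" by simp
    then show ?thesis by (simp add: distrib_right)
  qed
  ultimately show ?thesis by (simp add: add.assoc)
qed

section \<open>Values of symmetric forms\<close>

definition power_sum_value :: "'x set \<Rightarrow> nat multiset \<Rightarrow> ('x \<Rightarrow> real) \<Rightarrow> real" where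
  "power_sum_value N \<mu> x = (\<Prod>r\<in>#\<mu>. \<Sum>i\<in>N. x i ^ r)"

lemma poly_eval_sym_form:
  "poly_eval x (sym_form L n c) = (\<Sum>\<mu>\<in>L. c \<mu> * power_sum_value {1..n} \<mu> x)"
  by (simp add: sym_form_def power_sum_partition_def power_sum_def power_sum_value_def poly_eval_sum poly_eval_mult
      poly_eval_Const poly_eval_prod_mset poly_eval_power poly_eval_Var)

lemma sym_form_polys_in: "sym_form L n c \<in> polys_in {1..n}"
  unfolding sym_form_def power_sum_partition_def power_sum_def
  by (intro polys_in_sum polys_in_mult polys_in_Const polys_in_prod_mset polys_in_power polys_in_Var)

lemma sum_of_squares_imp_nonneg:
  assumes "sum_of_squares n f" shows "poly_eval x f \<ge> 0"
  using assms unfolding sum_of_squares_def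
  by (auto simp: poly_eval_sum_list poly_eval_power intro!: sum_list_nonneg)

lemma nonneg_iff:
  assumes "f \<in> polys_in {1..n}" shows "nonneg n f \<longleftrightarrow> (\<forall>x. poly_eval x f \<ge> 0)"
proof -
  have "poly_eval x f = poly_eval (restrict x {1..n}) f" for x by (rule poly_eval_cong[OF assms]) simp
  moreover have "restrict x {1..n} \<in> coord_space {1..n}" for x :: "nat \<Rightarrow> real" by simp
  ultimately show ?thesis unfolding nonneg_def by metis
qed

section \<open>Invariant Gram matrices\<close>

text \<open>Exponents are plain functions that vanish off N, so permutations act by composition, and
  a monomial in fewer variables is literally one in more variables.\<close>

definition mons :: "'i set \<Rightarrow> nat \<Rightarrow> ('i \<Rightarrow> nat) set" where
  "mons N d = {\<alpha>. (\<forall>i. i \<notin> N \<longrightarrow> \<alpha> i = 0) \<and> (\<Sum>i\<in>N. \<alpha> i) = d}"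

lemma mons_le: "finite N \<Longrightarrow> \<alpha> \<in> mons N d \<Longrightarrow> \<alpha> i \<le> d"
  unfolding mons_def using member_le_sum[of i N \<alpha>] by (cases "i \<in> N") auto

lemma finite_mons: "finite N \<Longrightarrow> finite (mons N d)"
proof -
  assume N: "finite N"
  have "mons N d \<subseteq> {f. \<forall>i. (i \<in> N \<longrightarrow> f i \<in> {..d}) \<and> (i \<notin> N \<longrightarrow> f i = 0)}"
    using mons_le[OF N] by (auto simp: mons_def)
  then show ?thesis using finite_set_of_finite_funs[OF N, of "{..d}" 0] finite_subset by blast
qed

text \<open>The bound makes 0 a zero of order at least d and limits the degree to d. Each induction
  step divides by X, where the new inequality at 0 follows by continuity; for d = 0 a bounded
  polynomial is constant.\<close>

lemma poly_bounded_by_monom: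
  fixes P :: "real poly"
  assumes "\<And>s. (poly P s)\<^sup>2 \<le> C * s ^ (2 * d)"
  shows "P = monom (coeff P d) d"
  using assms
proof (induction d arbitrary: P)
  case 0
  then have le: "(poly P s)\<^sup>2 \<le> C" for s by simp
  have C: "0 \<le> C" using le[of 0] zero_le_power2 order_trans by blast
  have "degree P = 0"
  proof (rule ccontr)
    assume "degree P \<noteq> 0"
    then have "filterlim (poly P) at_infinity at_infinity" by (intro filterlim_poly_at_infinity) simp
    then have "\<forall>\<^sub>F s in at_infinity. C + 1 \<le> norm (poly P s)"
      using C filterlim_at_infinity[of C "poly P" at_infinity] by simp
    then obtain s where "C + 1 \<le> \<bar>poly P s\<bar>"
      using eventually_happens'[OF trivial_limit_at_top_linorder filter_leD[OF at_top_le_at_infinity]] by force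
    then have "(C + 1)\<^sup>2 \<le> (poly P s)\<^sup>2" using C by (intro abs_le_square_iff[THEN iffD1]) simp
    also have "\<dots> \<le> C" by (rule le)
    finally show False using C by (simp add: power2_eq_square algebra_simps) (use mult_nonneg_nonneg[OF C C] in linarith)
  qed
  then show ?case by (metis degree_eq_zeroE coeff_pCons_0 monom_0)
next
  case (Suc d)
  have "poly P 0 = 0" using Suc.prems[of 0] by simp
  then obtain R where R: "P = pCons 0 R" by (metis mult_zero_left pCons_cases poly_pCons add.right_neutral)
  have nz: "(poly R s)\<^sup>2 \<le> C * s ^ (2 * d)" if "s \<noteq> 0" for s
  proof -
    have "s\<^sup>2 * (poly R s)\<^sup>2 \<le> s\<^sup>2 * (C * s ^ (2 * d))"
      using Suc.prems[of s] by (simp add: R power_mult_distrib power2_eq_square mult_ac)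
    then show ?thesis using that by (simp add: mult_le_cancel_left)
  qed
  have "(poly R s)\<^sup>2 \<le> C * s ^ (2 * d)" for s
  proof (cases "s = 0")
    case True
    have "((\<lambda>s. C * s ^ (2 * d) - (poly R s)\<^sup>2) \<longlongrightarrow> C * 0 ^ (2 * d) - (poly R 0)\<^sup>2) (at 0)"
      by (intro tendsto_intros)
    then have "0 \<le> C * 0 ^ (2 * d) - (poly R 0)\<^sup>2"
    proof (rule tendsto_lowerbound)
      show "\<forall>\<^sub>F s in at 0. 0 \<le> C * s ^ (2 * d) - (poly R s)\<^sup>2"
        using nz by (simp add: eventually_at_filter)
    qed simp
    then show ?thesis using True by simp
  qed (rule nz)
  from Suc.IH[OF this] have "R = monom (coeff R d) d" .
  then have "P = monom (coeff R d) (Suc d)" using R by (metis monom_Suc)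
  then show ?case by (metis coeff_monom)
qed

lemma homogeneous_sum_of_squares:
  assumes sos: "sum_of_squares n f"
    and hom: "\<And>s x. poly_eval (\<lambda>i. s * x i) f = s ^ (2 * d) * poly_eval x f"
  shows "\<exists>(k :: nat) a. \<forall>x. poly_eval x f = (\<Sum>j<k. (\<Sum>\<alpha>\<in>mons {1..n} d. a j \<alpha> * monom_eval {1..n} \<alpha> x)\<^sup>2)"
proof -
  obtain qs where qs: "set qs \<subseteq> polys_in {1..n}" "f = (\<Sum>q\<leftarrow>qs. q ^ 2)" using sos unfolding sum_of_squares_def by blast
  define N where "N = {1..n}"
  have fin: "finite N" by (simp add: N_def)
  have val: "poly_eval x f = (\<Sum>j<length qs. (poly_eval x (qs ! j))\<^sup>2)" for x
    unfolding qs(2) poly_eval_sum_list by (simp add: poly_eval_power sum_list_sum_nth atLeast0LessThan)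
  define a where "a j \<alpha> = Poly_Mapping.lookup (qs ! j) (Abs_poly_mapping \<alpha>)" for j \<alpha>
  have part: "poly_eval x (qs ! j) = (\<Sum>\<alpha>\<in>mons N d. a j \<alpha> * monom_eval N \<alpha> x)" if j: "j < length qs" for j x
  proof -
    let ?q = "qs ! j"
    let ?B = "Poly_Mapping.lookup ` Poly_Mapping.keys ?q"
    have q: "?q \<in> polys_in N" using qs(1) j by (auto simp: N_def)
    define P where "P = (\<Sum>\<beta>\<in>?B. monom (a j \<beta> * monom_eval N \<beta> x) (\<Sum>i\<in>N. \<beta> i))"
    have P: "poly P s = poly_eval (\<lambda>i. s * x i) ?q" for s
    proof -
      have "monom_eval N \<beta> (\<lambda>i. s * x i) = s ^ (\<Sum>i\<in>N. \<beta> i) * monom_eval N \<beta> x" for \<beta>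
        by (simp add: monom_eval_def power_mult_distrib prod.distrib power_sum)
      then show ?thesis
        by (simp add: poly_eval_lookup[OF fin q] P_def poly_sum poly_monom a_def mult_ac)
    qed
    have "P = monom (coeff P d) d"
    proof (rule poly_bounded_by_monom)
      fix s
      have "(poly P s)\<^sup>2 \<le> (\<Sum>j<length qs. (poly_eval (\<lambda>i. s * x i) (qs ! j))\<^sup>2)"
        unfolding P using j by (intro member_le_sum) auto
      then show "(poly P s)\<^sup>2 \<le> poly_eval x f * s ^ (2 * d)"
        using val[of "\<lambda>i. s * x i"] hom[of s x] by (simp add: mult.commute)
    qed
    then have "poly P 1 = coeff P d" by (metis poly_monom mult_1_right power_one)
    then have "poly_eval x ?q = (\<Sum>\<beta>\<in>?B. if (\<Sum>i\<in>N. \<beta> i) = d then a j \<beta> * monom_eval N \<beta> x else 0)"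
      using P[of 1] by (simp add: P_def coeff_sum)
    also have "\<dots> = (\<Sum>\<beta>\<in>?B \<inter> mons N d. a j \<beta> * monom_eval N \<beta> x)"
    proof -
      have "(\<Sum>\<beta>\<in>?B. if (\<Sum>i\<in>N. \<beta> i) = d then a j \<beta> * monom_eval N \<beta> x else 0) =
        (\<Sum>\<beta>\<in>{\<beta> \<in> ?B. (\<Sum>i\<in>N. \<beta> i) = d}. a j \<beta> * monom_eval N \<beta> x)"
        by (intro sum.mono_neutral_cong_right) auto
      moreover have "{\<beta> \<in> ?B. (\<Sum>i\<in>N. \<beta> i) = d} = ?B \<inter> mons N d"
      proof -
        have "\<beta> i = 0" if "\<beta> \<in> ?B" "i \<notin> N" for \<beta> i
          using that q by (auto simp: polys_in_def not_in_keys_iff_lookup_eq_zero[symmetric]) blast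
        then show ?thesis by (auto simp: mons_def)
      qed
      ultimately show ?thesis by simp
    qed
    also have "\<dots> = (\<Sum>\<beta>\<in>mons N d. a j \<beta> * monom_eval N \<beta> x)"
    proof (rule sum.mono_neutral_left)
      show "\<forall>\<beta>\<in>mons N d - ?B \<inter> mons N d. a j \<beta> * monom_eval N \<beta> x = 0"
      proof
        fix \<beta> assume b: "\<beta> \<in> mons N d - ?B \<inter> mons N d"
        then have "{i. \<beta> i \<noteq> 0} \<subseteq> N" by (auto simp: mons_def)
        then have "finite {i. \<beta> i \<noteq> 0}" using fin by (rule finite_subset)
        then have "Poly_Mapping.lookup (Abs_poly_mapping \<beta>) = \<beta>" by simp
        then have "Abs_poly_mapping \<beta> \<notin> Poly_Mapping.keys ?q" using b by (metis DiffE IntI imageI)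
        then show "a j \<beta> * monom_eval N \<beta> x = 0" by (simp add: a_def in_keys_iff)
      qed
    qed (auto simp: finite_mons fin)
    finally show ?thesis .
  qed
  then have "poly_eval x f = (\<Sum>j<length qs. (\<Sum>\<alpha>\<in>mons N d. a j \<alpha> * monom_eval N \<alpha> x)\<^sup>2)" for x
    by (simp add: val)
  then show ?thesis unfolding N_def by (intro exI[of _ "length qs"] exI[of _ a] allI)
qed

text \<open>The type of a pair of monomials records, up to a permutation of the variables, the pairs of
  exponents that occur together; variables occurring in neither monomial are ignored.\<close>

definition pair_mset :: "nat \<Rightarrow> nat \<Rightarrow> (nat \<times> nat) multiset" where
  "pair_mset a b = (if a = 0 \<and> b = 0 then {#} else {#(a, b)#})"

definition pair_type :: "'i set \<Rightarrow> ('i \<Rightarrow> nat) \<Rightarrow> ('i \<Rightarrow> nat) \<Rightarrow> (nat \<times> nat) multiset" where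
  "pair_type N \<alpha> \<beta> = (\<Sum>i\<in>N. pair_mset (\<alpha> i) (\<beta> i))"

lemma pair_mset_0 [simp]: "pair_mset 0 0 = {#}" by (simp add: pair_mset_def)

lemma pair_type_superset:
  assumes "finite N'" "N \<subseteq> N'" "\<And>i. i \<notin> N \<Longrightarrow> \<alpha> i = 0" "\<And>i. i \<notin> N \<Longrightarrow> \<beta> i = 0"
  shows "pair_type N' \<alpha> \<beta> = pair_type N \<alpha> \<beta>"
  unfolding pair_type_def using assms by (intro sum.mono_neutral_right) auto

lemma pair_type_filter:
  "finite N \<Longrightarrow> pair_type N \<alpha> \<beta> = filter_mset (\<lambda>z. z \<noteq> (0, 0)) (image_mset (\<lambda>i. (\<alpha> i, \<beta> i)) (mset_set N))"
  unfolding pair_type_def by (induction N rule: finite_induct) (auto simp: pair_mset_def)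

text \<open>Both pairs of monomials live on the same N, so equally many indices carry the exponents
  (0, 0). Adding these back gives equal multisets of exponent pairs over N, and equality of such
  multisets is realized by a permutation.\<close>

lemma pair_type_eq_imp_permutes:
  assumes N: "finite N" and "\<alpha> \<in> mons N d" "\<beta> \<in> mons N d" "\<alpha>' \<in> mons N d" "\<beta>' \<in> mons N d"
    and eq: "pair_type N \<alpha> \<beta> = pair_type N \<alpha>' \<beta>'"
  shows "\<exists>p. p permutes N \<and> \<alpha> = \<alpha>' \<circ> p \<and> \<beta> = \<beta>' \<circ> p"
proof -
  let ?I = "\<lambda>\<alpha> \<beta>. image_mset (\<lambda>i. (\<alpha> i, \<beta> i)) (mset_set N)"
  have split: "?I \<alpha> \<beta> = pair_type N \<alpha> \<beta> + replicate_mset (card N - size (pair_type N \<alpha> \<beta>)) (0, 0)"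
    for \<alpha> \<beta> :: "'a \<Rightarrow> nat"
  proof -
    have part: "?I \<alpha> \<beta> = filter_mset (\<lambda>z. z \<noteq> (0, 0)) (?I \<alpha> \<beta>) + filter_mset (\<lambda>z. \<not> z \<noteq> (0, 0)) (?I \<alpha> \<beta>)"
      by (rule multiset_partition)
    have "size (?I \<alpha> \<beta>) = card N" by simp
    then have "size (filter_mset (\<lambda>z. \<not> z \<noteq> (0, 0)) (?I \<alpha> \<beta>)) = card N - size (pair_type N \<alpha> \<beta>)"
      using arg_cong[OF part, of size] unfolding pair_type_filter[OF N] size_union by linarith
    moreover have "filter_mset (\<lambda>z. \<not> z \<noteq> (0, 0)) (?I \<alpha> \<beta>) = replicate_mset (size (filter_mset (\<lambda>z. \<not> z \<noteq> (0, 0)) (?I \<alpha> \<beta>))) (0, 0)"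
      by (rule set_mset_subset_singletonD) auto
    ultimately show ?thesis using part unfolding pair_type_filter[OF N] by simp
  qed
  have "?I \<alpha> \<beta> = ?I \<alpha>' \<beta>'" unfolding split eq ..
  from image_mset_eq_implies_permutes[OF N this] obtain p where
    p: "p permutes N" "\<forall>i\<in>N. (\<alpha> i, \<beta> i) = (\<alpha>' (p i), \<beta>' (p i))" by blast
  have "\<alpha> i = \<alpha>' (p i) \<and> \<beta> i = \<beta>' (p i)" for i
    using p assms by (cases "i \<in> N") (auto simp: mons_def permutes_not_in)
  then show ?thesis using p(1) by (intro exI[of _ p]) (auto simp: comp_def)
qed

lemma monom_eval_permute:
  assumes "p permutes N" "finite N"
  shows "monom_eval N (\<alpha> \<circ> p) x = monom_eval N \<alpha> (x \<circ> inv p)"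
proof -
  have "monom_eval N (\<alpha> \<circ> p) x = (\<Prod>i\<in>N. (x (inv p (p i))) ^ \<alpha> (p i))"
    by (simp add: monom_eval_def permutes_inverses[OF assms(1)])
  also have "\<dots> = (\<Prod>i\<in>N. (x (inv p i)) ^ \<alpha> i)"
    by (rule prod.permute[OF assms(1), unfolded comp_def, symmetric])
  finally show ?thesis by (simp add: monom_eval_def)
qed

lemma mons_permute: "p permutes N \<Longrightarrow> \<alpha> \<in> mons N d \<Longrightarrow> \<alpha> \<circ> p \<in> mons N d"
  using sum.permute[of p N \<alpha>] by (auto simp: mons_def permutes_not_in)

lemma bij_betw_mons_permute:
  assumes "p permutes N" shows "bij_betw (\<lambda>\<alpha>. \<alpha> \<circ> p) (mons N d) (mons N d)"
proof (rule bij_betw_byWitness[where f' = "\<lambda>\<alpha>. \<alpha> \<circ> inv p"])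
  show "\<forall>\<alpha>\<in>mons N d. \<alpha> \<circ> p \<circ> inv p = \<alpha>" using permutes_inv_o[OF assms] by (simp add: o_assoc[symmetric])
  show "\<forall>\<alpha>\<in>mons N d. \<alpha> \<circ> inv p \<circ> p = \<alpha>" using permutes_inv_o[OF assms] by (simp add: o_assoc[symmetric])
qed (use mons_permute[OF assms] mons_permute[OF permutes_inv[OF assms]] in blast)+

lemma sum_mult_square:
  fixes f :: "'a \<Rightarrow> real" shows "(\<Sum>i\<in>A. f i)\<^sup>2 = (\<Sum>i\<in>A. \<Sum>j\<in>A. f i * f j)"
  by (simp add: power2_eq_square sum_product)

text \<open>The invariant representation is the average of the given one over all permutations.\<close>

lemma symmetric_gram:
  fixes F :: "('i \<Rightarrow> real) \<Rightarrow> real" and k :: nat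
  assumes N: "finite N"
    and sos: "\<And>x. F x = (\<Sum>j<k. (\<Sum>\<alpha>\<in>mons N d. a j \<alpha> * monom_eval N \<alpha> x)\<^sup>2)"
    and sym: "\<And>p x. p permutes N \<Longrightarrow> F (x \<circ> p) = F x"
  shows "\<exists>(J :: (nat \<times> ('i \<Rightarrow> 'i)) set) b. finite J \<and>
     (\<forall>x. F x = (\<Sum>j\<in>J. (\<Sum>\<alpha>\<in>mons N d. b j \<alpha> * monom_eval N \<alpha> x)\<^sup>2)) \<and>
     (\<forall>p \<alpha> \<beta>. p permutes N \<longrightarrow> (\<Sum>j\<in>J. b j (\<alpha> \<circ> p) * b j (\<beta> \<circ> p)) = (\<Sum>j\<in>J. b j \<alpha> * b j \<beta> :: real))"
proof -
  let ?S = "{p. p permutes N}"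
  \<comment> \<open>The square root turns the sum over all permutations into an average once the
    terms are squared.\<close>
  define b where "b = (\<lambda>(j, p :: 'i \<Rightarrow> 'i) \<alpha>. a j (\<alpha> \<circ> p) / sqrt (card ?S))"
  have finS: "finite ?S" and "?S \<noteq> {}" using finite_permutations[OF N] permutes_id by blast+
  then have pos: "card ?S > 0" by (simp add: card_gt_0_iff)
  have "F x = (\<Sum>j\<in>{..<k} \<times> ?S. (\<Sum>\<alpha>\<in>mons N d. b j \<alpha> * monom_eval N \<alpha> x)\<^sup>2)" for x
  proof -
    have "(\<Sum>\<alpha>\<in>mons N d. a j (\<alpha> \<circ> p) * monom_eval N \<alpha> x) = (\<Sum>\<alpha>\<in>mons N d. a j \<alpha> * monom_eval N \<alpha> (x \<circ> p))"
      if p: "p permutes N" for j p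
    proof -
      have eq: "monom_eval N (\<alpha> \<circ> p) (x \<circ> p) = monom_eval N \<alpha> x" for \<alpha>
        unfolding monom_eval_permute[OF p N] using permutes_inv_o[OF p] by (simp add: o_assoc[symmetric])
      have "(\<Sum>\<alpha>\<in>mons N d. a j (\<alpha> \<circ> p) * monom_eval N (\<alpha> \<circ> p) (x \<circ> p)) = (\<Sum>\<alpha>\<in>mons N d. a j \<alpha> * monom_eval N \<alpha> (x \<circ> p))"
        by (rule sum.reindex_bij_betw[OF bij_betw_mons_permute[OF p]])
      then show ?thesis by (simp add: eq)
    qed
    then have "(\<Sum>\<alpha>\<in>mons N d. b (j, p) \<alpha> * monom_eval N \<alpha> x)\<^sup>2 =
        (\<Sum>\<alpha>\<in>mons N d. a j \<alpha> * monom_eval N \<alpha> (x \<circ> p))\<^sup>2 / card ?S" if "p \<in> ?S" for j p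
      using that by (simp add: b_def sum_divide_distrib[symmetric] power_divide)
    then have "(\<Sum>j\<in>{..<k} \<times> ?S. (\<Sum>\<alpha>\<in>mons N d. b j \<alpha> * monom_eval N \<alpha> x)\<^sup>2) =
       (\<Sum>(j, p)\<in>{..<k} \<times> ?S. (\<Sum>\<alpha>\<in>mons N d. a j \<alpha> * monom_eval N \<alpha> (x \<circ> p))\<^sup>2 / card ?S)"
      by (intro sum.cong refl) (simp add: split_paired_all)
    then have "(\<Sum>j\<in>{..<k} \<times> ?S. (\<Sum>\<alpha>\<in>mons N d. b j \<alpha> * monom_eval N \<alpha> x)\<^sup>2) =
       (\<Sum>j<k. \<Sum>p\<in>?S. (\<Sum>\<alpha>\<in>mons N d. a j \<alpha> * monom_eval N \<alpha> (x \<circ> p))\<^sup>2 / card ?S)"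
      by (simp add: sum.cartesian_product)
    also have "\<dots> = (\<Sum>p\<in>?S. F (x \<circ> p) / card ?S)"
      by (subst sum.swap) (simp add: sos sum_divide_distrib)
    also have "\<dots> = F x" using pos by (simp add: sym)
    finally show ?thesis by simp
  qed
  moreover have "(\<Sum>j\<in>{..<k} \<times> ?S. b j (\<alpha> \<circ> p) * b j (\<beta> \<circ> p)) = (\<Sum>j\<in>{..<k} \<times> ?S. b j \<alpha> * b j \<beta>)"
    if p: "p permutes N" for p \<alpha> \<beta>
  proof -
    have bij: "bij_betw (\<lambda>q. p \<circ> q) ?S ?S"
    proof (rule bij_betw_byWitness[where f' = "\<lambda>q. inv p \<circ> q"])
      show "(\<lambda>q. p \<circ> q) ` ?S \<subseteq> ?S" using permutes_compose[OF _ p] by blast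
      show "(\<lambda>q. inv p \<circ> q) ` ?S \<subseteq> ?S" using permutes_compose[OF _ permutes_inv[OF p]] by blast
    qed (simp_all add: o_assoc permutes_inv_o[OF p])
    have "(\<Sum>q\<in>?S. a j (\<alpha> \<circ> (p \<circ> q)) * a j (\<beta> \<circ> (p \<circ> q))) = (\<Sum>q\<in>?S. a j (\<alpha> \<circ> q) * a j (\<beta> \<circ> q))" for j
      by (rule sum.reindex_bij_betw[OF bij])
    then have "(\<Sum>q\<in>?S. b (j, q) (\<alpha> \<circ> p) * b (j, q) (\<beta> \<circ> p)) = (\<Sum>q\<in>?S. b (j, q) \<alpha> * b (j, q) \<beta>)" for j
      by (simp add: b_def sum_divide_distrib[symmetric] o_assoc)
    then have "(\<Sum>j<k. \<Sum>q\<in>?S. b (j, q) (\<alpha> \<circ> p) * b (j, q) (\<beta> \<circ> p)) = (\<Sum>j<k. \<Sum>q\<in>?S. b (j, q) \<alpha> * b (j, q) \<beta>)"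
      by simp
    then show ?thesis by (simp add: sum.cartesian_product case_prod_unfold)
  qed
  ultimately show ?thesis using finS by (intro exI[of _ "{..<k} \<times> ?S"] exI[of _ b]) simp
qed

section \<open>Symmetric forms in varying numbers of variables\<close>

definition form_value :: "(nat multiset \<Rightarrow> real) \<Rightarrow> nat \<Rightarrow> nat \<Rightarrow> (nat \<Rightarrow> real) \<Rightarrow> real" where
  "form_value c k n x = (\<Sum>\<mu>\<in>partitions k. c \<mu> * power_sum_value {1..n} \<mu> x)"

lemma form_value_permute:
  assumes "p permutes {1..n}" shows "form_value c k n (x \<circ> p) = form_value c k n x"
proof -
  have "(\<Sum>i\<in>{1..n}. (x \<circ> p) i ^ r) = (\<Sum>i\<in>{1..n}. x i ^ r)" for r
    using sum.permute[OF assms, of "\<lambda>i. x i ^ r"] by (simp add: comp_def)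
  then show ?thesis by (simp add: form_value_def power_sum_value_def)
qed

text \<open>All parts are positive, so variables set to 0 contribute nothing; a part 0 would count
  them. By this a representation in n variables restricts to one in fewer variables.\<close>

lemma form_value_extend:
  assumes "m \<le> n" "\<And>i. i \<notin> {1..m} \<Longrightarrow> x i = 0"
  shows "form_value c k n x = form_value c k m x"
  unfolding form_value_def
proof (intro sum.cong refl arg_cong2[where f = times])
  fix \<mu> assume "\<mu> \<in> partitions k"
  then have pos: "r > 0" if "r \<in># \<mu>" for r using that by (auto simp: partitions_def intro: Nat.gr0I)
  have "(\<Sum>i\<in>{1..n}. x i ^ r) = (\<Sum>i\<in>{1..m}. x i ^ r)" if "r \<in># \<mu>" for r
    using assms pos[OF that] by (intro sum.mono_neutral_right) auto
  then show "power_sum_value {1..n} \<mu> x = power_sum_value {1..m} \<mu> x"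
    unfolding power_sum_value_def by (intro arg_cong[where f = prod_mset] image_mset_cong)
qed

lemma power_sum_value_scale:
  "power_sum_value N \<mu> (\<lambda>i. s * x i) = s ^ sum_mset \<mu> * power_sum_value N \<mu> x"
proof -
  have "(\<Sum>i\<in>N. (s * x i) ^ r) = s ^ r * (\<Sum>i\<in>N. x i ^ r)" for r
    by (simp add: power_mult_distrib sum_distrib_left)
  then show ?thesis unfolding power_sum_value_def
    by (induction \<mu>) (simp_all add: power_add mult_ac)
qed

lemma form_value_scale: "form_value c k n (\<lambda>i. s * x i) = s ^ k * form_value c k n x"
  unfolding form_value_def
  unfolding sum_distrib_left by (intro sum.cong refl) (simp add: power_sum_value_scale partitions_def)

lemma convergent_subsequence_finite:
  fixes f :: "nat \<Rightarrow> 'a \<Rightarrow> real"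
  assumes "finite T" "\<And>\<tau>. \<tau> \<in> T \<Longrightarrow> Bseq (\<lambda>n. f n \<tau>)"
  shows "\<exists>r :: nat \<Rightarrow> nat. strict_mono r \<and> (\<forall>\<tau>\<in>T. convergent (\<lambda>n. f (r n) \<tau>))"
  using assms
proof (induction T rule: finite_induct)
  case empty
  then show ?case using strict_mono_id by auto
next
  case (insert \<tau> T)
  then obtain r :: "nat \<Rightarrow> nat" where r: "strict_mono r" "\<And>\<tau>. \<tau> \<in> T \<Longrightarrow> convergent (\<lambda>n. f (r n) \<tau>)" by auto
  obtain q :: "nat \<Rightarrow> nat" where q: "strict_mono q" "monoseq (\<lambda>n. f (r (q n)) \<tau>)"
    using seq_monosub[of "\<lambda>n. f (r n) \<tau>"] by blast
  have "Bseq (\<lambda>n. f n \<tau>)" using insert.prems by simp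
  then have "Bseq (\<lambda>n. f ((r \<circ> q) n) \<tau>)" using Bseq_subseq[of "\<lambda>n. f n \<tau>" "r \<circ> q"] by simp
  then have "convergent (\<lambda>n. f ((r \<circ> q) n) \<tau>)" using q(2) by (intro Bseq_monoseq_convergent) (simp_all add: comp_def)
  moreover have "convergent (\<lambda>n. f ((r \<circ> q) n) \<tau>')" if "\<tau>' \<in> T" for \<tau>'
    using convergent_subseq_convergent[OF r(2)[OF that] q(1)] by (simp add: comp_def)
  moreover have "strict_mono (r \<circ> q)" using r q by (simp add: strict_mono_o)
  ultimately show ?case by (intro exI[of _ "r \<circ> q"] conjI ballI) (auto simp: comp_def)
qed

lemma mons_mono:
  assumes "finite N'" "N \<subseteq> N'" shows "mons N d \<subseteq> mons N' d"
proof
  fix \<alpha> assume a: "\<alpha> \<in> mons N d"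
  have "(\<Sum>i\<in>N'. \<alpha> i) = (\<Sum>i\<in>N. \<alpha> i)"
    using assms a by (intro sum.mono_neutral_right) (auto simp: mons_def)
  then show "\<alpha> \<in> mons N' d" using a assms by (auto simp: mons_def)
qed

lemma pair_type_transfer:
  assumes h: "bij_betw h {1..m} N"
  defines "tr \<equiv> \<lambda>(\<alpha> :: 'i \<Rightarrow> nat) i. if i \<in> {1..m::nat} then \<alpha> (h i) else 0"
  shows "pair_type {1..m} (tr \<alpha>) (tr \<beta>) = pair_type N \<alpha> \<beta>"
    and "\<alpha> \<in> mons N d \<Longrightarrow> tr \<alpha> \<in> mons {1..m} d"
proof -
  show "pair_type {1..m} (tr \<alpha>) (tr \<beta>) = pair_type N \<alpha> \<beta>"
    using sum.reindex_bij_betw[OF h, of "\<lambda>i. pair_mset (\<alpha> i) (\<beta> i)"]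
    by (simp add: pair_type_def tr_def cong: sum.cong_simp)
  show "tr \<alpha> \<in> mons {1..m} d" if "\<alpha> \<in> mons N d"
    using sum.reindex_bij_betw[OF h, of \<alpha>] that by (simp add: mons_def tr_def cong: sum.cong_simp)
qed

text \<open>Two monomials of degree d together involve at most 2d variables. So the number of types
  is bounded independently of the number of variables, which makes a limit of Gram matrices
  possible.\<close>

lemma pair_type_realized:
  assumes N: "finite N" and \<alpha>: "\<alpha> \<in> mons N d" and \<beta>: "\<beta> \<in> mons N d"
  shows "\<exists>\<alpha>'\<in>mons {1..2 * d} d. \<exists>\<beta>'\<in>mons {1..2 * d} d. pair_type {1..2 * d} \<alpha>' \<beta>' = pair_type N \<alpha> \<beta>"
proof -
  define S where "S = {i \<in> N. \<alpha> i \<noteq> 0} \<union> {i \<in> N. \<beta> i \<noteq> 0}"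
  have card: "card {i \<in> N. \<gamma> i \<noteq> 0} \<le> d" if "\<gamma> \<in> mons N d" for \<gamma>
  proof -
    have "card {i \<in> N. \<gamma> i \<noteq> 0} = (\<Sum>i\<in>{i \<in> N. \<gamma> i \<noteq> 0}. 1)" by simp
    also have "\<dots> \<le> (\<Sum>i\<in>{i \<in> N. \<gamma> i \<noteq> 0}. \<gamma> i)" by (intro sum_mono) auto
    also have "\<dots> \<le> (\<Sum>i\<in>N. \<gamma> i)" using N by (intro sum_mono2) auto
    finally show ?thesis using that by (simp add: mons_def)
  qed
  have finS: "finite S" using N by (simp add: S_def)
  have cS: "card S \<le> 2 * d" using card_Un_le[of "{i \<in> N. \<alpha> i \<noteq> 0}" "{i \<in> N. \<beta> i \<noteq> 0}"] card[OF \<alpha>] card[OF \<beta>]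
    unfolding S_def by linarith
  have out: "\<alpha> i = 0" "\<beta> i = 0" if "i \<notin> S" for i using that \<alpha> \<beta> by (auto simp: S_def mons_def)
  have SN: "S \<subseteq> N" by (auto simp: S_def)
  have inS: "\<gamma> \<in> mons S d" if "\<gamma> \<in> mons N d" "\<And>i. i \<notin> S \<Longrightarrow> \<gamma> i = 0" for \<gamma>
  proof -
    have "(\<Sum>i\<in>N. \<gamma> i) = (\<Sum>i\<in>S. \<gamma> i)" using that SN N by (intro sum.mono_neutral_right) auto
    then show ?thesis using that by (auto simp: mons_def)
  qed
  obtain h where h: "bij_betw h {1..card S} S" using ex_bij_betw_nat_finite_1[OF finS] by blast
  define tr where "tr = (\<lambda>(\<alpha> :: 'a \<Rightarrow> nat) i. if i \<in> {1..card S} then \<alpha> (h i) else 0)"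
  have tr: "tr \<alpha> \<in> mons {1..card S} d" "tr \<beta> \<in> mons {1..card S} d"
    unfolding tr_def using pair_type_transfer(2)[OF h] inS \<alpha> \<beta> out by blast+
  have sub: "{1..card S} \<subseteq> {1..2 * d}" using cS by auto
  have "pair_type {1..2 * d} (tr \<alpha>) (tr \<beta>) = pair_type {1..card S} (tr \<alpha>) (tr \<beta>)"
    by (rule pair_type_superset) (use sub in \<open>auto simp: tr_def\<close>)
  also have "\<dots> = pair_type S \<alpha> \<beta>" unfolding tr_def by (rule pair_type_transfer(1)[OF h])
  also have "\<dots> = pair_type N \<alpha> \<beta>" by (rule pair_type_superset[symmetric]) (use N SN out in auto)
  finally show ?thesis using tr mons_mono[OF _ sub, of d] by blast
qed

lemma sum_mons_restrict:
  fixes m n :: nat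
  assumes "m \<le> n" "\<And>i. i \<notin> {1..m} \<Longrightarrow> x i = 0"
  shows "(\<Sum>\<alpha>\<in>mons {1..n} d. w \<alpha> * monom_eval {1..n} \<alpha> x) = (\<Sum>\<alpha>\<in>mons {1..m} d. w \<alpha> * monom_eval {1..m} \<alpha> x)"
proof -
  have sub: "mons {1..m} d \<subseteq> mons {1..n} d" using assms(1) by (intro mons_mono) auto
  have "(\<Sum>\<alpha>\<in>mons {1..n} d. w \<alpha> * monom_eval {1..n} \<alpha> x) = (\<Sum>\<alpha>\<in>mons {1..m} d. w \<alpha> * monom_eval {1..n} \<alpha> x)"
  proof (rule sum.mono_neutral_right[OF _ sub])
    show "finite (mons {1..n} d)" by (simp add: finite_mons)
    show "\<forall>\<alpha>\<in>mons {1..n} d - mons {1..m} d. w \<alpha> * monom_eval {1..n} \<alpha> x = 0"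
    proof
      fix \<alpha> assume a: "\<alpha> \<in> mons {1..n} d - mons {1..m} d"
      have "\<exists>i\<in>{1..n}. i \<notin> {1..m} \<and> \<alpha> i \<noteq> 0"
      proof (rule ccontr)
        assume neg: "\<not> ?thesis"
        then have out: "\<alpha> i = 0" if "i \<notin> {1..m}" for i using a that by (cases "i \<in> {1..n}") (auto simp: mons_def)
        have "(\<Sum>i\<in>{1..n}. \<alpha> i) = (\<Sum>i\<in>{1..m}. \<alpha> i)"
          using assms(1) out by (intro sum.mono_neutral_right) auto
        then have "\<alpha> \<in> mons {1..m} d" using a out by (auto simp: mons_def)
        then show False using a by blast
      qed
      then have "monom_eval {1..n} \<alpha> x = 0" unfolding monom_eval_def using assms(2)
        by (intro prod_zero) auto
      then show "w \<alpha> * monom_eval {1..n} \<alpha> x = 0" by simp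
    qed
  qed
  also have "\<dots> = (\<Sum>\<alpha>\<in>mons {1..m} d. w \<alpha> * monom_eval {1..m} \<alpha> x)"
  proof (intro sum.cong refl arg_cong2[where f = times])
    fix \<alpha> assume "\<alpha> \<in> mons {1..m} d"
    then show "monom_eval {1..n} \<alpha> x = monom_eval {1..m} \<alpha> x"
      unfolding monom_eval_def using assms(1) by (intro prod.mono_neutral_right) (auto simp: mons_def)
  qed
  finally show ?thesis .
qed

lemma sum_product_bound:
  fixes f g :: "'a \<Rightarrow> real"
  shows "\<bar>\<Sum>j\<in>J. f j * g j\<bar> \<le> (\<Sum>j\<in>J. (f j)\<^sup>2) + (\<Sum>j\<in>J. (g j)\<^sup>2)"
proof -
  have "\<bar>f j * g j\<bar> \<le> (f j)\<^sup>2 + (g j)\<^sup>2" for j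
  proof -
    have "2 * \<bar>f j * g j\<bar> \<le> (f j)\<^sup>2 + (g j)\<^sup>2"
      using sum_squares_bound[of "\<bar>f j\<bar>" "\<bar>g j\<bar>"] by (simp add: abs_mult)
    then show ?thesis using abs_ge_zero[of "f j * g j"] by linarith
  qed
  then have "(\<Sum>j\<in>J. \<bar>f j * g j\<bar>) \<le> (\<Sum>j\<in>J. (f j)\<^sup>2 + (g j)\<^sup>2)" by (rule sum_mono)
  then show ?thesis using sum_abs[of "\<lambda>j. f j * g j" J] unfolding sum.distrib by linarith
qed

text \<open>\<open>coefficient_extraction\<close> expresses a coefficient by values at grid points,
  and Cauchy-Schwarz bounds the diagonal Gram entry by a constant times the sum of F over the grid.
  C is the same for all J and b, hence for Gram matrices in arbitrarily many variables once they are
  restricted to the first m.\<close>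

lemma gram_diagonal_bound:
  fixes F :: "(nat \<Rightarrow> real) \<Rightarrow> real"
  assumes \<alpha>: "\<alpha> \<in> mons {1..m} d"
  shows "\<exists>C. \<forall>(J :: 'j set) b. (\<forall>x. (\<forall>i. i \<notin> {1..m} \<longrightarrow> x i = 0) \<longrightarrow>
       F x = (\<Sum>j\<in>J. (\<Sum>\<beta>\<in>mons {1..m} d. b j \<beta> * monom_eval {1..m} \<beta> x)\<^sup>2)) \<longrightarrow>
     (\<Sum>j\<in>J. (b j \<alpha>)\<^sup>2) \<le> C"
proof -
  let ?N = "{1..m}" and ?T = "{1..m} \<rightarrow>\<^sub>E {..d}"
  have finM: "finite (mons ?N d)" by (simp add: finite_mons)
  have "\<exists>\<omega>. \<forall>a. (\<Sum>t\<in>?T. \<omega> t * (\<Sum>\<beta>\<in>mons ?N d. a \<beta> * monom_eval ?N \<beta> (\<lambda>i. real (t i)))) = a \<alpha>"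
  proof (rule coefficient_extraction)
    show "\<beta> i \<le> d" if "\<beta> \<in> mons ?N d" for \<beta> i using mons_le[OF _ that] by simp
    show "\<beta> i = 0" if "\<beta> \<in> mons ?N d" "i \<notin> ?N" for \<beta> i using that unfolding mons_def by blast
  qed (use \<alpha> finM in simp_all)
  then obtain \<omega> where \<omega>: "\<forall>a. (\<Sum>t\<in>?T. \<omega> t * (\<Sum>\<beta>\<in>mons ?N d. a \<beta> * monom_eval ?N \<beta> (\<lambda>i. real (t i)))) = a \<alpha>"
    by (elim exE) (rule that)
  define X where "X t i = (if i \<in> ?N then real (t i) else 0)" for t :: "nat \<Rightarrow> nat" and i
  have monX: "monom_eval ?N \<beta> (\<lambda>i. real (t i)) = monom_eval ?N \<beta> (X t)" for \<beta> t
    unfolding monom_eval_def X_def by (intro prod.cong) auto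
  have "(\<Sum>j\<in>J. (b j \<alpha>)\<^sup>2) \<le> (\<Sum>t\<in>?T. (\<omega> t)\<^sup>2) * (\<Sum>t\<in>?T. F (X t))"
    if F: "\<forall>x. (\<forall>i. i \<notin> {1..m} \<longrightarrow> x i = 0) \<longrightarrow>
       F x = (\<Sum>j\<in>J. (\<Sum>\<beta>\<in>mons {1..m} d. b j \<beta> * monom_eval {1..m} \<beta> x)\<^sup>2)" for J :: "'j set" and b
  proof -
    define Q where "Q j t = (\<Sum>\<beta>\<in>mons ?N d. b j \<beta> * monom_eval ?N \<beta> (X t))" for j t
    have "(b j \<alpha>)\<^sup>2 \<le> (\<Sum>t\<in>?T. (\<omega> t)\<^sup>2) * (\<Sum>t\<in>?T. (Q j t)\<^sup>2)" for j
    proof -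
      have "b j \<alpha> = (\<Sum>t\<in>?T. \<omega> t * Q j t)" using spec[OF \<omega>, of "b j"] by (simp only: Q_def monX[symmetric])
      then show ?thesis using Cauchy_Schwarz_ineq_sum[of \<omega> "Q j" ?T] by simp
    qed
    then have "(\<Sum>j\<in>J. (b j \<alpha>)\<^sup>2) \<le> (\<Sum>j\<in>J. (\<Sum>t\<in>?T. (\<omega> t)\<^sup>2) * (\<Sum>t\<in>?T. (Q j t)\<^sup>2))" by (rule sum_mono)
    also have "\<dots> = (\<Sum>t\<in>?T. (\<omega> t)\<^sup>2) * (\<Sum>j\<in>J. \<Sum>t\<in>?T. (Q j t)\<^sup>2)" by (simp add: sum_distrib_left)
    also have "(\<Sum>j\<in>J. \<Sum>t\<in>?T. (Q j t)\<^sup>2) = (\<Sum>t\<in>?T. F (X t))"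
    proof (subst sum.swap, rule sum.cong[OF refl])
      fix t
      have "\<forall>i. i \<notin> ?N \<longrightarrow> X t i = 0" by (simp add: X_def)
      with F show "(\<Sum>j\<in>J. (Q j t)\<^sup>2) = F (X t)" unfolding Q_def by simp
    qed
    finally show ?thesis .
  qed
  then show ?thesis by (intro exI[of _ "(\<Sum>t\<in>?T. (\<omega> t)\<^sup>2) * (\<Sum>t\<in>?T. F (X t))"]) simp
qed

section \<open>The limit of the invariant Gram matrices\<close>

text \<open>A permutation-invariant positive semidefinite matrix on the monomials of degree d in
  infinitely many variables: one function of the type serves for every m.\<close>

definition gram_kernel :: "nat \<Rightarrow> ((nat \<times> nat) multiset \<Rightarrow> real) \<Rightarrow> bool" where
  "gram_kernel d g \<longleftrightarrow>
    (\<forall>m :: nat. \<forall>\<alpha>\<in>mons {1..m} d. \<forall>\<beta>\<in>mons {1..m} d. g (pair_type {1..m} \<alpha> \<beta>) = g (pair_type {1..m} \<beta> \<alpha>)) \<and>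
    (\<forall>(m :: nat) (K :: nat) \<gamma> u. (\<forall>k<K. \<gamma> k \<in> mons {1..m} d) \<longrightarrow>
      0 \<le> (\<Sum>k<K. \<Sum>l<K. u k * u l * g (pair_type {1..m} (\<gamma> k) (\<gamma> l))))"

text \<open>For fixed m, the entries between monomials in the first m variables also represent the
  form in m variables: putting the other variables to 0 kills all other monomials and changes no
  type. So a limit of the entries along a subsequence represents the form for all m at once.\<close>

lemma limit_gram_kernel:
  assumes sos: "\<And>n. n \<ge> 2 * d \<Longrightarrow> sum_of_squares n (sym_form (partitions (2 * d)) n c)"
  shows "\<exists>g. gram_kernel d g \<and> (\<forall>m x. form_value c (2 * d) m x =
    (\<Sum>\<alpha>\<in>mons {1..m} d. \<Sum>\<beta>\<in>mons {1..m} d.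
      g (pair_type {1..m} \<alpha> \<beta>) * (monom_eval {1..m} \<alpha> x * monom_eval {1..m} \<beta> x)))"
proof -
  let ?M = "\<lambda>n. mons {1..n::nat} d" and ?e = "\<lambda>n. monom_eval {1..n::nat}" and ?F = "form_value c (2 * d)"
  define good where "good n J b \<longleftrightarrow> (\<forall>x. ?F n x = (\<Sum>j\<in>J. (\<Sum>\<alpha>\<in>?M n. b j \<alpha> * ?e n \<alpha> x)\<^sup>2)) \<and>
     (\<forall>p \<alpha> \<beta>. p permutes {1..n} \<longrightarrow> (\<Sum>j\<in>J. b j (\<alpha> \<circ> p) * b j (\<beta> \<circ> p)) = (\<Sum>j\<in>J. b j \<alpha> * b j \<beta>))"
    for n and J :: "(nat \<times> (nat \<Rightarrow> nat)) set" and b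
  have "\<exists>J b. good n J b" if n: "n \<ge> 2 * d" for n
  proof -
    have val: "poly_eval x (sym_form (partitions (2 * d)) n c) = ?F n x" for x
      by (simp add: poly_eval_sym_form form_value_def)
    have "\<exists>(k :: nat) a. \<forall>x. ?F n x = (\<Sum>j<k. (\<Sum>\<alpha>\<in>?M n. a j \<alpha> * ?e n \<alpha> x)\<^sup>2)"
      using homogeneous_sum_of_squares[OF sos[OF n], of d] by (simp only: val form_value_scale)
    then obtain k a where "\<And>x. ?F n x = (\<Sum>j<(k::nat). (\<Sum>\<alpha>\<in>?M n. a j \<alpha> * ?e n \<alpha> x)\<^sup>2)" by blast
    note ka = this
    have "\<exists>J b. finite J \<and> good n J b" unfolding good_def
    proof (rule symmetric_gram[OF finite_atLeastAtMost ka])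
      show "?F n (x \<circ> p) = ?F n x" if "p permutes {1..n}" for p x using that by (rule form_value_permute)
    qed
    then show ?thesis by blast
  qed
  then have "\<forall>n. \<exists>z. n \<ge> 2 * d \<longrightarrow> good n (fst z) (snd z)" by (metis fst_conv snd_conv)
  then obtain z where z: "\<forall>n. n \<ge> 2 * d \<longrightarrow> good n (fst (z n)) (snd (z n))"
    by (elim choice[THEN exE]) (rule that)
  define J where "J n = fst (z n)" for n
  define b where "b n = snd (z n)" for n
  have gram: "?F n x = (\<Sum>j\<in>J n. (\<Sum>\<alpha>\<in>?M n. b n j \<alpha> * ?e n \<alpha> x)\<^sup>2)" if "n \<ge> 2 * d" for n x
    using z[rule_format, OF that] by (simp add: good_def J_def b_def)
  have sym: "(\<Sum>j\<in>J n. b n j (\<alpha> \<circ> p) * b n j (\<beta> \<circ> p)) = (\<Sum>j\<in>J n. b n j \<alpha> * b n j \<beta>)"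
    if "n \<ge> 2 * d" "p permutes {1..n}" for n p \<alpha> \<beta>
    using z[rule_format, OF that(1)] that(2) unfolding good_def J_def b_def by blast
  define \<Gamma> where "\<Gamma> n \<alpha> \<beta> = (\<Sum>j\<in>J n. b n j \<alpha> * b n j \<beta>)" for n \<alpha> \<beta>
  have restrict: "?F m x = (\<Sum>j\<in>J n. (\<Sum>\<alpha>\<in>?M m. b n j \<alpha> * ?e m \<alpha> x)\<^sup>2)"
    if "n \<ge> 2 * d" "m \<le> n" "\<And>i. i \<notin> {1..m} \<Longrightarrow> x i = 0" for n m x
    using gram[OF that(1), of x] form_value_extend[OF that(2,3)] sum_mons_restrict[OF that(2,3)] by simp
  have mM: "?M m \<subseteq> ?M n" if "m \<le> n" for m n using that by (intro mons_mono) auto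
  have tM: "pair_type {1..n} \<alpha> \<beta> = pair_type {1..m} \<alpha> \<beta>" if "m \<le> n" "\<alpha> \<in> ?M m" "\<beta> \<in> ?M m" for m n \<alpha> \<beta>
    using that by (intro pair_type_superset) (auto simp: mons_def)

  define \<T> where "\<T> = (\<lambda>(\<alpha>, \<beta>). pair_type {1..2 * d} \<alpha> \<beta>) ` (?M (2 * d) \<times> ?M (2 * d))"
  have finT: "finite \<T>" by (simp add: \<T>_def finite_mons)
  have inT: "pair_type {1..m} \<alpha> \<beta> \<in> \<T>" if "\<alpha> \<in> ?M m" "\<beta> \<in> ?M m" for m \<alpha> \<beta>
    using pair_type_realized[OF _ that] by (force simp: \<T>_def)
  have "\<exists>\<alpha> \<beta>. \<tau> \<in> \<T> \<longrightarrow> \<alpha> \<in> ?M (2 * d) \<and> \<beta> \<in> ?M (2 * d) \<and> pair_type {1..2 * d} \<alpha> \<beta> = \<tau>" for \<tau>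
    by (auto simp: \<T>_def)
  then obtain A B where AB: "\<And>\<tau>. \<tau> \<in> \<T> \<Longrightarrow> A \<tau> \<in> ?M (2 * d) \<and> B \<tau> \<in> ?M (2 * d) \<and> pair_type {1..2 * d} (A \<tau>) (B \<tau>) = \<tau>"
    by metis
  \<comment> \<open>Entries are indexed by types, through representatives in 2d variables, so that a
    single finite index set serves all n.\<close>
  define G where "G n \<tau> = \<Gamma> n (A \<tau>) (B \<tau>)" for n \<tau>
  have \<Gamma>G: "\<Gamma> n \<alpha> \<beta> = G n (pair_type {1..n} \<alpha> \<beta>)" if n: "n \<ge> 2 * d" and ab: "\<alpha> \<in> ?M n" "\<beta> \<in> ?M n" for n \<alpha> \<beta>
  proof -
    define \<tau> where "\<tau> = pair_type {1..n} \<alpha> \<beta>"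
    have "\<tau> \<in> \<T>" using inT[OF ab] by (simp add: \<tau>_def)
    note * = AB[OF this]
    have **: "A \<tau> \<in> ?M n" "B \<tau> \<in> ?M n" using * mM[OF n] by blast+
    have "pair_type {1..n} (A \<tau>) (B \<tau>) = \<tau>" using * tM[OF n] by simp
    then have "pair_type {1..n} \<alpha> \<beta> = pair_type {1..n} (A \<tau>) (B \<tau>)" by (simp add: \<tau>_def)
    from pair_type_eq_imp_permutes[OF finite_atLeastAtMost ab ** this]
    obtain p where p: "p permutes {1..n}" "\<alpha> = A \<tau> \<circ> p" "\<beta> = B \<tau> \<circ> p" by blast
    have "\<Gamma> n \<alpha> \<beta> = \<Gamma> n (A \<tau>) (B \<tau>)" unfolding \<Gamma>_def p(2,3) by (rule sym[OF n p(1)])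
    then show ?thesis by (simp add: G_def \<tau>_def)
  qed
  have diag: "\<exists>C. \<forall>n\<ge>2 * d. \<Gamma> n \<alpha> \<alpha> \<le> C" if \<alpha>: "\<alpha> \<in> ?M (2 * d)" for \<alpha>
  proof -
    obtain C where C: "\<And>(J :: (nat \<times> (nat \<Rightarrow> nat)) set) b. (\<forall>x. (\<forall>i. i \<notin> {1..2 * d} \<longrightarrow> x i = 0) \<longrightarrow>
       ?F (2 * d) x = (\<Sum>j\<in>J. (\<Sum>\<beta>\<in>?M (2 * d). b j \<beta> * ?e (2 * d) \<beta> x)\<^sup>2)) \<Longrightarrow> (\<Sum>j\<in>J. (b j \<alpha>)\<^sup>2) \<le> C"
      using gram_diagonal_bound[OF \<alpha>, of "?F (2 * d)"] by blast
    have "\<Gamma> n \<alpha> \<alpha> \<le> C" if "n \<ge> 2 * d" for n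
      using C[where J = "J n" and b = "b n"] restrict[OF that that] by (simp add: \<Gamma>_def power2_eq_square)
    then show ?thesis by blast
  qed
  \<comment> \<open>Off-diagonal entries are controlled by diagonal ones. The shift by 2d skips
    those n for which no representation is given.\<close>
  have "Bseq (\<lambda>n. G (n + 2 * d) \<tau>)" if "\<tau> \<in> \<T>" for \<tau>
  proof -
    note * = AB[OF that]
    obtain C where C: "\<forall>n\<ge>2 * d. \<Gamma> n (A \<tau>) (A \<tau>) \<le> C" using diag[of "A \<tau>"] * by blast
    obtain D where D: "\<forall>n\<ge>2 * d. \<Gamma> n (B \<tau>) (B \<tau>) \<le> D" using diag[of "B \<tau>"] * by blast
    have "\<bar>G (n + 2 * d) \<tau>\<bar> \<le> C + D" for n
    proof -
      have "\<bar>G (n + 2 * d) \<tau>\<bar> \<le> \<Gamma> (n + 2 * d) (A \<tau>) (A \<tau>) + \<Gamma> (n + 2 * d) (B \<tau>) (B \<tau>)"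
        using sum_product_bound[of "\<lambda>j. b (n + 2 * d) j (A \<tau>)" "\<lambda>j. b (n + 2 * d) j (B \<tau>)" "J (n + 2 * d)"]
        by (simp add: G_def \<Gamma>_def power2_eq_square)
      moreover have "\<Gamma> (n + 2 * d) (A \<tau>) (A \<tau>) \<le> C" "\<Gamma> (n + 2 * d) (B \<tau>) (B \<tau>) \<le> D" using C D by simp_all
      ultimately show ?thesis by linarith
    qed
    then show ?thesis by (intro BseqI'[of _ "C + D"]) simp
  qed
  from convergent_subsequence_finite[OF finT, of "\<lambda>n. G (n + 2 * d)", OF this] obtain r0 :: "nat \<Rightarrow> nat" where
    r0: "strict_mono r0" "\<And>\<tau>. \<tau> \<in> \<T> \<Longrightarrow> convergent (\<lambda>n. G (r0 n + 2 * d) \<tau>)" by blast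
  define r where "r n = r0 n + 2 * d" for n
  have r: "r n \<ge> 2 * d" "r n \<ge> n" for n using seq_suble[OF r0(1), of n] by (auto simp: r_def)
  define g where "g \<tau> = lim (\<lambda>n. G (r n) \<tau>)" for \<tau>
  have "(\<lambda>n. G (r n) (pair_type {1..m} \<alpha> \<beta>)) \<longlonglongrightarrow> g (pair_type {1..m} \<alpha> \<beta>)" if "\<alpha> \<in> ?M m" "\<beta> \<in> ?M m" for m \<alpha> \<beta>
    using r0(2)[OF inT[OF that]] unfolding g_def r_def by (simp add: convergent_LIMSEQ_iff)
  moreover have "G (r n) (pair_type {1..m} \<alpha> \<beta>) = \<Gamma> (r n) \<alpha> \<beta>" if "n \<ge> m" "\<alpha> \<in> ?M m" "\<beta> \<in> ?M m" for n m \<alpha> \<beta>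
  proof -
    have le: "m \<le> r n" using r(2)[of n] that by linarith
    have "\<alpha> \<in> ?M (r n)" "\<beta> \<in> ?M (r n)" using mM[OF le] that by blast+
    from \<Gamma>G[OF r(1) this] tM[OF le that(2,3)] show ?thesis by simp
  qed
  ultimately have lim: "(\<lambda>n. \<Gamma> (r n) \<alpha> \<beta>) \<longlonglongrightarrow> g (pair_type {1..m} \<alpha> \<beta>)" if "\<alpha> \<in> ?M m" "\<beta> \<in> ?M m" for m \<alpha> \<beta>
    using that Lim_transform_eventually[where f = "\<lambda>n. G (r n) (pair_type {1..m} \<alpha> \<beta>)" and F = sequentially]
    by (metis (mono_tags, lifting) eventually_sequentiallyI)

  have "gram_kernel d g"
    unfolding gram_kernel_def
  proof (intro conjI allI ballI impI)
    fix m \<alpha> \<beta> assume ab: "\<alpha> \<in> ?M m" "\<beta> \<in> ?M m"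
    have "\<Gamma> (r n) \<beta> \<alpha> = \<Gamma> (r n) \<alpha> \<beta>" for n by (simp add: \<Gamma>_def mult.commute)
    then show "g (pair_type {1..m} \<alpha> \<beta>) = g (pair_type {1..m} \<beta> \<alpha>)"
      using LIMSEQ_unique[OF lim[OF ab]] lim[OF ab(2,1)] by simp
  next
    fix m :: nat and K :: nat and \<gamma> u assume \<gamma>: "\<forall>k<K. \<gamma> k \<in> ?M m"
    have "(\<lambda>n. \<Sum>k<K. \<Sum>l<K. u k * u l * \<Gamma> (r n) (\<gamma> k) (\<gamma> l)) \<longlonglongrightarrow> (\<Sum>k<K. \<Sum>l<K. u k * u l * g (pair_type {1..m} (\<gamma> k) (\<gamma> l)))"
      using \<gamma> by (intro tendsto_sum tendsto_mult tendsto_const lim) auto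
    moreover have "0 \<le> (\<Sum>k<K. \<Sum>l<K. u k * u l * \<Gamma> (r n) (\<gamma> k) (\<gamma> l))" for n
    proof -
      have "(\<Sum>k<K. \<Sum>l<K. u k * u l * \<Gamma> (r n) (\<gamma> k) (\<gamma> l)) =
          (\<Sum>k<K. \<Sum>l<K. \<Sum>j\<in>J (r n). (u k * b (r n) j (\<gamma> k)) * (u l * b (r n) j (\<gamma> l)))"
        by (simp add: \<Gamma>_def sum_distrib_left mult_ac)
      also have "\<dots> = (\<Sum>k<K. \<Sum>j\<in>J (r n). \<Sum>l<K. (u k * b (r n) j (\<gamma> k)) * (u l * b (r n) j (\<gamma> l)))"
        by (intro sum.cong refl sum.swap)
      also have "\<dots> = (\<Sum>j\<in>J (r n). \<Sum>k<K. \<Sum>l<K. (u k * b (r n) j (\<gamma> k)) * (u l * b (r n) j (\<gamma> l)))"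
        by (rule sum.swap)
      also have "\<dots> = (\<Sum>j\<in>J (r n). (\<Sum>k<K. u k * b (r n) j (\<gamma> k))\<^sup>2)"
        by (simp add: sum_mult_square)
      finally show ?thesis by (simp add: sum_nonneg)
    qed
    ultimately show "0 \<le> (\<Sum>k<K. \<Sum>l<K. u k * u l * g (pair_type {1..m} (\<gamma> k) (\<gamma> l)))"
      by (intro LIMSEQ_le_const) auto
  qed
  moreover have "?F m x = (\<Sum>\<alpha>\<in>?M m. \<Sum>\<beta>\<in>?M m. g (pair_type {1..m} \<alpha> \<beta>) * (?e m \<alpha> x * ?e m \<beta> x))" for m x
  proof -
    \<comment> \<open>\<open>restrict\<close> needs a point that vanishes outside
      \<open>{1..m}\<close>; cutting \<open>x\<close> off there changes neither side of the
      identity.\<close>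
    define x' where "x' i = (if i \<in> {1..m} then x i else 0)" for i
    have Fx: "?F m x = ?F m x'" by (simp add: form_value_def power_sum_value_def x'_def cong: sum.cong_simp)
    have ex: "?e m \<alpha> x' = ?e m \<alpha> x" for \<alpha> by (simp add: monom_eval_def x'_def cong: prod.cong_simp)
    have "(\<lambda>n. \<Sum>\<alpha>\<in>?M m. \<Sum>\<beta>\<in>?M m. \<Gamma> (r n) \<alpha> \<beta> * (?e m \<alpha> x * ?e m \<beta> x)) \<longlonglongrightarrow>
       (\<Sum>\<alpha>\<in>?M m. \<Sum>\<beta>\<in>?M m. g (pair_type {1..m} \<alpha> \<beta>) * (?e m \<alpha> x * ?e m \<beta> x))"
      by (intro tendsto_sum tendsto_mult tendsto_const lim)
    moreover have "(\<Sum>\<alpha>\<in>?M m. \<Sum>\<beta>\<in>?M m. \<Gamma> (r n) \<alpha> \<beta> * (?e m \<alpha> x * ?e m \<beta> x)) = ?F m x" if "n \<ge> m" for n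
    proof -
      have le: "m \<le> r n" using r(2)[of n] that by linarith
      have "?F m x = (\<Sum>j\<in>J (r n). (\<Sum>\<alpha>\<in>?M m. b (r n) j \<alpha> * ?e m \<alpha> x)\<^sup>2)"
      proof -
        have "x' i = 0" if "i \<notin> {1..m}" for i using that by (simp only: x'_def if_False)
        then have "?F m x' = (\<Sum>j\<in>J (r n). (\<Sum>\<alpha>\<in>?M m. b (r n) j \<alpha> * ?e m \<alpha> x')\<^sup>2)"
          by (rule restrict[OF r(1) le])
        then show ?thesis by (simp only: Fx ex)
      qed
      also have "\<dots> = (\<Sum>j\<in>J (r n). \<Sum>\<alpha>\<in>?M m. \<Sum>\<beta>\<in>?M m. (b (r n) j \<alpha> * b (r n) j \<beta>) * (?e m \<alpha> x * ?e m \<beta> x))"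
        unfolding sum_mult_square by (intro sum.cong refl) (simp add: mult_ac)
      also have "\<dots> = (\<Sum>\<alpha>\<in>?M m. \<Sum>j\<in>J (r n). \<Sum>\<beta>\<in>?M m. (b (r n) j \<alpha> * b (r n) j \<beta>) * (?e m \<alpha> x * ?e m \<beta> x))"
        by (rule sum.swap)
      also have "\<dots> = (\<Sum>\<alpha>\<in>?M m. \<Sum>\<beta>\<in>?M m. \<Sum>j\<in>J (r n). (b (r n) j \<alpha> * b (r n) j \<beta>) * (?e m \<alpha> x * ?e m \<beta> x))"
        by (intro sum.cong refl sum.swap)
      finally show ?thesis by (simp add: \<Gamma>_def sum_distrib_right)
    qed
    then have "(\<lambda>n. \<Sum>\<alpha>\<in>?M m. \<Sum>\<beta>\<in>?M m. \<Gamma> (r n) \<alpha> \<beta> * (?e m \<alpha> x * ?e m \<beta> x)) \<longlonglongrightarrow> ?F m x"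
      by (intro tendsto_eventually eventually_sequentiallyI)
    ultimately show ?thesis using LIMSEQ_unique by blast
  qed
  ultimately show ?thesis by blast
qed

section \<open>Moebius decomposition of invariant kernels\<close>

definition moebius :: "'i set \<Rightarrow> ('i set \<Rightarrow> real) \<Rightarrow> real" where
  "moebius S h = (\<Sum>V\<in>Pow S. (- 1) ^ card (S - V) * h V)"

lemma sum_Pow_insert:
  fixes f :: "'i set \<Rightarrow> 'b::comm_monoid_add"
  assumes "finite S" "i \<notin> S"
  shows "(\<Sum>V\<in>Pow (insert i S). f V) = (\<Sum>V\<in>Pow S. f V) + (\<Sum>V\<in>Pow S. f (insert i V))"
proof -
  have inj: "inj_on (insert i) (Pow S)" using assms(2) by (auto simp: inj_on_def insert_ident)
  have "(\<Sum>V\<in>Pow (insert i S). f V) = (\<Sum>V\<in>Pow S. f V) + (\<Sum>V\<in>insert i ` Pow S. f V)"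
    unfolding Pow_insert using assms by (intro sum.union_disjoint) auto
  then show ?thesis by (simp add: sum.reindex[OF inj])
qed

lemma moebius_cong: "(\<And>V. V \<subseteq> S \<Longrightarrow> h V = h' V) \<Longrightarrow> moebius S h = moebius S h'"
  unfolding moebius_def by (intro sum.cong) auto

lemma moebius_diff: "moebius S (\<lambda>V. h V - h' V) = moebius S h - moebius S h'"
  by (simp add: moebius_def right_diff_distrib sum_subtractf)

lemma moebius_empty [simp]: "moebius {} h = h {}"
  by (simp add: moebius_def)

lemma moebius_insert:
  assumes "finite S" "i \<notin> S"
  shows "moebius (insert i S) h = moebius S (\<lambda>V. h (insert i V)) - moebius S h"
proof -
  have 1: "card (insert i S - V) = Suc (card (S - V))" if "V \<in> Pow S" for V
  proof -
    have "insert i S - V = insert i (S - V)" using that assms(2) by auto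
    then show ?thesis using assms by simp
  qed
  have 2: "insert i S - insert i V = S - V" for V using assms(2) by auto
  show ?thesis
    unfolding moebius_def sum_Pow_insert[OF assms] by (simp add: 1 2 sum_negf)
qed

lemma moebius_vanish:
  assumes "finite S" "i \<in> S" "\<And>V. h (insert i V) = h V"
  shows "moebius S h = 0"
proof -
  have "S = insert i (S - {i})" using assms(2) by auto
  then show ?thesis using moebius_insert[of "S - {i}" i h] assms by simp
qed

lemma sum_moebius: "finite A \<Longrightarrow> (\<Sum>S\<in>Pow A. moebius S h) = h A"
proof (induction A arbitrary: h rule: finite_induct)
  case (insert i A)
  have "(\<Sum>S\<in>Pow A. moebius (insert i S) h) = (\<Sum>S\<in>Pow A. moebius S (\<lambda>V. h (insert i V)) - moebius S h)"
    using insert.hyps by (intro sum.cong refl moebius_insert) (auto intro: finite_subset)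
  then show ?case using insert by (simp add: sum_Pow_insert sum_subtractf)
qed simp

text \<open>The value at U \<inter> W is the sum of the Moebius terms of all T contained in both U
  and W, and each of the two alternating sums removes every T except S. The proof peels off one
  element of S at a time. The identity presents the Moebius term as a product of two signed sums,
  one over U and one over W, which is what positivity needs.\<close>

lemma moebius_Int: "finite S \<Longrightarrow> moebius S (\<lambda>U. moebius S (\<lambda>W. h (U \<inter> W))) = moebius S h"
proof (induction S arbitrary: h rule: finite_induct)
  case (insert i S)
  let ?M = "\<lambda>U. moebius (insert i S) (\<lambda>W. h (U \<inter> W))"
  have M0: "?M U = 0" if "U \<subseteq> S" for U
  proof -
    have "U \<inter> insert i W = U \<inter> W" for W using that insert.hyps by auto
    then show ?thesis using insert.hyps by (intro moebius_vanish[of _ i]) auto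
  qed
  have M1: "?M (insert i U) = moebius S (\<lambda>W. h (insert i (U \<inter> W))) - moebius S (\<lambda>W. h (U \<inter> W))" if "U \<subseteq> S" for U
  proof -
    have "moebius S (\<lambda>W. h (insert i U \<inter> W)) = moebius S (\<lambda>W. h (U \<inter> W))"
    proof (rule moebius_cong)
      fix V assume "V \<subseteq> S"
      then have "insert i U \<inter> V = U \<inter> V" using insert.hyps by auto
      then show "h (insert i U \<inter> V) = h (U \<inter> V)" by simp
    qed
    moreover have "insert i U \<inter> insert i W = insert i (U \<inter> W)" for W by auto
    ultimately show ?thesis using moebius_insert[OF insert.hyps] by simp
  qed
  have "moebius (insert i S) ?M = moebius S (\<lambda>U. ?M (insert i U)) - moebius S ?M"
    by (rule moebius_insert[OF insert.hyps])
  also have "moebius S ?M = moebius S (\<lambda>U. 0)" by (rule moebius_cong) (rule M0)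
  also have "moebius S (\<lambda>U. 0) = 0" by (simp add: moebius_def)
  also have "moebius S (\<lambda>U. ?M (insert i U)) =
     moebius S (\<lambda>U. moebius S (\<lambda>W. h (insert i (U \<inter> W))) - moebius S (\<lambda>W. h (U \<inter> W)))"
    by (rule moebius_cong) (rule M1)
  also have "\<dots> = moebius S (\<lambda>V. h (insert i V)) - moebius S h"
    unfolding moebius_diff insert.IH insert.IH[of "\<lambda>V. h (insert i V)"] ..
  finally show ?case using moebius_insert[OF insert.hyps] by simp
qed simp

text \<open>The type of two monomials after their common variables have been restricted to \<open>V\<close>, all
  other variables of the two monomials being moved apart.\<close>

definition overlap_type :: "'i set \<Rightarrow> 'i set \<Rightarrow> ('i \<Rightarrow> nat) \<Rightarrow> ('i \<Rightarrow> nat) \<Rightarrow> (nat \<times> nat) multiset" where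
  "overlap_type N V \<alpha> \<beta> = (\<Sum>i\<in>N. if i \<in> V then pair_mset (\<alpha> i) (\<beta> i) else pair_mset (\<alpha> i) 0 + pair_mset 0 (\<beta> i))"

lemma overlap_type_full: "overlap_type N N \<alpha> \<beta> = pair_type N \<alpha> \<beta>"
  unfolding overlap_type_def pair_type_def by (intro sum.cong) auto

lemma overlap_type_insert_trivial:
  assumes "\<alpha> i = 0 \<or> \<beta> i = 0"
  shows "overlap_type N (insert i V) \<alpha> \<beta> = overlap_type N V \<alpha> \<beta>"
  unfolding overlap_type_def using assms by (intro sum.cong) auto

text \<open>The Moebius sum computed from the list of exponent pairs alone: each distinguished
  variable is either shared by the two monomials or split into two. So it sees the exponents but not
  the variables that carry them.\<close>

fun moebius_list :: "((nat \<times> nat) multiset \<Rightarrow> real) \<Rightarrow> (nat \<times> nat) list \<Rightarrow> (nat \<times> nat) multiset \<Rightarrow> real" where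
  "moebius_list g [] \<tau> = g \<tau>"
| "moebius_list g ((a, b) # zs) \<tau> =
    moebius_list g zs (\<tau> + pair_mset a b) - moebius_list g zs (\<tau> + (pair_mset a 0 + pair_mset 0 b))"

lemma moebius_list_eq:
  "distinct L \<Longrightarrow> moebius_list g (map (\<lambda>i. (\<alpha> i, \<beta> i)) L) \<tau> = moebius (set L) (\<lambda>V. g (\<tau> + overlap_type (set L) V \<alpha> \<beta>))"
proof (induction L arbitrary: \<tau>)
  case Nil
  then show ?case by (simp add: overlap_type_def)
next
  case (Cons i L)
  then have i: "i \<notin> set L" and L: "distinct L" by auto
  have a: "overlap_type (insert i (set L)) (insert i V) \<alpha> \<beta> = pair_mset (\<alpha> i) (\<beta> i) + overlap_type (set L) V \<alpha> \<beta>" for V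
  proof -
    have "overlap_type (set L) (insert i V) \<alpha> \<beta> = overlap_type (set L) V \<alpha> \<beta>"
      unfolding overlap_type_def using i by (intro sum.cong) auto
    then show ?thesis using i by (simp add: overlap_type_def)
  qed
  have b: "overlap_type (insert i (set L)) V \<alpha> \<beta> = pair_mset (\<alpha> i) 0 + pair_mset 0 (\<beta> i) + overlap_type (set L) V \<alpha> \<beta>"
    if "V \<subseteq> set L" for V
    using i that by (auto simp: overlap_type_def)
  have "moebius (insert i (set L)) (\<lambda>V. g (\<tau> + overlap_type (insert i (set L)) V \<alpha> \<beta>)) =
     moebius (set L) (\<lambda>V. g (\<tau> + overlap_type (insert i (set L)) (insert i V) \<alpha> \<beta>)) -
     moebius (set L) (\<lambda>V. g (\<tau> + overlap_type (insert i (set L)) V \<alpha> \<beta>))"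
    by (rule moebius_insert[OF finite_set i])
  also have "moebius (set L) (\<lambda>V. g (\<tau> + overlap_type (insert i (set L)) V \<alpha> \<beta>)) =
    moebius (set L) (\<lambda>V. g (\<tau> + (pair_mset (\<alpha> i) 0 + pair_mset 0 (\<beta> i)) + overlap_type (set L) V \<alpha> \<beta>))"
    by (rule moebius_cong) (simp add: b add.assoc)
  finally show ?case by (simp add: a Cons.IH[OF L] add.assoc)
qed

text \<open>A monomial seen from a list of distinguished variables: their exponents in order, and the
  multiset of the other nonzero exponents.\<close>

definition rel_class :: "'i list \<Rightarrow> 'i set \<Rightarrow> ('i \<Rightarrow> nat) \<Rightarrow> nat list \<times> nat multiset" where
  "rel_class L N \<alpha> = (map \<alpha> L, \<Sum>i\<in>N - set L. if \<alpha> i = 0 then {#} else {#\<alpha> i#})"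

text \<open>Exponents of variables outside the list are never paired with each other, whence the
  pairs with a 0.\<close>

definition class_kernel :: "((nat \<times> nat) multiset \<Rightarrow> real) \<Rightarrow> nat list \<times> nat multiset \<Rightarrow> nat list \<times> nat multiset \<Rightarrow> real" where
  "class_kernel g \<kappa> \<kappa>' = moebius_list g (zip (fst \<kappa>) (fst \<kappa>'))
     (image_mset (\<lambda>a. (a, 0)) (snd \<kappa>) + image_mset (\<lambda>b. (0, b)) (snd \<kappa>'))"

lemma image_mset_of_sum: "image_mset f (\<Sum>i\<in>I. A i) = (\<Sum>i\<in>I. image_mset f (A i))"
  by (induction I rule: infinite_finite_induct) auto

lemma class_kernel_eq:
  assumes N: "finite N" and L: "distinct L" "set L \<subseteq> N"
  shows "class_kernel g (rel_class L N \<alpha>) (rel_class L N \<beta>) = moebius (set L) (\<lambda>V. g (overlap_type N V \<alpha> \<beta>))"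
proof -
  let ?R = "\<Sum>i\<in>N - set L. pair_mset (\<alpha> i) 0 + pair_mset 0 (\<beta> i)"
  have R: "image_mset (\<lambda>a. (a, 0)) (\<Sum>i\<in>N - set L. if \<alpha> i = 0 then {#} else {#\<alpha> i#}) +
      image_mset (\<lambda>b. (0, b)) (\<Sum>i\<in>N - set L. if \<beta> i = 0 then {#} else {#\<beta> i#}) = ?R"
    unfolding image_mset_of_sum sum.distrib[symmetric] by (intro sum.cong refl) (simp add: pair_mset_def)
  have "zip (map \<alpha> L) (map \<beta> L) = map (\<lambda>i. (\<alpha> i, \<beta> i)) L" by (induction L) auto
  then have "class_kernel g (rel_class L N \<alpha>) (rel_class L N \<beta>) = moebius (set L) (\<lambda>V. g (?R + overlap_type (set L) V \<alpha> \<beta>))"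
    using moebius_list_eq[OF L(1), of g \<alpha> \<beta> ?R] by (simp only: class_kernel_def rel_class_def fst_conv snd_conv R)
  also have "\<dots> = moebius (set L) (\<lambda>V. g (overlap_type N V \<alpha> \<beta>))"
  proof (rule moebius_cong)
    fix V assume V: "V \<subseteq> set L"
    have "overlap_type N V \<alpha> \<beta> = (\<Sum>i\<in>N - set L. if i \<in> V then pair_mset (\<alpha> i) (\<beta> i) else pair_mset (\<alpha> i) 0 + pair_mset 0 (\<beta> i))
        + overlap_type (set L) V \<alpha> \<beta>"
      unfolding overlap_type_def by (rule sum.subset_diff[OF L(2) N])
    also have "(\<Sum>i\<in>N - set L. if i \<in> V then pair_mset (\<alpha> i) (\<beta> i) else pair_mset (\<alpha> i) 0 + pair_mset 0 (\<beta> i)) = ?R"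
      using V by (intro sum.cong) auto
    finally show "g (?R + overlap_type (set L) V \<alpha> \<beta>) = g (overlap_type N V \<alpha> \<beta>)" by simp
  qed
  finally show ?thesis .
qed

text \<open>Bijections carry the definition, stated for \<open>{1..m}\<close>, over to arbitrary
  finite index sets; the copies of monomials used below live on a product set.\<close>

lemma gram_kernel_psd:
  assumes g: "gram_kernel d g" and N: "finite (N :: 'i set)" and K: "finite (K :: 'k set)"
    and \<gamma>: "\<And>k. k \<in> K \<Longrightarrow> \<gamma> k \<in> mons N d"
  shows "0 \<le> (\<Sum>k\<in>K. \<Sum>l\<in>K. u k * u l * g (pair_type N (\<gamma> k) (\<gamma> l)))"
proof -
  obtain h where h: "bij_betw h {1..card N} N" using ex_bij_betw_nat_finite_1[OF N] by blast
  obtain e where e: "bij_betw e {..<card K} K" using ex_bij_betw_nat_finite[OF K] by (auto simp: atLeast0LessThan)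
  define tr where "tr = (\<lambda>(\<alpha> :: 'i \<Rightarrow> nat) i. if i \<in> {1..card N} then \<alpha> (h i) else 0)"
  have eK: "e k \<in> K" if "k < card K" for k using bij_betwE[OF e] that by auto
  have tr: "tr (\<gamma> (e k)) \<in> mons {1..card N} d" if "k < card K" for k
    unfolding tr_def by (rule pair_type_transfer(2)[OF h \<gamma>[OF eK[OF that]]])
  have "0 \<le> (\<Sum>k<card K. \<Sum>l<card K. u (e k) * u (e l) * g (pair_type {1..card N} (tr (\<gamma> (e k))) (tr (\<gamma> (e l)))))"
    by (rule g[unfolded gram_kernel_def, THEN conjunct2, THEN spec[of _ "card N"], THEN spec[of _ "card K"],
        THEN spec[of _ "\<lambda>k. tr (\<gamma> (e k))"], THEN spec[of _ "\<lambda>k. u (e k)"], THEN mp]) (use tr in simp)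
  also have "\<dots> = (\<Sum>k<card K. \<Sum>l<card K. u (e k) * u (e l) * g (pair_type N (\<gamma> (e k)) (\<gamma> (e l))))"
    unfolding tr_def pair_type_transfer(1)[OF h] ..
  also have "\<dots> = (\<Sum>k<card K. \<Sum>l\<in>K. u (e k) * u l * g (pair_type N (\<gamma> (e k)) (\<gamma> l)))"
    by (intro sum.cong refl sum.reindex_bij_betw[OF e])
  also have "\<dots> = (\<Sum>k\<in>K. \<Sum>l\<in>K. u k * u l * g (pair_type N (\<gamma> k) (\<gamma> l)))"
    by (rule sum.reindex_bij_betw[OF e])
  finally show ?thesis .
qed

lemma gram_kernel_sym:
  assumes g: "gram_kernel d g" and N: "finite (N :: 'i set)" and ab: "\<alpha> \<in> mons N d" "\<beta> \<in> mons N d"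
  shows "g (pair_type N \<alpha> \<beta>) = g (pair_type N \<beta> \<alpha>)"
proof -
  obtain h where h: "bij_betw h {1..card N} N" using ex_bij_betw_nat_finite_1[OF N] by blast
  define tr where "tr = (\<lambda>(\<alpha> :: 'i \<Rightarrow> nat) i. if i \<in> {1..card N} then \<alpha> (h i) else 0)"
  have tr: "tr \<gamma> \<in> mons {1..card N} d" if "\<gamma> \<in> mons N d" for \<gamma>
    unfolding tr_def by (rule pair_type_transfer(2)[OF h that])
  have pt: "pair_type {1..card N} (tr \<alpha>) (tr \<beta>) = pair_type N \<alpha> \<beta>" for \<alpha> \<beta>
    unfolding tr_def by (rule pair_type_transfer(1)[OF h])
  have "g (pair_type {1..card N} (tr \<alpha>) (tr \<beta>)) = g (pair_type {1..card N} (tr \<beta>) (tr \<alpha>))"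
    using g tr[OF ab(1)] tr[OF ab(2)] unfolding gram_kernel_def by blast
  then show ?thesis by (simp only: pt)
qed

lemma sum_Times: "(\<Sum>z\<in>A \<times> B. f z) = (\<Sum>x\<in>A. \<Sum>y\<in>B. f (x, y))"
  by (simp add: sum.cartesian_product case_prod_unfold)

section \<open>Copies of monomials in fresh variables\<close>

text \<open>Every variable i is replaced by a column of variables (i, 0), (i, 1), and so on. The
  r-th copy of \<alpha> keeps the variables in U at the common level 0 and moves the others to level
  r.\<close>

definition shift :: "'i set \<Rightarrow> nat \<Rightarrow> ('i \<Rightarrow> nat) \<Rightarrow> 'i \<times> nat \<Rightarrow> nat" where
  "shift U r \<alpha> = (\<lambda>(i, k). if k = (if i \<in> U then 0 else r) then \<alpha> i else 0)"

lemma shift_mons: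
  assumes "r \<le> R" "\<alpha> \<in> mons N d"
  shows "shift U r \<alpha> \<in> mons (N \<times> {..R}) d"
proof -
  have "(\<Sum>z\<in>N \<times> {..R}. shift U r \<alpha> z) = (\<Sum>i\<in>N. \<Sum>k\<le>R. if k = (if i \<in> U then 0 else r) then \<alpha> i else 0)"
    by (simp only: sum_Times shift_def case_prod_conv)
  also have "\<dots> = (\<Sum>i\<in>N. \<alpha> i)" using assms(1) by (intro sum.cong) auto
  finally show ?thesis using assms by (auto simp: mons_def shift_def)
qed

lemma sum_pair_mset_delta:
  assumes "finite K" "p \<in> K" "q \<in> K"
  shows "(\<Sum>k\<in>K. pair_mset (if k = p then a else 0) (if k = q then b else 0)) =
    (if p = q then pair_mset a b else pair_mset a 0 + pair_mset 0 b)"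
proof -
  have "(\<Sum>k\<in>K. pair_mset (if k = p then a else 0) (if k = q then b else 0)) =
     (\<Sum>k\<in>{p, q}. pair_mset (if k = p then a else 0) (if k = q then b else 0))"
    using assms by (intro sum.mono_neutral_right) auto
  then show ?thesis by auto
qed

text \<open>Two exponents meet exactly if they sit at the same level. As level 0 is reserved for
  kept variables (r and r' are at least 1), different copies share only the variables kept by
  both.\<close>

lemma pair_type_shift:
  assumes "r \<ge> 1" "r' \<ge> 1" "r \<le> R" "r' \<le> R"
  shows "pair_type (N \<times> {..R}) (shift U r \<alpha>) (shift U' r' \<beta>) =
    overlap_type N (if r = r' then {i. i \<in> U \<longleftrightarrow> i \<in> U'} else U \<inter> U') \<alpha> \<beta>"
proof -
  have "pair_type (N \<times> {..R}) (shift U r \<alpha>) (shift U' r' \<beta>) =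
    (\<Sum>i\<in>N. \<Sum>k\<le>R. pair_mset (if k = (if i \<in> U then 0 else r) then \<alpha> i else 0) (if k = (if i \<in> U' then 0 else r') then \<beta> i else 0))"
    unfolding pair_type_def by (simp only: sum_Times shift_def case_prod_conv)
  also have "\<dots> = overlap_type N (if r = r' then {i. i \<in> U \<longleftrightarrow> i \<in> U'} else U \<inter> U') \<alpha> \<beta>"
    unfolding overlap_type_def using assms by (intro sum.cong refl) (subst sum_pair_mset_delta, auto)
  finally show ?thesis .
qed

text \<open>The squared norm of a sum of R vectors has R diagonal terms B and R(R - 1) mixed terms
  Q; for large R the mixed terms dominate.\<close>

lemma nonneg_if_averages_nonneg:
  fixes B Q :: real
  assumes "\<And>R :: nat. R \<ge> 1 \<Longrightarrow> 0 \<le> R * B + R * (real R - 1) * Q"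
  shows "0 \<le> Q"
proof (rule ccontr)
  assume "\<not> 0 \<le> Q"
  then obtain n :: nat where n: "B < real n * (- Q)" using reals_Archimedean3[of "- Q"] by auto
  have "0 \<le> real (n + 1) * (B + real n * Q)" using assms[of "n + 1"] by (simp add: algebra_simps)
  then have "0 \<le> B + real n * Q" by (simp add: zero_le_mult_iff)
  then show False using n by simp
qed

text \<open>If the vectors \<open>Z r\<close> (\<open>r = 1, 2, \<dots>\<close>) have all mutual inner products equal to \<open>Q\<close> and the same
  norm, then \<open>Q \<ge> 0\<close>; here \<open>Z r\<close> is the signed sum of the vectors of shifted monomials.\<close>

lemma moebius_kernel_psd:
  assumes g: "gram_kernel d g" and N: "finite (N :: 'i set)" and K: "finite (K :: 'k set)" and S: "finite S"
    and \<gamma>: "\<And>k. k \<in> K \<Longrightarrow> \<gamma> k \<in> mons N d"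
  shows "0 \<le> (\<Sum>k\<in>K. \<Sum>l\<in>K. u k * u l * moebius S (\<lambda>V. g (overlap_type N V (\<gamma> k) (\<gamma> l))))" (is "0 \<le> ?Q")
proof -
  let ?s = "\<lambda>U. (- 1) ^ card (S - U) :: real"
  define w where "w z = u (fst z) * ?s (snd z)" for z :: "'k \<times> 'i set"
  define I where "I = K \<times> Pow S"
  \<comment> \<open>\<open>E V\<close> is the inner product of two signed sums of shifted monomials.
    Different copies give \<open>V\<close> = \<open>(\<inter>)\<close>, which is \<open>?Q\<close>
    by \<open>moebius_Int\<close>; equal copies give the set \<open>?A\<close> on which U and U'
    agree.\<close>
  define E where "E V = (\<Sum>z\<in>I. \<Sum>z'\<in>I. w z * w z' * g (overlap_type N (V (snd z) (snd z')) (\<gamma> (fst z)) (\<gamma> (fst z'))))" for V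
  let ?A = "\<lambda>U U'. {i. i \<in> U \<longleftrightarrow> i \<in> U'} :: 'i set"
  have "E (\<inter>) = (\<Sum>k\<in>K. \<Sum>U\<in>Pow S. \<Sum>l\<in>K. \<Sum>W\<in>Pow S. u k * ?s U * (u l * ?s W) * g (overlap_type N (U \<inter> W) (\<gamma> k) (\<gamma> l)))"
    by (simp only: E_def I_def w_def sum_Times fst_conv snd_conv)
  also have "\<dots> = (\<Sum>k\<in>K. \<Sum>l\<in>K. \<Sum>U\<in>Pow S. \<Sum>W\<in>Pow S. u k * ?s U * (u l * ?s W) * g (overlap_type N (U \<inter> W) (\<gamma> k) (\<gamma> l)))"
    by (intro sum.cong refl sum.swap)
  also have "\<dots> = (\<Sum>k\<in>K. \<Sum>l\<in>K. u k * u l * moebius S (\<lambda>U. moebius S (\<lambda>W. g (overlap_type N (U \<inter> W) (\<gamma> k) (\<gamma> l)))))"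
    by (simp add: moebius_def sum_distrib_left mult_ac)
  also have "\<dots> = ?Q" by (simp only: moebius_Int[OF S, where h = "\<lambda>V. g (overlap_type N V (\<gamma> k) (\<gamma> l))" for k l])
  finally have EQ: "E (\<inter>) = ?Q" .
  have "0 \<le> R * E ?A + R * (real R - 1) * ?Q" for R :: nat
  proof -
    let ?Z = "{1..R} \<times> I"
    have fin: "finite ?Z" using K S by (simp add: I_def)
    have "0 \<le> (\<Sum>y\<in>?Z. \<Sum>y'\<in>?Z. w (snd y) * w (snd y') *
       g (pair_type (N \<times> {..R}) (shift (snd (snd y)) (fst y) (\<gamma> (fst (snd y)))) (shift (snd (snd y')) (fst y') (\<gamma> (fst (snd y'))))))"
    proof (rule gram_kernel_psd[OF g _ fin])
      show "shift (snd (snd y)) (fst y) (\<gamma> (fst (snd y))) \<in> mons (N \<times> {..R}) d" if "y \<in> ?Z" for y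
        using that by (intro shift_mons \<gamma>) (auto simp: I_def)
    qed (use N in simp)
    also have "\<dots> = (\<Sum>y\<in>?Z. \<Sum>y'\<in>?Z. w (snd y) * w (snd y') *
       g (overlap_type N (if fst y = fst y' then ?A (snd (snd y)) (snd (snd y')) else snd (snd y) \<inter> snd (snd y'))
         (\<gamma> (fst (snd y))) (\<gamma> (fst (snd y')))))"
      by (intro sum.cong refl, subst pair_type_shift) auto
    also have "\<dots> = (\<Sum>r\<in>{1..R}. \<Sum>z\<in>I. \<Sum>r'\<in>{1..R}. \<Sum>z'\<in>I. w z * w z' *
       g (overlap_type N (if r = r' then ?A (snd z) (snd z') else snd z \<inter> snd z') (\<gamma> (fst z)) (\<gamma> (fst z'))))"
      by (simp only: sum_Times[of _ "{1..R}"] fst_conv snd_conv)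
    also have "\<dots> = (\<Sum>r\<in>{1..R}. \<Sum>r'\<in>{1..R}. \<Sum>z\<in>I. \<Sum>z'\<in>I. w z * w z' *
       g (overlap_type N (if r = r' then ?A (snd z) (snd z') else snd z \<inter> snd z') (\<gamma> (fst z)) (\<gamma> (fst z'))))"
      by (intro sum.cong refl sum.swap)
    also have "\<dots> = (\<Sum>r\<in>{1..R}. \<Sum>r'\<in>{1..R}. (if r = r' then E ?A - ?Q else 0) + ?Q)"
      by (intro sum.cong refl) (auto simp: E_def EQ[symmetric])
    also have "\<dots> = R * E ?A + R * (real R - 1) * ?Q"
      by (simp add: sum.distrib algebra_simps)
    finally show ?thesis .
  qed
  then show ?thesis by (rule nonneg_if_averages_nonneg)
qed

text \<open>Two different copies that both keep exactly the variables in V overlap exactly in V. So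
  every overlap type is the type of an honest pair of monomials, to which symmetry applies.\<close>

lemma moebius_kernel_sym:
  assumes g: "gram_kernel d g" and N: "finite (N :: 'i set)" and ab: "\<alpha> \<in> mons N d" "\<beta> \<in> mons N d"
  shows "g (overlap_type N V \<alpha> \<beta>) = g (overlap_type N V \<beta> \<alpha>)"
proof -
  have pt: "pair_type (N \<times> {..2}) (shift V 1 \<alpha>) (shift V 2 \<beta>) = overlap_type N V \<alpha> \<beta>"
       "pair_type (N \<times> {..2}) (shift V 2 \<beta>) (shift V 1 \<alpha>) = overlap_type N V \<beta> \<alpha>"
    by (simp_all add: pair_type_shift)
  have "g (pair_type (N \<times> {..2}) (shift V 1 \<alpha>) (shift V 2 \<beta>)) = g (pair_type (N \<times> {..2}) (shift V 2 \<beta>) (shift V 1 \<alpha>))"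
    by (rule gram_kernel_sym[OF g]) (use N shift_mons[of 1 2 \<alpha> N d V] shift_mons[of 2 2 \<beta> N d V] ab in auto)
  then show ?thesis by (simp only: pt)
qed

section \<open>Factorization of the kernels and the resulting squares\<close>

definition rel_classes :: "nat \<Rightarrow> nat \<Rightarrow> (nat list \<times> nat multiset) set" where
  "rel_classes d s = {(l, \<mu>). length l = s \<and> 0 \<notin># \<mu> \<and> sum_list l + sum_mset \<mu> = d}"

lemma finite_rel_classes: "finite (rel_classes d s)"
proof -
  have "rel_classes d s \<subseteq> {l. set l \<subseteq> {..d} \<and> length l = s} \<times> (\<Union>e\<le>d. partitions e)"
    unfolding rel_classes_def partitions_def by (auto dest!: member_le_sum_list)
  then show ?thesis
    by (rule finite_subset) (intro finite_cartesian_product finite_lists_length_eq finite_UN_I finite_partitions; simp)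
qed

lemma rel_class_in_rel_classes:
  assumes "finite N" "distinct L" "set L \<subseteq> N" "\<alpha> \<in> mons N d"
  shows "rel_class L N \<alpha> \<in> rel_classes d (length L)"
proof -
  have "sum_mset (\<Sum>i\<in>I. if \<alpha> i = 0 then {#} else {#\<alpha> i#}) = (\<Sum>i\<in>I. \<alpha> i)"
     "0 \<notin># (\<Sum>i\<in>I. if \<alpha> i = 0 then {#} else {#\<alpha> i#})" for I
    by (induction I rule: infinite_finite_induct) auto
  moreover have "sum_list (map \<alpha> L) + (\<Sum>i\<in>N - set L. \<alpha> i) = d"
    using assms sum.subset_diff[OF assms(3,1), of \<alpha>] by (simp add: sum_list_distinct_conv_sum_set mons_def)
  ultimately show ?thesis by (simp add: rel_class_def rel_classes_def)
qed

lemma mset_eq_sum_nth: "mset xs = (\<Sum>i<length xs. {#xs ! i#})"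
  by (induction xs rule: rev_induct) (simp_all add: nth_append)

text \<open>The remaining exponents are nonzero with sum at most d, so d variables beyond the s
  distinguished ones suffice. Monomials realizing the classes transport symmetry and positivity to
  \<open>class_kernel\<close>.\<close>

lemma rel_class_realized:
  assumes "\<kappa> \<in> rel_classes d s"
  shows "\<exists>\<alpha>\<in>mons {..<s + d} d. rel_class [0..<s] {..<s + d} \<alpha> = \<kappa>"
proof -
  obtain l \<mu> where \<kappa>: "\<kappa> = (l, \<mu>)" "length l = s" "0 \<notin># \<mu>" "sum_list l + sum_mset \<mu> = d"
    using assms by (auto simp: rel_classes_def)
  obtain xs where xs: "\<mu> = mset xs" by (metis ex_mset)
  have "length ys \<le> sum_list ys" if "0 \<notin> set ys" for ys :: "nat list" using that by (induction ys) auto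
  then have len: "length xs \<le> d" using \<kappa> xs by (fastforce simp: sum_mset_sum_list)
  have pos: "xs ! j \<noteq> 0" if "j < length xs" for j using \<kappa>(3) xs that by (metis nth_mem set_mset_mset)
  define \<alpha> where "\<alpha> i = (if i < s + length xs then (l @ xs) ! i else 0)" for i
  have "(\<Sum>i<s + d. \<alpha> i) = (\<Sum>i<s + length xs. \<alpha> i)"
    using len by (intro sum.mono_neutral_right) (auto simp: \<alpha>_def)
  also have "\<dots> = sum_list (l @ xs)" using \<kappa>(2) by (simp add: \<alpha>_def sum_list_sum_nth atLeast0LessThan)
  finally have "\<alpha> \<in> mons {..<s + d} d" using \<kappa>(4) len xs by (auto simp: mons_def sum_mset_sum_list \<alpha>_def)
  moreover have "map \<alpha> [0..<s] = l" using \<kappa>(2) by (intro nth_equalityI) (auto simp: \<alpha>_def nth_append)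
  moreover have "(\<Sum>i\<in>{..<s + d} - set [0..<s]. if \<alpha> i = 0 then {#} else {#\<alpha> i#}) = \<mu>"
  proof -
    have "(\<Sum>i\<in>{..<s + d} - set [0..<s]. if \<alpha> i = 0 then {#} else {#\<alpha> i#}) = (\<Sum>i\<in>{s..<s + length xs}. {#xs ! (i - s)#})"
      using len pos \<kappa>(2) by (intro sum.mono_neutral_cong_right) (auto simp: \<alpha>_def nth_append)
    also have "\<dots> = (\<Sum>j<length xs. {#xs ! j#})"
      by (rule sum.reindex_bij_witness[of _ "\<lambda>j. j + s" "\<lambda>i. i - s"]) auto
    finally show ?thesis unfolding xs mset_eq_sum_nth[of xs] .
  qed
  ultimately show ?thesis using \<kappa>(1) by (intro bexI[of _ \<alpha>]) (simp_all add: rel_class_def)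
qed

text \<open>Cholesky's method: the pivot row gives one vector, and the Schur complement
  \<open>k'\<close> is again positive semidefinite. A serves as its own index set for the
  vectors.\<close>

lemma psd_factorization:
  fixes k :: "'a \<Rightarrow> 'a \<Rightarrow> real"
  assumes "finite A" "\<And>a b. a \<in> A \<Longrightarrow> b \<in> A \<Longrightarrow> k a b = k b a"
    and "\<And>u. 0 \<le> (\<Sum>a\<in>A. \<Sum>b\<in>A. u a * u b * k a b)"
  shows "\<exists>v. \<forall>a\<in>A. \<forall>b\<in>A. k a b = (\<Sum>j\<in>A. v j a * v j b)"
  using assms
proof (induction A arbitrary: k rule: finite_induct)
  case (insert a A)
  note fin = insert.hyps(1) and a = insert.hyps(2)
  have sym: "k b c = k c b" if "b \<in> insert a A" "c \<in> insert a A" for b c by (rule insert.prems(1)[OF that])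
  have expand: "(\<Sum>b\<in>insert a A. \<Sum>c\<in>insert a A. u b * u c * k b c) =
     (u a)\<^sup>2 * k a a + 2 * u a * (\<Sum>b\<in>A. u b * k a b) + (\<Sum>b\<in>A. \<Sum>c\<in>A. u b * u c * k b c)" for u
  proof -
    have "(\<Sum>b\<in>A. u b * u a * k b a) = u a * (\<Sum>b\<in>A. u b * k a b)"
      unfolding sum_distrib_left using sym by (intro sum.cong) auto
    then show ?thesis
      using fin a by (simp add: sum.distrib sum_distrib_left[symmetric] power2_eq_square algebra_simps)
  qed
  define p where "p = k a a"
  have p: "p \<ge> 0" using insert.prems(2)[of "\<lambda>b. if b = a then 1 else 0"] unfolding expand p_def
    using a by (simp add: sum.neutral if_distrib cong: if_cong)
  have p0: "k a b = 0" if "p = 0" "b \<in> A" for b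
  proof (rule ccontr)
    assume nz: "k a b \<noteq> 0"
    \<comment> \<open>Chosen so that \<open>2 * t * k a b + k b b\<close> equals -1, against
      positivity.\<close>
    define t where "t = - (k b b + 1) / (2 * k a b)"
    let ?u = "\<lambda>c. if c = a then t else if c = b then 1 else 0"
    have ab: "a \<noteq> b" using a that by auto
    have 1: "(\<Sum>c\<in>A. ?u c * k a c) = k a b"
    proof -
      have "(\<Sum>c\<in>A. ?u c * k a c) = (\<Sum>c\<in>A. if c = b then k a b else 0)" using a by (intro sum.cong) auto
      then show ?thesis using that fin by simp
    qed
    have 2: "(\<Sum>c\<in>A. \<Sum>e\<in>A. ?u c * ?u e * k c e) = k b b"
    proof -
      have "(\<Sum>c\<in>A. \<Sum>e\<in>A. ?u c * ?u e * k c e) = (\<Sum>c\<in>A. \<Sum>e\<in>A. if e = b then (if c = b then k b b else 0) else 0)"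
        using a by (intro sum.cong) auto
      then show ?thesis using that fin by simp
    qed
    have "0 \<le> 2 * t * k a b + k b b"
      using insert.prems(2)[of ?u] unfolding expand 1 2 using that by (simp add: p_def)
    also have "2 * t * k a b = - (k b b + 1)" using nz by (simp add: t_def)
    finally show False by simp
  qed
  \<comment> \<open>For p = 0 the quotient is 0 by convention; this agrees with \<open>p0\<close>,
    by which the pivot row vanishes in that case.\<close>
  define k' where "k' b c = k b c - k a b * k a c / p" for b c
  have "\<exists>v. \<forall>b\<in>A. \<forall>c\<in>A. k' b c = (\<Sum>j\<in>A. v j b * v j c)"
  proof (rule insert.IH)
    show "k' b c = k' c b" if "b \<in> A" "c \<in> A" for b c using sym that by (simp add: k'_def)
    fix u :: "'a \<Rightarrow> real"
    define s where "s = (\<Sum>b\<in>A. u b * k a b)"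
    define u' where "u' = u(a := - s / p)"
    have u': "u' b = u b" if "b \<in> A" for b using that a by (auto simp: u'_def)
    have sums: "(\<Sum>b\<in>A. u' b * k a b) = s" "(\<Sum>b\<in>A. \<Sum>c\<in>A. u' b * u' c * k b c) = (\<Sum>b\<in>A. \<Sum>c\<in>A. u b * u c * k b c)"
      by (simp_all add: u' s_def cong: sum.cong)
    have "0 \<le> (u' a)\<^sup>2 * p + 2 * u' a * s + (\<Sum>b\<in>A. \<Sum>c\<in>A. u b * u c * k b c)"
      using insert.prems(2)[of u'] unfolding expand sums by (simp add: p_def)
    also have "(u' a)\<^sup>2 * p + 2 * u' a * s = - (s * s / p)"
      by (cases "p = 0") (simp_all add: u'_def power2_eq_square field_simps)
    also have "s * s / p = (\<Sum>b\<in>A. \<Sum>c\<in>A. u b * u c * (k a b * k a c / p))"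
      by (simp add: s_def sum_product sum_divide_distrib mult_ac)
    finally show "0 \<le> (\<Sum>b\<in>A. \<Sum>c\<in>A. u b * u c * k' b c)"
      by (simp add: k'_def right_diff_distrib sum_subtractf)
  qed
  then obtain v where v: "\<And>b c. b \<in> A \<Longrightarrow> c \<in> A \<Longrightarrow> k' b c = (\<Sum>j\<in>A. v j b * v j c)" by blast
  define w where "w j b = (if j = a then k a b / sqrt p else if b = a then 0 else v j b)" for j b
  have main: "k b c = k a b * k a c / p + (\<Sum>j\<in>A. w j b * w j c)" if bc: "b \<in> insert a A" "c \<in> insert a A" for b c
  proof (cases "b = a \<or> c = a")
    case True
    have z: "(\<Sum>j\<in>A. w j b * w j c) = 0" using True a by (intro sum.neutral) (auto simp: w_def)
    have "k b c = k a b * k a c / p"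
    proof (cases "p = 0")
      case True
      then show ?thesis using p0 bc \<open>b = a \<or> c = a\<close> sym[of b c] by (auto simp: p_def)
    next
      case False
      then show ?thesis using sym bc True by (auto simp: p_def)
    qed
    then show ?thesis using z by simp
  next
    case False
    then have A: "b \<in> A" "c \<in> A" using bc by auto
    have "(\<Sum>j\<in>A. w j b * w j c) = (\<Sum>j\<in>A. v j b * v j c)" using False a by (intro sum.cong) (auto simp: w_def)
    then show ?thesis using v[OF A] by (simp add: k'_def)
  qed
  have "k b c = (\<Sum>j\<in>insert a A. w j b * w j c)" if "b \<in> insert a A" "c \<in> insert a A" for b c
  proof -
    have "w a b * w a c = k a b * k a c / p" using p by (simp add: w_def)
    then show ?thesis using main[OF that] fin a by simp
  qed
  then show ?case by (intro exI[of _ w]) blast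
qed simp

lemma class_kernel_factorization:
  assumes g: "gram_kernel d g"
  shows "\<exists>v. \<forall>\<kappa>\<in>rel_classes d s. \<forall>\<kappa>'\<in>rel_classes d s. class_kernel g \<kappa> \<kappa>' = (\<Sum>j\<in>rel_classes d s. v j \<kappa> * v j \<kappa>')"
proof (rule psd_factorization[OF finite_rel_classes])
  let ?N = "{..<s + d}" and ?L = "[0..<s]"
  have "\<forall>\<kappa>. \<exists>\<alpha>. \<kappa> \<in> rel_classes d s \<longrightarrow> \<alpha> \<in> mons ?N d \<and> rel_class ?L ?N \<alpha> = \<kappa>"
    using rel_class_realized by blast
  then obtain a where a: "\<forall>\<kappa>. \<kappa> \<in> rel_classes d s \<longrightarrow> a \<kappa> \<in> mons ?N d \<and> rel_class ?L ?N (a \<kappa>) = \<kappa>"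
    by (elim choice[THEN exE]) (rule that)
  have ck: "class_kernel g \<kappa> \<kappa>' = moebius {..<s} (\<lambda>V. g (overlap_type ?N V (a \<kappa>) (a \<kappa>')))"
    if "\<kappa> \<in> rel_classes d s" "\<kappa>' \<in> rel_classes d s" for \<kappa> \<kappa>'
  proof -
    have "class_kernel g (rel_class ?L ?N (a \<kappa>)) (rel_class ?L ?N (a \<kappa>')) = moebius (set ?L) (\<lambda>V. g (overlap_type ?N V (a \<kappa>) (a \<kappa>')))"
      by (rule class_kernel_eq) auto
    then show ?thesis using a that by (simp add: atLeast0LessThan)
  qed
  have am: "a \<kappa> \<in> mons ?N d" if "\<kappa> \<in> rel_classes d s" for \<kappa> using a that by blast
  show "class_kernel g \<kappa> \<kappa>' = class_kernel g \<kappa>' \<kappa>" if "\<kappa> \<in> rel_classes d s" "\<kappa>' \<in> rel_classes d s" for \<kappa> \<kappa>'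
    unfolding ck[OF that] ck[OF that(2,1)]
    by (intro moebius_cong moebius_kernel_sym[OF g] am that) simp
  show "0 \<le> (\<Sum>\<kappa>\<in>rel_classes d s. \<Sum>\<kappa>'\<in>rel_classes d s. u \<kappa> * u \<kappa>' * class_kernel g \<kappa> \<kappa>')" for u
  proof -
    have "0 \<le> (\<Sum>\<kappa>\<in>rel_classes d s. \<Sum>\<kappa>'\<in>rel_classes d s. u \<kappa> * u \<kappa>' * moebius {..<s} (\<lambda>V. g (overlap_type ?N V (a \<kappa>) (a \<kappa>'))))"
      by (rule moebius_kernel_psd[OF g]) (simp_all add: finite_rel_classes am)
    also have "\<dots> = (\<Sum>\<kappa>\<in>rel_classes d s. \<Sum>\<kappa>'\<in>rel_classes d s. u \<kappa> * u \<kappa>' * class_kernel g \<kappa> \<kappa>')"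
      by (intro sum.cong refl) (simp add: ck)
    finally show ?thesis .
  qed
qed

text \<open>A sum of squares in n variables whose parameters \<open>v\<close> are independent of n:
  one square for each set S of at most d distinguished variables and each j, with coefficients that
  depend only on the size of S, on j and on the class of the monomial. Only finitely many values of
  \<open>v\<close> enter, whatever n is.\<close>

definition square_sum :: "nat \<Rightarrow> (nat \<Rightarrow> nat list \<times> nat multiset \<Rightarrow> nat list \<times> nat multiset \<Rightarrow> real) \<Rightarrow> nat \<Rightarrow> (nat \<Rightarrow> real) \<Rightarrow> real" where
  "square_sum d v n x = (\<Sum>S\<in>{S \<in> Pow {1..n}. card S \<le> d}. \<Sum>j\<in>rel_classes d (card S).
     (\<Sum>\<alpha>\<in>mons {1..n} d. v (card S) j (rel_class (sorted_list_of_set S) {1..n} \<alpha>) * monom_eval {1..n} \<alpha> x)\<^sup>2)"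

text \<open>The Moebius term of S vanishes if some variable of S is absent from \<alpha>, since
  sharing that variable or splitting it makes no difference. This happens whenever S has more than d
  elements, so only finitely many kernels need to be factored.\<close>

lemma gram_kernel_square_sum:
  assumes g: "gram_kernel d g"
  shows "\<exists>v. \<forall>m x. (\<Sum>\<alpha>\<in>mons {1..m} d. \<Sum>\<beta>\<in>mons {1..m} d.
      g (pair_type {1..m} \<alpha> \<beta>) * (monom_eval {1..m} \<alpha> x * monom_eval {1..m} \<beta> x)) = square_sum d v m x"
proof -
  have "\<forall>s. \<exists>v. \<forall>\<kappa>\<in>rel_classes d s. \<forall>\<kappa>'\<in>rel_classes d s. class_kernel g \<kappa> \<kappa>' = (\<Sum>j\<in>rel_classes d s. v j \<kappa> * v j \<kappa>')"
    using class_kernel_factorization[OF g] by blast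
  then obtain v where v: "\<forall>s. \<forall>\<kappa>\<in>rel_classes d s. \<forall>\<kappa>'\<in>rel_classes d s. class_kernel g \<kappa> \<kappa>' = (\<Sum>j\<in>rel_classes d s. v s j \<kappa> * v s j \<kappa>')"
    by (elim choice[THEN exE]) (rule that)
  have "(\<Sum>\<alpha>\<in>mons {1..m} d. \<Sum>\<beta>\<in>mons {1..m} d.
      g (pair_type {1..m} \<alpha> \<beta>) * (monom_eval {1..m} \<alpha> x * monom_eval {1..m} \<beta> x)) = square_sum d v m x" for m x
  proof -
    define N where "N = {1..m}"
    have N: "finite N" by (simp add: N_def)
    let ?P = "{S \<in> Pow N. card S \<le> d}"
    let ?c = "\<lambda>S. rel_class (sorted_list_of_set S) N"
    let ?C = "\<lambda>S. rel_classes d (card S)"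
    let ?e = "\<lambda>\<alpha>. monom_eval N \<alpha> x"
    have finS: "finite S" if "S \<subseteq> N" for S using that N by (rule finite_subset)
    have g_eq: "g (pair_type N \<alpha> \<beta>) = (\<Sum>S\<in>?P. \<Sum>j\<in>?C S. v (card S) j (?c S \<alpha>) * v (card S) j (?c S \<beta>))"
      if ab: "\<alpha> \<in> mons N d" "\<beta> \<in> mons N d" for \<alpha> \<beta>
    proof -
      have "g (pair_type N \<alpha> \<beta>) = (\<Sum>S\<in>Pow N. moebius S (\<lambda>V. g (overlap_type N V \<alpha> \<beta>)))"
        using sum_moebius[OF N, of "\<lambda>V. g (overlap_type N V \<alpha> \<beta>)"] by (simp add: overlap_type_full)
      also have "\<dots> = (\<Sum>S\<in>?P. moebius S (\<lambda>V. g (overlap_type N V \<alpha> \<beta>)))"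
      proof (rule sum.mono_neutral_right)
        show "\<forall>S\<in>Pow N - ?P. moebius S (\<lambda>V. g (overlap_type N V \<alpha> \<beta>)) = 0"
        proof
          fix S assume S: "S \<in> Pow N - ?P"
          have "\<exists>i\<in>S. \<alpha> i = 0"
          proof (rule ccontr)
            assume "\<not> ?thesis"
            then have "card S \<le> (\<Sum>i\<in>S. \<alpha> i)" using sum_mono[of S "\<lambda>_. 1" \<alpha>] by (simp add: Suc_leI)
            also have "\<dots> \<le> (\<Sum>i\<in>N. \<alpha> i)" using S N by (intro sum_mono2) auto
            finally show False using S ab by (auto simp: mons_def)
          qed
          then obtain i where "i \<in> S" "\<alpha> i = 0" by blast
          then show "moebius S (\<lambda>V. g (overlap_type N V \<alpha> \<beta>)) = 0"
            using S finS by (intro moebius_vanish[of S i]) (auto simp: overlap_type_insert_trivial)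
        qed
      qed (use N in auto)
      also have "\<dots> = (\<Sum>S\<in>?P. class_kernel g (?c S \<alpha>) (?c S \<beta>))"
      proof (rule sum.cong[OF refl])
        fix S assume "S \<in> ?P"
        then have S: "S \<subseteq> N" by auto
        then show "moebius S (\<lambda>V. g (overlap_type N V \<alpha> \<beta>)) = class_kernel g (?c S \<alpha>) (?c S \<beta>)"
          using class_kernel_eq[OF N, of "sorted_list_of_set S" g \<alpha> \<beta>] finS[OF S] by simp
      qed
      also have "\<dots> = (\<Sum>S\<in>?P. \<Sum>j\<in>?C S. v (card S) j (?c S \<alpha>) * v (card S) j (?c S \<beta>))"
      proof (rule sum.cong[OF refl])
        fix S assume "S \<in> ?P"
        then have S: "S \<subseteq> N" by auto
        have "?c S \<gamma> \<in> ?C S" if "\<gamma> \<in> mons N d" for \<gamma>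
          using rel_class_in_rel_classes[OF N, of "sorted_list_of_set S" \<gamma> d] finS[OF S] S that by simp
        then show "class_kernel g (?c S \<alpha>) (?c S \<beta>) = (\<Sum>j\<in>?C S. v (card S) j (?c S \<alpha>) * v (card S) j (?c S \<beta>))"
          using v ab by blast
      qed
      finally show ?thesis .
    qed
    let ?t = "\<lambda>\<alpha> \<beta> S j. (v (card S) j (?c S \<alpha>) * ?e \<alpha>) * (v (card S) j (?c S \<beta>) * ?e \<beta>)"
    have "(\<Sum>\<alpha>\<in>mons N d. \<Sum>\<beta>\<in>mons N d. g (pair_type N \<alpha> \<beta>) * (?e \<alpha> * ?e \<beta>)) =
       (\<Sum>\<alpha>\<in>mons N d. \<Sum>\<beta>\<in>mons N d. \<Sum>S\<in>?P. \<Sum>j\<in>?C S. ?t \<alpha> \<beta> S j)"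
      by (intro sum.cong refl) (simp add: g_eq sum_distrib_right sum_distrib_left mult_ac)
    also have "\<dots> = (\<Sum>\<alpha>\<in>mons N d. \<Sum>S\<in>?P. \<Sum>\<beta>\<in>mons N d. \<Sum>j\<in>?C S. ?t \<alpha> \<beta> S j)"
      by (intro sum.cong refl sum.swap)
    also have "\<dots> = (\<Sum>S\<in>?P. \<Sum>\<alpha>\<in>mons N d. \<Sum>\<beta>\<in>mons N d. \<Sum>j\<in>?C S. ?t \<alpha> \<beta> S j)"
      by (rule sum.swap)
    also have "\<dots> = (\<Sum>S\<in>?P. \<Sum>\<alpha>\<in>mons N d. \<Sum>j\<in>?C S. \<Sum>\<beta>\<in>mons N d. ?t \<alpha> \<beta> S j)"
      by (intro sum.cong refl sum.swap)
    also have "\<dots> = (\<Sum>S\<in>?P. \<Sum>j\<in>?C S. \<Sum>\<alpha>\<in>mons N d. \<Sum>\<beta>\<in>mons N d. ?t \<alpha> \<beta> S j)"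
      by (intro sum.cong refl sum.swap)
    also have "\<dots> = square_sum d v m x"
      unfolding square_sum_def sum_mult_square N_def ..
    finally show ?thesis unfolding N_def .
  qed
  then show ?thesis by (intro exI[of _ v] allI)
qed

section \<open>Semialgebraicity of the cones of sums of squares\<close>

lemma sum_of_squaresI:
  assumes "finite I" "\<And>i. i \<in> I \<Longrightarrow> q i \<in> polys_in {1..n}" "f \<in> polys_in {1..n}"
    and eq: "\<And>x. poly_eval x f = (\<Sum>i\<in>I. (poly_eval x (q i))\<^sup>2)"
  shows "sum_of_squares n f"
proof -
  obtain xs where xs: "set xs = I" "distinct xs" using finite_distinct_list[OF assms(1)] by blast
  have "f = (\<Sum>q\<leftarrow>map q xs. q ^ 2)"
  proof (rule poly_eval_injective[of "{1..n}"])
    show "(\<Sum>q\<leftarrow>map q xs. q ^ 2) \<in> polys_in {1..n}"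
      using xs assms(2) by (intro polys_in_sum_list polys_in_power) auto
    show "poly_eval x f = poly_eval x (\<Sum>q\<leftarrow>map q xs. q ^ 2)" for x
      unfolding eq poly_eval_sum_list using xs by (simp add: poly_eval_power sum_list_distinct_conv_sum_set comp_def)
  qed (use assms in auto)
  then show ?thesis unfolding sum_of_squares_def using xs assms(2) by (intro exI[of _ "map q xs"]) auto
qed

lemma square_sum_imp_sum_of_squares:
  assumes f: "f \<in> polys_in {1..n}" and eq: "\<And>x. poly_eval x f = square_sum d v n x"
  shows "sum_of_squares n f"
proof -
  let ?N = "{1..n}"
  define q where "q z = (\<Sum>\<alpha>\<in>mons ?N d. Poly_Mapping.single (Abs_poly_mapping \<alpha>)
      (v (card (fst z)) (snd z) (rel_class (sorted_list_of_set (fst z)) ?N \<alpha>)))" for z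
  have fin: "finite {i. \<alpha> i \<noteq> 0}" if "\<alpha> \<in> mons ?N d" for \<alpha>
  proof (rule finite_subset)
    have "\<alpha> i = 0" if "i \<notin> ?N" for i using \<open>\<alpha> \<in> mons ?N d\<close> that by (simp add: mons_def)
    then show "{i. \<alpha> i \<noteq> 0} \<subseteq> ?N" by (meson mem_Collect_eq subsetI)
  qed simp
  have lookup: "Poly_Mapping.lookup (Abs_poly_mapping \<alpha>) = \<alpha>" if "\<alpha> \<in> mons ?N d" for \<alpha>
    by (rule lookup_Abs_poly_mapping[OF fin[OF that]])
  have keys: "Poly_Mapping.keys (Abs_poly_mapping \<alpha>) \<subseteq> ?N" if "\<alpha> \<in> mons ?N d" for \<alpha>
    using that by (auto simp: in_keys_iff lookup[OF that]) (auto simp: mons_def)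
  have q_eval: "poly_eval x (q z) = (\<Sum>\<alpha>\<in>mons ?N d. v (card (fst z)) (snd z) (rel_class (sorted_list_of_set (fst z)) ?N \<alpha>) * monom_eval ?N \<alpha> x)"
    for x z
    unfolding q_def poly_eval_sum poly_eval_single
    by (intro sum.cong refl arg_cong2[where f = times], subst monom_eval_keys[OF _ keys]) (simp_all add: lookup)
  show ?thesis
  proof (rule sum_of_squaresI[where I = "SIGMA S:{S \<in> Pow ?N. card S \<le> d}. rel_classes d (card S)" and q = q])
    show "q z \<in> polys_in ?N" for z unfolding q_def by (intro polys_in_sum polys_in_single keys)
    show "poly_eval x f = (\<Sum>i\<in>(SIGMA S:{S \<in> Pow ?N. card S \<le> d}. rel_classes d (card S)). (poly_eval x (q i))\<^sup>2)" for x
      unfolding eq square_sum_def q_eval by (subst sum.Sigma) (simp_all add: finite_rel_classes case_prod_unfold)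
  qed (use f in \<open>auto simp: finite_rel_classes\<close>)
qed

text \<open>\<open>v\<close> is chosen before n; this uniformity is what makes the condition
  expressible by finitely many real parameters.\<close>

lemma sum_of_squares_all_iff:
  "(\<forall>n\<ge>2 * d. sum_of_squares n (sym_form (partitions (2 * d)) n c)) \<longleftrightarrow>
   (\<exists>v. \<forall>n x. form_value c (2 * d) n x = square_sum d v n x)"
proof
  assume "\<forall>n\<ge>2 * d. sum_of_squares n (sym_form (partitions (2 * d)) n c)"
  then obtain g where g: "gram_kernel d g" "\<forall>m x. form_value c (2 * d) m x =
    (\<Sum>\<alpha>\<in>mons {1..m} d. \<Sum>\<beta>\<in>mons {1..m} d.
      g (pair_type {1..m} \<alpha> \<beta>) * (monom_eval {1..m} \<alpha> x * monom_eval {1..m} \<beta> x))"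
    using limit_gram_kernel by blast
  show "\<exists>v. \<forall>n x. form_value c (2 * d) n x = square_sum d v n x"
    using gram_kernel_square_sum[OF g(1)] by (simp only: g(2))
next
  assume "\<exists>v. \<forall>n x. form_value c (2 * d) n x = square_sum d v n x"
  then obtain v where v: "\<And>n x. form_value c (2 * d) n x = square_sum d v n x" by blast
  show "\<forall>n\<ge>2 * d. sum_of_squares n (sym_form (partitions (2 * d)) n c)"
  proof (intro allI impI)
    fix n
    show "sum_of_squares n (sym_form (partitions (2 * d)) n c)"
      by (rule square_sum_imp_sum_of_squares[OF sym_form_polys_in, of _ _ _ d v])
        (use v[of n] in \<open>simp add: form_value_def poly_eval_sym_form\<close>)
  qed
qed

section \<open>Infinite systems of equations and the elimination of the parameters\<close>

text \<open>Gaussian elimination, for a possibly infinite T: an equation with nonzero coefficient at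
  \<phi>0 removes this unknown from all equations and is added to the finite subsystem found for the
  remaining unknowns.\<close>

lemma finite_subsystem:
  fixes A :: "'t \<Rightarrow> 'f \<Rightarrow> real"
  assumes "finite \<Phi>"
  shows "\<exists>T'. finite T' \<and> T' \<subseteq> T \<and> (\<forall>z. (\<forall>t\<in>T'. (\<Sum>\<phi>\<in>\<Phi>. A t \<phi> * z \<phi>) = 0) \<longrightarrow> (\<forall>t\<in>T. (\<Sum>\<phi>\<in>\<Phi>. A t \<phi> * z \<phi>) = 0))"
  using assms
proof (induction \<Phi> arbitrary: A rule: finite_induct)
  case empty
  then show ?case by (intro exI[of _ "{}"]) simp
next
  case (insert \<phi>0 \<Phi>)
  show ?case
  proof (cases "\<forall>t\<in>T. A t \<phi>0 = 0")
    case True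
    obtain T' where T': "finite T'" "T' \<subseteq> T"
      "\<And>z. (\<forall>t\<in>T'. (\<Sum>\<phi>\<in>\<Phi>. A t \<phi> * z \<phi>) = 0) \<Longrightarrow> (\<forall>t\<in>T. (\<Sum>\<phi>\<in>\<Phi>. A t \<phi> * z \<phi>) = 0)"
      using insert.IH[of A] by blast
    have "(\<Sum>\<phi>\<in>insert \<phi>0 \<Phi>. A t \<phi> * z \<phi>) = (\<Sum>\<phi>\<in>\<Phi>. A t \<phi> * z \<phi>)" if "t \<in> T" for t z
      using True that insert.hyps by simp
    then show ?thesis using T' by (intro exI[of _ T'] conjI allI impI ballI) (auto simp: subset_iff)
  next
    case False
    then obtain t0 where t0: "t0 \<in> T" "A t0 \<phi>0 \<noteq> 0" by blast
    define r where "r t = A t \<phi>0 / A t0 \<phi>0" for t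
    define B where "B t \<phi> = A t \<phi> - r t * A t0 \<phi>" for t \<phi>
    obtain T' where T': "finite T'" "T' \<subseteq> T"
      "\<And>z. (\<forall>t\<in>T'. (\<Sum>\<phi>\<in>\<Phi>. B t \<phi> * z \<phi>) = 0) \<Longrightarrow> (\<forall>t\<in>T. (\<Sum>\<phi>\<in>\<Phi>. B t \<phi> * z \<phi>) = 0)"
      using insert.IH[of B] by blast
    have B: "(\<Sum>\<phi>\<in>\<Phi>. B t \<phi> * z \<phi>) = (\<Sum>\<phi>\<in>insert \<phi>0 \<Phi>. A t \<phi> * z \<phi>) - r t * (\<Sum>\<phi>\<in>insert \<phi>0 \<Phi>. A t0 \<phi> * z \<phi>)" for t z
    proof -
      have "r t * (A t0 \<phi>0 * z \<phi>0) = A t \<phi>0 * z \<phi>0" using t0 by (simp add: r_def)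
      moreover have "(\<Sum>\<phi>\<in>\<Phi>. B t \<phi> * z \<phi>) = (\<Sum>\<phi>\<in>\<Phi>. A t \<phi> * z \<phi>) - r t * (\<Sum>\<phi>\<in>\<Phi>. A t0 \<phi> * z \<phi>)"
        by (simp add: B_def left_diff_distrib sum_subtractf sum_distrib_left mult.assoc)
      ultimately show ?thesis unfolding sum.insert[OF insert.hyps] distrib_left by linarith
    qed
    show ?thesis
    proof (intro exI[of _ "insert t0 T'"] conjI allI impI)
      fix z assume z: "\<forall>t\<in>insert t0 T'. (\<Sum>\<phi>\<in>insert \<phi>0 \<Phi>. A t \<phi> * z \<phi>) = 0"
      then have z0: "(\<Sum>\<phi>\<in>insert \<phi>0 \<Phi>. A t0 \<phi> * z \<phi>) = 0" by (rule bspec[OF _ insertI1])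
      have "\<forall>t\<in>T'. (\<Sum>\<phi>\<in>\<Phi>. B t \<phi> * z \<phi>) = 0"
      proof
        fix t assume "t \<in> T'"
        then have "(\<Sum>\<phi>\<in>insert \<phi>0 \<Phi>. A t \<phi> * z \<phi>) = 0" by (intro bspec[OF z] insertI2)
        then show "(\<Sum>\<phi>\<in>\<Phi>. B t \<phi> * z \<phi>) = 0" unfolding B z0 by simp
      qed
      from T'(3)[OF this] show "\<forall>t\<in>T. (\<Sum>\<phi>\<in>insert \<phi>0 \<Phi>. A t \<phi> * z \<phi>) = 0" unfolding B z0 by simp
    qed (use T' t0 in auto)
  qed
qed

definition fun_span :: "('y \<Rightarrow> real) set \<Rightarrow> ('y \<Rightarrow> real) set" where
  "fun_span \<Phi> = {h. \<exists>a. \<forall>y. h y = (\<Sum>\<phi>\<in>\<Phi>. a \<phi> * \<phi> y)}"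

lemma fun_span_base: "finite \<Phi> \<Longrightarrow> \<phi> \<in> \<Phi> \<Longrightarrow> \<phi> \<in> fun_span \<Phi>"
  unfolding fun_span_def by (intro CollectI exI[of _ "\<lambda>\<psi>. if \<psi> = \<phi> then 1 else 0"]) (simp add: if_distrib[of "\<lambda>a. a * _"] cong: if_cong)

lemma fun_span_scale:
  assumes "h \<in> fun_span \<Phi>" shows "(\<lambda>y. r * h y) \<in> fun_span \<Phi>"
proof -
  obtain a where "\<forall>y. h y = (\<Sum>\<phi>\<in>\<Phi>. a \<phi> * \<phi> y)" using assms unfolding fun_span_def by (elim CollectE exE)
  then show ?thesis unfolding fun_span_def
    by (intro CollectI exI[of _ "\<lambda>\<phi>. r * a \<phi>"]) (simp add: sum_distrib_left mult.assoc)
qed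

lemma fun_span_add:
  assumes "h \<in> fun_span \<Phi>" "h' \<in> fun_span \<Phi>" shows "(\<lambda>y. h y + h' y) \<in> fun_span \<Phi>"
proof -
  obtain a where "\<forall>y. h y = (\<Sum>\<phi>\<in>\<Phi>. a \<phi> * \<phi> y)" using assms(1) unfolding fun_span_def by (elim CollectE exE)
  moreover obtain a' where "\<forall>y. h' y = (\<Sum>\<phi>\<in>\<Phi>. a' \<phi> * \<phi> y)" using assms(2) unfolding fun_span_def by (elim CollectE exE)
  ultimately show ?thesis unfolding fun_span_def
    by (intro CollectI exI[of _ "\<lambda>\<phi>. a \<phi> + a' \<phi>"]) (simp add: sum.distrib distrib_right)
qed

lemma fun_span_diff:
  assumes "h \<in> fun_span \<Phi>" "h' \<in> fun_span \<Phi>" shows "(\<lambda>y. h y - h' y) \<in> fun_span \<Phi>"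
  using fun_span_add[OF assms(1) fun_span_scale[OF assms(2), of "- 1"]] by simp

lemma fun_span_sum:
  assumes "\<And>i. i \<in> I \<Longrightarrow> h i \<in> fun_span \<Phi>" shows "(\<lambda>y. \<Sum>i\<in>I. h i y) \<in> fun_span \<Phi>"
  using assms
proof (induction I rule: infinite_finite_induct)
  case (insert i I)
  then show ?case using fun_span_add[of "h i" \<Phi> "\<lambda>y. \<Sum>i\<in>I. h i y"] by simp
qed (auto simp: fun_span_def intro!: exI[of _ "\<lambda>_. 0"])

text \<open>The functions in \<Phi> are treated as independent unknowns z. A finite subsystem that
  suffices for all z suffices in particular for their values at a point y.\<close>

lemma sign_algebra_equations:
  assumes fin: "finite \<Phi>" and poly: "\<Phi> \<subseteq> poly_funs I" and h: "\<And>t. t \<in> T \<Longrightarrow> h t \<in> fun_span \<Phi>"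
  shows "{y. \<forall>t\<in>T. h t y = 0} \<in> sign_algebra (poly_funs I)"
proof -
  have "\<forall>t. \<exists>a. t \<in> T \<longrightarrow> (\<forall>y. h t y = (\<Sum>\<phi>\<in>\<Phi>. a \<phi> * \<phi> y))"
    using h unfolding fun_span_def by simp
  then obtain A where A: "\<forall>t. t \<in> T \<longrightarrow> (\<forall>y. h t y = (\<Sum>\<phi>\<in>\<Phi>. A t \<phi> * \<phi> y))"
    by (elim choice[THEN exE]) (rule that)
  obtain T' where T': "finite T'" "T' \<subseteq> T"
    "\<And>z. \<forall>t\<in>T'. (\<Sum>\<phi>\<in>\<Phi>. A t \<phi> * z \<phi>) = 0 \<Longrightarrow> \<forall>t\<in>T. (\<Sum>\<phi>\<in>\<Phi>. A t \<phi> * z \<phi>) = 0"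
    using finite_subsystem[OF fin, of T A] by (elim exE conjE) (rule that, assumption+, blast)
  have "{y. \<forall>t\<in>T. h t y = 0} = (\<Inter>t\<in>T'. {y. h t y = 0})"
  proof (intro set_eqI iffI)
    fix y assume "y \<in> (\<Inter>t\<in>T'. {y. h t y = 0})"
    then have "\<forall>t\<in>T'. (\<Sum>\<phi>\<in>\<Phi>. A t \<phi> * \<phi> y) = 0" using A T'(2) by (auto simp: subset_iff)
    from T'(3)[of "\<lambda>\<phi>. \<phi> y", OF this] show "y \<in> {y. \<forall>t\<in>T. h t y = 0}" using A by simp
  qed (use T'(2) in auto)
  moreover have "(\<Inter>t\<in>T'. {y. h t y = 0}) \<in> sign_algebra (poly_funs I)"
  proof (rule PF.sign_INT[OF T'(1)], rule PF.sign_zero)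
    fix t assume "t \<in> T'"
    then have "h t = (\<lambda>y. \<Sum>\<phi>\<in>\<Phi>. A t \<phi> * \<phi> y)" using A T'(2) by (auto simp: subset_iff)
    moreover have "(\<lambda>y. \<Sum>\<phi>\<in>\<Phi>. A t \<phi> * \<phi> y) \<in> poly_funs I"
    proof (rule poly_funs_sum)
      fix \<phi> assume "\<phi> \<in> \<Phi>"
      then have "\<phi> \<in> poly_funs I" using poly by blast
      then show "(\<lambda>y. A t \<phi> * \<phi> y) \<in> poly_funs I" by (rule poly_funs.mult[OF poly_funs.const])
    qed
    ultimately show "h t \<in> poly_funs I" by simp
  qed
  ultimately show ?thesis by simp
qed

text \<open>For fixed n and x the equation is linear in c and quadratic in v, so \<Phi> consists of
  the coefficients and the products of two parameters. Coefficients and parameters become the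
  \<open>Inl\<close> and \<open>Inr\<close> coordinates of one space, and the \<open>Inr\<close>
  coordinates are projected out.\<close>

lemma square_sum_representable_sign_algebra:
  "{c. \<exists>v. \<forall>n x. form_value c (2 * d) n x = square_sum d v n x} \<in> sign_algebra (poly_funs (partitions (2 * d)))"
proof -
  let ?P = "partitions (2 * d)"
  define J where "J = (SIGMA s:{..d}. rel_classes d s \<times> rel_classes d s)"
  have finJ: "finite J" by (simp add: J_def finite_rel_classes)
  let ?I = "Inl ` ?P \<union> Inr ` J"
  define c where "c y \<mu> = y (Inl \<mu>)" for y :: "nat multiset + nat \<times> (nat list \<times> nat multiset) \<times> (nat list \<times> nat multiset) \<Rightarrow> real" and \<mu>
  define v where "v y s j \<kappa> = y (Inr (s, j, \<kappa>))" for y :: "nat multiset + nat \<times> (nat list \<times> nat multiset) \<times> (nat list \<times> nat multiset) \<Rightarrow> real" and s j \<kappa>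
  define h where "h = (\<lambda>(n, x) y. form_value (c y) (2 * d) n x - square_sum d (v y) n x)"
  define \<Phi> where "\<Phi> = (\<lambda>\<mu> y. c y \<mu>) ` ?P \<union> (\<lambda>(p, q) y. y (Inr p) * y (Inr q)) ` (J \<times> J)"
  have fin\<Phi>: "finite \<Phi>" by (simp add: \<Phi>_def finJ finite_partitions)
  have poly: "\<Phi> \<subseteq> poly_funs ?I"
    unfolding \<Phi>_def c_def by (auto simp: split_beta intro!: poly_funs.coord poly_funs.mult)
  have classes: "rel_class (sorted_list_of_set S) {1..n} \<alpha> \<in> rel_classes d (card S)"
    if "S \<subseteq> {1..n}" "\<alpha> \<in> mons {1..n} d" for S \<alpha> and n :: nat
    using rel_class_in_rel_classes[of "{1..n}" "sorted_list_of_set S" \<alpha> d] that finite_subset[OF that(1)] by simp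
  have "h (n, x) \<in> fun_span \<Phi>" for n x
  proof -
    have "(\<lambda>y. form_value (c y) (2 * d) n x) \<in> fun_span \<Phi>"
    proof -
      have "(\<lambda>y. \<Sum>\<mu>\<in>?P. power_sum_value {1..n} \<mu> x * c y \<mu>) \<in> fun_span \<Phi>"
      proof (rule fun_span_sum, rule fun_span_scale, rule fun_span_base[OF fin\<Phi>])
        show "(\<lambda>y. c y \<mu>) \<in> \<Phi>" if "\<mu> \<in> ?P" for \<mu> unfolding \<Phi>_def by (rule UnI1, rule imageI) (rule that)
      qed
      then show ?thesis by (simp add: form_value_def mult.commute)
    qed
    moreover have "(\<lambda>y. square_sum d (v y) n x) \<in> fun_span \<Phi>"
    proof -
      let ?cl = "\<lambda>S. rel_class (sorted_list_of_set S) {1..n}" and ?e = "\<lambda>\<alpha>. monom_eval {1..n} \<alpha> x"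
      have "(\<lambda>y. \<Sum>S\<in>{S \<in> Pow {1..n}. card S \<le> d}. \<Sum>j\<in>rel_classes d (card S). \<Sum>\<alpha>\<in>mons {1..n} d. \<Sum>\<beta>\<in>mons {1..n} d.
          (?e \<alpha> * ?e \<beta>) * (y (Inr (card S, j, ?cl S \<alpha>)) * y (Inr (card S, j, ?cl S \<beta>)))) \<in> fun_span \<Phi>"
      proof (rule fun_span_sum, rule fun_span_sum, rule fun_span_sum, rule fun_span_sum, rule fun_span_scale,
          rule fun_span_base[OF fin\<Phi>])
        fix S j \<alpha> \<beta> assume "S \<in> {S \<in> Pow {1..n}. card S \<le> d}" "j \<in> rel_classes d (card S)"
          "\<alpha> \<in> mons {1..n} d" "\<beta> \<in> mons {1..n} d"
        then have "((card S, j, ?cl S \<alpha>), (card S, j, ?cl S \<beta>)) \<in> J \<times> J"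
          using classes by (simp add: J_def)
        then have "(\<lambda>(p, q) y. y (Inr p) * y (Inr q)) ((card S, j, ?cl S \<alpha>), (card S, j, ?cl S \<beta>)) \<in> \<Phi>"
          unfolding \<Phi>_def by (intro UnI2 imageI)
        then show "(\<lambda>y. y (Inr (card S, j, ?cl S \<alpha>)) * y (Inr (card S, j, ?cl S \<beta>))) \<in> \<Phi>" by simp
      qed
      then show ?thesis unfolding square_sum_def sum_mult_square v_def by (simp add: mult_ac)
    qed
    ultimately show ?thesis unfolding h_def case_prod_conv by (rule fun_span_diff)
  qed
  then have "{y. \<forall>t\<in>UNIV. h t y = 0} \<in> sign_algebra (poly_funs ?I)"
    by (intro sign_algebra_equations[OF fin\<Phi> poly]) (metis surj_pair)
  from sign_algebra_project_finite[OF finite_imageI[OF finJ] this]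
  have proj: "{y. \<exists>w. (\<lambda>i. if i \<in> Inr ` J then w i else y i) \<in> {y. \<forall>t\<in>UNIV. h t y = 0}} \<in> sign_algebra (poly_funs (Inl ` ?P))" .
  \<comment> \<open>The 0 at \<open>Inr\<close> is a placeholder: the coordinates in J are
    overwritten by \<open>w\<close>, and the equations involve no other parameters.\<close>
  have pull: "{c. (\<lambda>i. case i of Inl \<mu> \<Rightarrow> c \<mu> | Inr p \<Rightarrow> 0) \<in>
      {y. \<exists>w. (\<lambda>i. if i \<in> Inr ` J then w i else y i) \<in> {y. \<forall>t\<in>UNIV. h t y = 0}}} \<in> sign_algebra (poly_funs ?P)"
  proof (rule sign_algebra_vimage[OF proj])
    fix i :: "nat multiset + nat \<times> (nat list \<times> nat multiset) \<times> (nat list \<times> nat multiset)"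
    assume "i \<in> Inl ` ?P"
    then obtain \<mu> where "i = Inl \<mu>" "\<mu> \<in> ?P" by blast
    then show "(\<lambda>c. case i of Inl \<mu> \<Rightarrow> c \<mu> | Inr p \<Rightarrow> 0) \<in> poly_funs ?P" by (simp add: poly_funs.coord)
  qed
  have square_sum_cong: "square_sum d u n x = square_sum d u' n x"
    if "\<And>s j \<kappa>. (s, j, \<kappa>) \<in> J \<Longrightarrow> u s j \<kappa> = u' s j \<kappa>" for u u' n x
    unfolding square_sum_def using that classes by (intro sum.cong refl arg_cong2[where f = power] arg_cong2[where f = times]) (auto simp: J_def)
  have "{c. (\<lambda>i. case i of Inl \<mu> \<Rightarrow> c \<mu> | Inr p \<Rightarrow> 0) \<in>
      {y. \<exists>w. (\<lambda>i. if i \<in> Inr ` J then w i else y i) \<in> {y. \<forall>t\<in>UNIV. h t y = 0}}} =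
    {c. \<exists>v. \<forall>n x. form_value c (2 * d) n x = square_sum d v n x}"
  proof (intro set_eqI)
    fix b :: "nat multiset \<Rightarrow> real"
    define y where "y w i = (if i \<in> Inr ` J then w i else (case i of Inl \<mu> \<Rightarrow> b \<mu> | Inr p \<Rightarrow> 0))"
      for w :: "nat multiset + nat \<times> (nat list \<times> nat multiset) \<times> (nat list \<times> nat multiset) \<Rightarrow> real" and i
    have cy: "c (y w) = b" for w by (auto simp: c_def y_def fun_eq_iff)
    have vy: "v (y w) s j \<kappa> = w (Inr (s, j, \<kappa>))" if "(s, j, \<kappa>) \<in> J" for w s j \<kappa> using that by (simp add: v_def y_def)
    have h0: "(\<forall>t\<in>UNIV. h t (y w) = 0) \<longleftrightarrow> (\<forall>n x. form_value b (2 * d) n x = square_sum d (v (y w)) n x)" for w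
      by (simp add: h_def cy)
    have "(\<exists>w. \<forall>t\<in>UNIV. h t (y w) = 0) \<longleftrightarrow> (\<exists>v. \<forall>n x. form_value b (2 * d) n x = square_sum d v n x)"
    proof
      assume "\<exists>v. \<forall>n x. form_value b (2 * d) n x = square_sum d v n x"
      then obtain u where u: "\<And>n x. form_value b (2 * d) n x = square_sum d u n x" by blast
      define w where "w i = (case i of Inl \<mu> \<Rightarrow> 0 | Inr (s, j, \<kappa>) \<Rightarrow> u s j \<kappa>)"
        for i :: "nat multiset + nat \<times> (nat list \<times> nat multiset) \<times> (nat list \<times> nat multiset)"
      have "square_sum d (v (y w)) n x = square_sum d u n x" for n x
        by (rule square_sum_cong) (simp add: vy w_def)
      then show "\<exists>w. \<forall>t\<in>UNIV. h t (y w) = 0" unfolding h0 using u by (intro exI[of _ w]) simp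
    qed (use h0 in blast)
    then show "b \<in> {c. (\<lambda>i. case i of Inl \<mu> \<Rightarrow> c \<mu> | Inr p \<Rightarrow> 0) \<in>
      {y. \<exists>w. (\<lambda>i. if i \<in> Inr ` J then w i else y i) \<in> {y. \<forall>t\<in>UNIV. h t y = 0}}} \<longleftrightarrow>
      b \<in> {c. \<exists>v. \<forall>n x. form_value c (2 * d) n x = square_sum d v n x}"
      unfolding y_def by simp
  qed
  then show ?thesis using pull by simp
qed

theorem semialgebraic_S_Sigma: "semialgebraic (partitions (2 * d)) (S_Sigma (2 * d))"
proof -
  have "S_Sigma (2 * d) = {c. \<exists>v. \<forall>n x. form_value c (2 * d) n x = square_sum d v n x} \<inter> coord_space (partitions (2 * d))"
    unfolding S_Sigma_def sum_of_squares_all_iff by blast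
  then show ?thesis using semialgebraic_if_sign_algebra[OF square_sum_representable_sign_algebra] by simp
qed

definition zero_extend :: "'i set \<Rightarrow> ('i \<Rightarrow> real) \<Rightarrow> 'i \<Rightarrow> real" where
  "zero_extend I c i = (if i \<in> I then c i else 0)"

lemma zero_extend_poly_funs: "(\<lambda>c. zero_extend I c i) \<in> poly_funs I"
  by (cases "i \<in> I") (simp_all add: zero_extend_def poly_funs.coord poly_funs.const)

lemma sym_form_zero_extend:
  assumes "L \<subseteq> L'" "finite L'"
  shows "sym_form L' n (zero_extend L c) = sym_form L n c"
proof -
  have "sym_form L' n (zero_extend L c) = (\<Sum>\<mu>\<in>L. Const (zero_extend L c \<mu>) * power_sum_partition n \<mu>)"
    unfolding sym_form_def using assms by (intro sum.mono_neutral_right) (auto simp: zero_extend_def Const_def)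
  also have "\<dots> = sym_form L n c"
    unfolding sym_form_def by (intro sum.cong) (auto simp: zero_extend_def)
  finally show ?thesis .
qed

lemma even_partitions_subset: "even_partitions k \<subseteq> partitions k"
  by (auto simp: even_partitions_def)

text \<open>The even cone is the section of the full cone by the coordinate subspace on which the
  coefficients of all other partitions vanish, and preimages under polynomial maps stay in the
  algebra.\<close>

theorem semialgebraic_B_Sigma: "semialgebraic (even_partitions (2 * d)) (B_Sigma (2 * d))"
proof -
  let ?E = "even_partitions (2 * d)"
  have "B_Sigma (2 * d) = {c. zero_extend ?E c \<in> {c. \<exists>v. \<forall>n x. form_value c (2 * d) n x = square_sum d v n x}} \<inter> coord_space ?E"
    unfolding B_Sigma_def mem_Collect_eq sum_of_squares_all_iff[symmetric]
      sym_form_zero_extend[OF even_partitions_subset finite_partitions] by blast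
  moreover have "{c. zero_extend ?E c \<in> {c. \<exists>v. \<forall>n x. form_value c (2 * d) n x = square_sum d v n x}} \<in> sign_algebra (poly_funs ?E)"
    by (rule sign_algebra_vimage[OF square_sum_representable_sign_algebra zero_extend_poly_funs])
  ultimately show ?thesis using semialgebraic_if_sign_algebra by simp
qed

section \<open>Failure of semialgebraicity for nonnegative forms\<close>

text \<open>The outer variable of \<open>P\<close> is \<epsilon>, and its coefficients are
  polynomials in t; this nesting fits the order in which the two variables tend to 0.\<close>

definition bipoly :: "(real \<Rightarrow> real \<Rightarrow> real) set" where
  "bipoly = {f. \<exists>P :: real poly poly. \<forall>t \<epsilon>. f t \<epsilon> = poly (poly P [:\<epsilon>:]) t}"

lemma bipoly_const: "(\<lambda>t \<epsilon>. a) \<in> bipoly"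
  unfolding bipoly_def by (intro CollectI exI[of _ "[:[:a:]:]"]) simp

lemma bipoly_fst: "(\<lambda>t \<epsilon>. t) \<in> bipoly"
  unfolding bipoly_def by (intro CollectI exI[of _ "[:[:0, 1:]:]"]) simp

lemma bipoly_snd: "(\<lambda>t \<epsilon>. \<epsilon>) \<in> bipoly"
  unfolding bipoly_def by (intro CollectI exI[of _ "[:0, 1:]"]) simp

lemma bipoly_add: "f \<in> bipoly \<Longrightarrow> g \<in> bipoly \<Longrightarrow> (\<lambda>t \<epsilon>. f t \<epsilon> + g t \<epsilon>) \<in> bipoly"
  unfolding bipoly_def mem_Collect_eq
proof (elim exE)
  fix P Q :: "real poly poly"
  assume "\<forall>t \<epsilon>. f t \<epsilon> = poly (poly P [:\<epsilon>:]) t" "\<forall>t \<epsilon>. g t \<epsilon> = poly (poly Q [:\<epsilon>:]) t"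
  then show "\<exists>P. \<forall>t \<epsilon>. f t \<epsilon> + g t \<epsilon> = poly (poly P [:\<epsilon>:]) t" by (intro exI[of _ "P + Q"]) simp
qed

lemma bipoly_mult: "f \<in> bipoly \<Longrightarrow> g \<in> bipoly \<Longrightarrow> (\<lambda>t \<epsilon>. f t \<epsilon> * g t \<epsilon>) \<in> bipoly"
  unfolding bipoly_def mem_Collect_eq
proof (elim exE)
  fix P Q :: "real poly poly"
  assume "\<forall>t \<epsilon>. f t \<epsilon> = poly (poly P [:\<epsilon>:]) t" "\<forall>t \<epsilon>. g t \<epsilon> = poly (poly Q [:\<epsilon>:]) t"
  then show "\<exists>P. \<forall>t \<epsilon>. f t \<epsilon> * g t \<epsilon> = poly (poly P [:\<epsilon>:]) t" by (intro exI[of _ "P * Q"]) simp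
qed

lemma bipoly_diff: "f \<in> bipoly \<Longrightarrow> g \<in> bipoly \<Longrightarrow> (\<lambda>t \<epsilon>. f t \<epsilon> - g t \<epsilon>) \<in> bipoly"
  using bipoly_add[OF _ bipoly_mult[OF bipoly_const[of "- 1"]]] by simp

lemma eventually_sgn_eq:
  fixes f :: "real \<Rightarrow> real"
  assumes "(f \<longlongrightarrow> l) F" "l \<noteq> 0" shows "\<forall>\<^sub>F x in F. sgn (f x) = sgn l"
proof (cases "l > 0")
  case True
  from order_tendstoD(1)[OF assms(1) this] show ?thesis by (rule eventually_mono) (use True in simp)
next
  case False
  with assms(2) have "l < 0" by simp
  from order_tendstoD(2)[OF assms(1) this] show ?thesis by (rule eventually_mono) (use \<open>l < 0\<close> in simp)
qed

text \<open>The sign is that of the lowest nonzero coefficient; factors t > 0 do not affect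
  it.\<close>

lemma eventually_sgn_poly:
  fixes q :: "real poly"
  assumes "q \<noteq> 0" shows "\<exists>s. s \<noteq> 0 \<and> (\<forall>\<^sub>F t in at_right 0. sgn (poly q t) = s)"
  using assms
proof (induction q)
  case (pCons a q)
  show ?case
  proof (cases "a = 0")
    case True
    then have "q \<noteq> 0" using pCons.hyps by auto
    then obtain s where s: "s \<noteq> 0" "\<forall>\<^sub>F t in at_right 0. sgn (poly q t) = s" using pCons.IH by blast
    have "\<forall>\<^sub>F t in at_right 0. sgn (poly (pCons a q) t) = s"
      using s(2) eventually_at_right_less[of "0::real"] by eventually_elim (simp add: True sgn_mult)
    then show ?thesis using s(1) by blast
  next
    case False
    have "(poly (pCons a q) \<longlongrightarrow> poly (pCons a q) 0) (at_right 0)" by (intro tendsto_poly tendsto_ident_at)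
    then have "\<forall>\<^sub>F t in at_right 0. sgn (poly (pCons a q) t) = sgn a"
      using eventually_sgn_eq[of "poly (pCons a q)" a] False by simp
    then show ?thesis using False by (intro exI[of _ "sgn a"]) (simp add: sgn_0_0)
  qed
qed simp

text \<open>Factors \<epsilon> > 0 are stripped until the coefficient q of the lowest power is
  nonzero. Near t = 0 the value of q is nonzero of constant sign, and it dominates for all
  \<epsilon> that are small depending on t.\<close>

lemma bipoly_germ:
  assumes "f \<in> bipoly"
  shows "\<exists>s. \<forall>\<^sub>F t in at_right 0. \<forall>\<^sub>F \<epsilon> in at_right 0. sgn (f t \<epsilon>) = s"
proof -
  obtain P :: "real poly poly" where P: "\<And>t \<epsilon>. f t \<epsilon> = poly (poly P [:\<epsilon>:]) t" using assms unfolding bipoly_def by blast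
  have "\<exists>s. \<forall>\<^sub>F t in at_right 0. \<forall>\<^sub>F \<epsilon> in at_right 0. sgn (poly (poly P [:\<epsilon>:]) t) = s"
  proof (induction P)
    case 0
    show ?case by (intro exI[of _ 0]) simp
  next
    case (pCons q P)
    show ?case
    proof (cases "q = 0")
      case True
      obtain s where s: "\<forall>\<^sub>F t in at_right 0. \<forall>\<^sub>F \<epsilon> in at_right 0. sgn (poly (poly P [:\<epsilon>:]) t) = s"
        using pCons.IH by blast
      have "\<forall>\<^sub>F t in at_right 0. \<forall>\<^sub>F \<epsilon> in at_right 0. sgn (poly (poly (pCons q P) [:\<epsilon>:]) t) = s"
        using s
      proof eventually_elim
        case (elim t)
        show ?case using elim eventually_at_right_less[of "0::real"]
          by eventually_elim (simp add: True sgn_mult)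
      qed
      then show ?thesis by blast
    next
      case False
      obtain s where s: "s \<noteq> 0" "\<forall>\<^sub>F t in at_right 0. sgn (poly q t) = s" using eventually_sgn_poly[OF False] by blast
      have cont: "\<exists>R. \<forall>\<epsilon>. poly (poly P [:\<epsilon>:]) t = poly R \<epsilon>" for P :: "real poly poly" and t
      proof (induction P)
        case 0
        show ?case by (intro exI[of _ 0]) simp
      next
        case (pCons q P)
        then obtain R where "\<forall>\<epsilon>. poly (poly P [:\<epsilon>:]) t = poly R \<epsilon>" by blast
        then show ?case by (intro exI[of _ "pCons (poly q t) R"]) simp
      qed
      have "\<forall>\<^sub>F t in at_right 0. \<forall>\<^sub>F \<epsilon> in at_right 0. sgn (poly (poly (pCons q P) [:\<epsilon>:]) t) = s"
        using s(2)
      proof eventually_elim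
        case (elim t)
        obtain R where R: "\<And>\<epsilon>. poly (poly (pCons q P) [:\<epsilon>:]) t = poly R \<epsilon>" using cont by blast
        have "(poly R \<longlongrightarrow> poly R 0) (at_right 0)" by (intro tendsto_poly tendsto_ident_at)
        moreover have "poly R 0 = poly q t" using R[of 0, symmetric] by simp
        ultimately have tend: "(poly R \<longlongrightarrow> poly q t) (at_right 0)" by simp
        have "poly q t \<noteq> 0" using elim s(1) by (metis sgn_0)
        from eventually_sgn_eq[OF tend this] show ?case unfolding R elim .
      qed
      then show ?thesis by blast
    qed
  qed
  then show ?thesis by (simp add: P)
qed

lemma sign_algebra_germ:
  assumes "S \<in> sign_algebra (poly_funs I)" and g: "\<And>i. i \<in> I \<Longrightarrow> (\<lambda>t \<epsilon>. g t \<epsilon> i) \<in> bipoly"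
  shows "\<exists>b. \<forall>\<^sub>F t in at_right 0. \<forall>\<^sub>F \<epsilon> in at_right 0. g t \<epsilon> \<in> S \<longleftrightarrow> b"
  using assms(1)
proof induction
  case (pos f)
  have "(\<lambda>t \<epsilon>. f (g t \<epsilon>)) \<in> bipoly" using pos
  proof induction
    case (const a) show ?case by (rule bipoly_const)
  next
    case (coord i) then show ?case by (rule g)
  next
    case (add f h) show ?case by (rule bipoly_add[OF add.IH])
  next
    case (mult f h) show ?case by (rule bipoly_mult[OF mult.IH])
  qed
  from bipoly_germ[OF this] obtain s where "\<forall>\<^sub>F t in at_right 0. \<forall>\<^sub>F \<epsilon> in at_right 0. sgn (f (g t \<epsilon>)) = s" by blast
  then have "\<forall>\<^sub>F t in at_right 0. \<forall>\<^sub>F \<epsilon> in at_right 0. (g t \<epsilon> \<in> {x. f x > 0}) \<longleftrightarrow> s = 1"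
    by (rule eventually_mono) (erule eventually_mono, auto simp: sgn_if split: if_splits)
  then show ?case by (rule exI)
next
  case (compl S)
  then obtain b where "\<forall>\<^sub>F t in at_right 0. \<forall>\<^sub>F \<epsilon> in at_right 0. g t \<epsilon> \<in> S \<longleftrightarrow> b" by blast
  then have "\<forall>\<^sub>F t in at_right 0. \<forall>\<^sub>F \<epsilon> in at_right 0. g t \<epsilon> \<in> - S \<longleftrightarrow> \<not> b"
    by (rule eventually_mono) (erule eventually_mono, simp)
  then show ?case by (rule exI)
next
  case (union S T)
  then obtain b b' where *: "\<forall>\<^sub>F t in at_right 0. \<forall>\<^sub>F \<epsilon> in at_right 0. g t \<epsilon> \<in> S \<longleftrightarrow> b"
     "\<forall>\<^sub>F t in at_right 0. \<forall>\<^sub>F \<epsilon> in at_right 0. g t \<epsilon> \<in> T \<longleftrightarrow> b'" by blast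
  have "\<forall>\<^sub>F t in at_right 0. \<forall>\<^sub>F \<epsilon> in at_right 0. g t \<epsilon> \<in> S \<union> T \<longleftrightarrow> b \<or> b'"
    using *
  proof eventually_elim
    case (elim t)
    show ?case using elim by eventually_elim simp
  qed
  then show ?case by (rule exI)
qed

text \<open>The signs of finitely many polynomials in \<open>t\<close> and \<open>\<epsilon>\<close> are constant for \<open>\<epsilon>\<close> infinitesimally small
  compared with \<open>t\<close> and \<open>t\<close> near \<open>0\<close>.\<close>

lemma not_semialgebraic_if_reciprocals_excluded:
  assumes coord: "\<And>t \<epsilon>. g t \<epsilon> \<in> coord_space I"
    and g: "\<And>i. i \<in> I \<Longrightarrow> (\<lambda>t \<epsilon>. g t \<epsilon> i) \<in> bipoly"
    and out: "\<And>m \<epsilon>. m \<ge> 1 \<Longrightarrow> \<epsilon> > 0 \<Longrightarrow> g (1 / real m) \<epsilon> \<notin> S"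
    and inside: "\<And>t. t > 0 \<Longrightarrow> (\<And>k :: nat. real k * t \<noteq> 1) \<Longrightarrow> \<exists>e>0. \<forall>\<epsilon>. 0 < \<epsilon> \<and> \<epsilon> \<le> e \<longrightarrow> g t \<epsilon> \<in> S"
  shows "\<not> semialgebraic I S"
proof
  assume "semialgebraic I S"
  then obtain T where T: "T \<in> sign_algebra (poly_funs I)" "S = T \<inter> coord_space I"
    using sign_algebra_if_semialgebraic by blast
  have ST: "g t \<epsilon> \<in> T \<longleftrightarrow> g t \<epsilon> \<in> S" for t \<epsilon> using coord T(2) by blast
  have "\<exists>b. \<forall>\<^sub>F t in at_right 0. \<forall>\<^sub>F \<epsilon> in at_right 0. g t \<epsilon> \<in> T \<longleftrightarrow> b"
    by (rule sign_algebra_germ[OF T(1)]) (rule g)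
  then obtain b where "\<forall>\<^sub>F t in at_right 0. \<forall>\<^sub>F \<epsilon> in at_right 0. g t \<epsilon> \<in> S \<longleftrightarrow> b"
    unfolding ST by (elim exE) (rule that)
  then obtain a where a: "a > 0" "\<And>t. 0 < t \<Longrightarrow> t < a \<Longrightarrow> \<forall>\<^sub>F \<epsilon> in at_right 0. g t \<epsilon> \<in> S \<longleftrightarrow> b"
    by (subst (asm) eventually_at_right_field) blast
  obtain n where n: "inverse (real (Suc n)) < a" using reals_Archimedean[OF a(1)] by blast
  \<comment> \<open>Two statements about all small \<epsilon> > 0 are compared at a single
    \<epsilon> small enough for both.\<close>
  have b: "b \<longleftrightarrow> c" if e: "e > 0" "\<forall>\<epsilon>. 0 < \<epsilon> \<and> \<epsilon> \<le> e \<longrightarrow> (g t \<epsilon> \<in> S \<longleftrightarrow> c)" and t: "0 < t" "t < a" for t e c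
  proof -
    have "\<forall>\<^sub>F \<epsilon> in at_right 0. g t \<epsilon> \<in> S \<longleftrightarrow> b" by (rule a(2)[OF t])
    then obtain h where h: "h > 0" "\<forall>\<epsilon>>0. \<epsilon> < h \<longrightarrow> (g t \<epsilon> \<in> S \<longleftrightarrow> b)"
      by (subst (asm) eventually_at_right_field) blast
    have "g t (min e (h / 2)) \<in> S \<longleftrightarrow> b" using h e(1) by simp
    moreover have "g t (min e (h / 2)) \<in> S \<longleftrightarrow> c" using e h(1) by simp
    ultimately show ?thesis by simp
  qed
  have "\<not> b"
    using b[of 1 "1 / real (Suc n)" False] out[of "Suc n"] n by (simp add: inverse_eq_divide)
  moreover have b
  proof -
    \<comment> \<open>Here 1/t = n + 3/2 is no integer, so t is not excluded, and t < 1/(n + 1) <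
      a.\<close>
    define t where "t = 2 / (2 * real (Suc n) + 1)"
    have t: "t > 0" "t < a"
    proof -
      show "t > 0" by (simp add: t_def)
      have "t < inverse (real (Suc n))" by (simp add: t_def field_simps)
      then show "t < a" using n by simp
    qed
    have "real k * t \<noteq> 1" for k :: nat
    proof
      assume "real k * t = 1"
      then have "real (2 * k) = real (2 * Suc n + 1)" by (simp add: t_def field_simps)
      then have "2 * k = 2 * Suc n + 1" by (simp only: of_nat_eq_iff)
      then show False by presburger
    qed
    then obtain e where e: "e > 0" "\<forall>\<epsilon>. 0 < \<epsilon> \<and> \<epsilon> \<le> e \<longrightarrow> g t \<epsilon> \<in> S" using inside[OF t(1)] by blast
    then show b using b[of e t True] t by simp
  qed
  ultimately show False by blast
qed

section \<open>Forms whose nonnegativity fails exactly at reciprocals\<close>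

text \<open>If the sum is small, almost all of the mass sits on the set A of indices where y is
  close to t, so card A times t is close to 1. But the integer multiples of t stay at distance
  \<eta> from 1. The bound does not depend on the number of variables.\<close>

lemma spread_bound:
  fixes t :: real
  assumes t: "t > 0" and nt: "\<And>k :: nat. real k * t \<noteq> 1"
  shows "\<exists>e>0. \<forall>(N :: 'i set) y. finite N \<longrightarrow> (\<forall>i\<in>N. 0 \<le> y i) \<longrightarrow> (\<Sum>i\<in>N. y i) = 1 \<longrightarrow> e \<le> (\<Sum>i\<in>N. y i * (y i - t)\<^sup>2)"
proof -
  \<comment> \<open>Multiples k t with k > K exceed 2, so finitely many k determine the distance
    \<eta>.\<close>
  obtain K :: nat where K: "2 < real K * t" using reals_Archimedean3[OF t] by blast
  define \<eta> where "\<eta> = Min (insert 1 ((\<lambda>k. \<bar>real k * t - 1\<bar>) ` {..K}))"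
  have \<eta>0: "\<eta> > 0" unfolding \<eta>_def by (subst Min_gr_iff) (use nt in auto)
  have \<eta>: "\<eta> \<le> \<bar>real k * t - 1\<bar>" for k :: nat
  proof (cases "k \<le> K")
    case True
    then show ?thesis unfolding \<eta>_def by (intro Min_le) auto
  next
    case False
    then have "real K * t \<le> real k * t" using t by (intro mult_right_mono) auto
    then have "1 \<le> \<bar>real k * t - 1\<bar>" using K by linarith
    moreover have "\<eta> \<le> 1" unfolding \<eta>_def by (intro Min_le) auto
    ultimately show ?thesis by linarith
  qed
  \<comment> \<open>The bound t / 2 gives card A \<le> 2 / t, and \<eta> t / 8 then makes the
    accumulated error on A at most \<eta> / 4. Together with a mass below \<eta> / 2 off A this is
    less than \<eta>.\<close>
  define \<delta> where "\<delta> = min (t / 2) (\<eta> * t / 8)"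
  have \<delta>: "\<delta> > 0" "\<delta> \<le> t / 2" "\<delta> \<le> \<eta> * t / 8" using t \<eta>0 by (auto simp: \<delta>_def)
  have "\<delta>\<^sup>2 * \<eta> / 2 \<le> (\<Sum>i\<in>N. y i * (y i - t)\<^sup>2)"
    if N: "finite N" and y: "\<forall>i\<in>N. 0 \<le> y i" and s1: "(\<Sum>i\<in>N. y i) = 1" for N :: "'i set" and y
  proof (rule ccontr)
    assume "\<not> ?thesis"
    then have less: "(\<Sum>i\<in>N. y i * (y i - t)\<^sup>2) < \<delta>\<^sup>2 * \<eta> / 2" by simp
    define A where "A = {i \<in> N. \<bar>y i - t\<bar> < \<delta>}"
    have AN: "A \<subseteq> N" "finite A" using N by (auto simp: A_def)
    have split: "(\<Sum>i\<in>N - A. y i) + (\<Sum>i\<in>A. y i) = 1" using sum.subset_diff[OF AN(1) N, of y] s1 by simp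
    have far: "(\<Sum>i\<in>N - A. y i) < \<eta> / 2"
    proof -
      have "\<delta>\<^sup>2 * (\<Sum>i\<in>N - A. y i) = (\<Sum>i\<in>N - A. y i * \<delta>\<^sup>2)" unfolding sum_distrib_left by (simp add: mult.commute)
      also have "\<dots> \<le> (\<Sum>i\<in>N - A. y i * (y i - t)\<^sup>2)"
      proof (intro sum_mono mult_left_mono)
        fix i assume "i \<in> N - A"
        then have "\<bar>\<delta>\<bar> \<le> \<bar>y i - t\<bar>" using \<delta>(1) by (auto simp: A_def)
        then show "\<delta>\<^sup>2 \<le> (y i - t)\<^sup>2" by (simp only: abs_le_square_iff)
      qed (use y in auto)
      also have "\<dots> \<le> (\<Sum>i\<in>N. y i * (y i - t)\<^sup>2)" using N y by (intro sum_mono2) auto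
      also have "\<dots> < \<delta>\<^sup>2 * (\<eta> / 2)" using less by simp
      finally show ?thesis using \<delta>(1) by simp
    qed
    have far0: "0 \<le> (\<Sum>i\<in>N - A. y i)" using y by (intro sum_nonneg) auto
    have near: "\<bar>(\<Sum>i\<in>A. y i) - real (card A) * t\<bar> \<le> real (card A) * \<delta>"
    proof -
      have "(\<Sum>i\<in>A. y i) - real (card A) * t = (\<Sum>i\<in>A. y i - t)" by (simp add: sum_subtractf)
      moreover have "\<bar>\<Sum>i\<in>A. y i - t\<bar> \<le> (\<Sum>i\<in>A. \<bar>y i - t\<bar>)" by (rule sum_abs)
      moreover have "(\<Sum>i\<in>A. \<bar>y i - t\<bar>) \<le> (\<Sum>i\<in>A. \<delta>)" by (intro sum_mono) (auto simp: A_def)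
      moreover have "(\<Sum>i\<in>A. \<delta>) = real (card A) * \<delta>" by simp
      ultimately show ?thesis by linarith
    qed
    have "real (card A) * (t / 2) \<le> 1"
    proof -
      have "real (card A) * (t / 2) \<le> real (card A) * (t - \<delta>)" using \<delta> by (intro mult_left_mono) auto
      also have "\<dots> \<le> (\<Sum>i\<in>A. y i)" using near by (simp add: right_diff_distrib abs_le_iff)
      also have "\<dots> \<le> 1" using split far0 by linarith
      finally show ?thesis .
    qed
    moreover have "real (card A) * \<delta> \<le> (real (card A) * (t / 2)) * (\<eta> / 4)"
      using mult_left_mono[OF \<delta>(3), of "real (card A)"] by (simp add: algebra_simps)
    ultimately have "real (card A) * \<delta> \<le> \<eta> / 4"
      using mult_right_mono[of "real (card A) * (t / 2)" 1 "\<eta> / 4"] \<eta>0 by linarith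
    then show False using \<eta>[of "card A"] near split far far0 \<eta>0 by linarith
  qed
  moreover have "\<delta>\<^sup>2 * \<eta> / 2 > 0" using \<delta> \<eta>0 by simp
  ultimately show ?thesis by blast
qed

definition nonneg_coeffs :: "nat multiset set \<Rightarrow> nat \<Rightarrow> (nat multiset \<Rightarrow> real) set" where
  "nonneg_coeffs L k = {c \<in> coord_space L. \<forall>n\<ge>k. nonneg n (sym_form L n c)}"

lemma sum_delta_coeff:
  assumes "finite L" "\<mu>0 \<in> L"
  shows "(\<Sum>\<mu>\<in>L. (if \<mu> = \<mu>0 then a else 0) * f \<mu>) = (a * f \<mu>0 :: real)"
proof -
  have "(\<Sum>\<mu>\<in>L. (if \<mu> = \<mu>0 then a else 0) * f \<mu>) = (\<Sum>\<mu>\<in>L. if \<mu> = \<mu>0 then a * f \<mu>0 else 0)"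
    by (intro sum.cong) auto
  then show ?thesis using assms by simp
qed

lemma bipoly_if: "f \<in> bipoly \<Longrightarrow> (\<lambda>t \<epsilon>. if P then f t \<epsilon> else 0) \<in> bipoly"
  by (cases P) (simp_all add: bipoly_const)

text \<open>The sextic form is multiplied by p_2^(d - 3), which is positive away from the origin. So
  three coefficients serve for all degrees from 6 on, with L the set of all partitions or that of
  the even ones.\<close>

lemma not_semialgebraic_nonneg_coeffs:
  assumes fin: "finite L" and d: "d \<ge> 3"
    and L: "replicate_mset d 2 \<in> L" "add_mset 4 (replicate_mset (d - 2) 2) \<in> L" "add_mset 6 (replicate_mset (d - 3) 2) \<in> L"
  shows "\<not> semialgebraic L (nonneg_coeffs L k)"
proof -
  define g where "g t \<epsilon> = (\<lambda>\<mu>\<in>L. (if \<mu> = replicate_mset d 2 then t * t - \<epsilon> else 0) +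
     ((if \<mu> = add_mset 4 (replicate_mset (d - 2) 2) then - 2 * t else 0) +
      (if \<mu> = add_mset 6 (replicate_mset (d - 3) 2) then 1 else 0)))" for t \<epsilon> :: real
  have val: "poly_eval x (sym_form L n (g t \<epsilon>)) = (\<Sum>i=1..n. x i ^ 2) ^ (d - 3) *
     ((\<Sum>i=1..n. x i ^ 6) - 2 * t * (\<Sum>i=1..n. x i ^ 4) * (\<Sum>i=1..n. x i ^ 2) + (t * t - \<epsilon>) * (\<Sum>i=1..n. x i ^ 2) ^ 3)" for n x t \<epsilon>
  proof -
    have pw: "(\<Sum>i=1..n. x i ^ 2) ^ d = (\<Sum>i=1..n. x i ^ 2) ^ (d - 3) * (\<Sum>i=1..n. x i ^ 2) ^ 3"
        "(\<Sum>i=1..n. x i ^ 2) ^ (d - 2) = (\<Sum>i=1..n. x i ^ 2) ^ (d - 3) * (\<Sum>i=1..n. x i ^ 2)"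
    proof -
      obtain e where "d = e + 3" using d by (metis le_add_diff_inverse2)
      then show "(\<Sum>i=1..n. x i ^ 2) ^ d = (\<Sum>i=1..n. x i ^ 2) ^ (d - 3) * (\<Sum>i=1..n. x i ^ 2) ^ 3"
        "(\<Sum>i=1..n. x i ^ 2) ^ (d - 2) = (\<Sum>i=1..n. x i ^ 2) ^ (d - 3) * (\<Sum>i=1..n. x i ^ 2)"
        by (simp_all add: power_add)
    qed
    have "poly_eval x (sym_form L n (g t \<epsilon>)) = (\<Sum>\<mu>\<in>L. (if \<mu> = replicate_mset d 2 then t * t - \<epsilon> else 0) * power_sum_value {1..n} \<mu> x) +
       ((\<Sum>\<mu>\<in>L. (if \<mu> = add_mset 4 (replicate_mset (d - 2) 2) then - 2 * t else 0) * power_sum_value {1..n} \<mu> x) +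
        (\<Sum>\<mu>\<in>L. (if \<mu> = add_mset 6 (replicate_mset (d - 3) 2) then 1 else 0) * power_sum_value {1..n} \<mu> x))"
      unfolding poly_eval_sym_form sum.distrib[symmetric] distrib_right[symmetric]
      by (intro sum.cong refl) (simp only: g_def restrict_apply if_True)
    also have "\<dots> = (t * t - \<epsilon>) * power_sum_value {1..n} (replicate_mset d 2) x +
      (- 2 * t * power_sum_value {1..n} (add_mset 4 (replicate_mset (d - 2) 2)) x +
       1 * power_sum_value {1..n} (add_mset 6 (replicate_mset (d - 3) 2)) x)"
      by (simp only: sum_delta_coeff[OF fin L(1)] sum_delta_coeff[OF fin L(2)] sum_delta_coeff[OF fin L(3)])
    also have "\<dots> = (t * t - \<epsilon>) * (\<Sum>i=1..n. x i ^ 2) ^ d +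
      (- 2 * t * ((\<Sum>i=1..n. x i ^ 4) * (\<Sum>i=1..n. x i ^ 2) ^ (d - 2)) +
       1 * ((\<Sum>i=1..n. x i ^ 6) * (\<Sum>i=1..n. x i ^ 2) ^ (d - 3)))"
      by (simp only: power_sum_value_def image_mset_add_mset image_replicate_mset prod_mset.add_mset prod_mset_replicate_mset)
    finally show ?thesis unfolding pw by (simp add: algebra_simps)
  qed
  show ?thesis
  proof (rule not_semialgebraic_if_reciprocals_excluded)
    show "g t \<epsilon> \<in> coord_space L" for t \<epsilon> by (simp add: g_def)
    show "(\<lambda>t \<epsilon>. g t \<epsilon> \<mu>) \<in> bipoly" if "\<mu> \<in> L" for \<mu>
    proof -
      have "(\<lambda>t \<epsilon>. (if \<mu> = replicate_mset d 2 then t * t - \<epsilon> else 0) +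
       ((if \<mu> = add_mset 4 (replicate_mset (d - 2) 2) then - 2 * t else 0) +
        (if \<mu> = add_mset 6 (replicate_mset (d - 3) 2) then 1 else 0))) \<in> bipoly"
        by (rule bipoly_add bipoly_if bipoly_diff bipoly_mult bipoly_const bipoly_fst bipoly_snd)+
      then show ?thesis using that by (simp only: g_def restrict_apply if_True)
    qed
  next
    fix m :: nat and \<epsilon> :: real assume m: "m \<ge> 1" and \<epsilon>: "\<epsilon> > 0"
    define n where "n = max m k"
    \<comment> \<open>With m coordinates 1 and the others 0, every y is 1/m = t or 0, so only
      -\<epsilon> p_2^3 is left of the sextic.\<close>
    define x where "x i = (if i \<le> m then 1 else 0 :: real)" for i :: nat
    have ps: "(\<Sum>i=1..n. x i ^ r) = real m" if "r > 0" for r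
    proof -
      have "(\<Sum>i=1..n. x i ^ r) = (\<Sum>i=1..m. 1)"
        using that by (intro sum.mono_neutral_cong_right) (auto simp: n_def x_def)
      then show ?thesis by simp
    qed
    have p: "(\<Sum>i=1..n. x i ^ 2) = real m" "(\<Sum>i=1..n. x i ^ 4) = real m" "(\<Sum>i=1..n. x i ^ 6) = real m"
      by (rule ps, simp)+
    have "real m - 2 * (1 / real m) * real m * real m + (1 / real m * (1 / real m) - \<epsilon>) * real m ^ 3 = - (\<epsilon> * real m ^ 3)"
      using m by (simp add: field_simps power3_eq_cube)
    then have "poly_eval x (sym_form L n (g (1 / real m) \<epsilon>)) = real m ^ (d - 3) * - (\<epsilon> * real m ^ 3)"
      unfolding val p by (simp only:)
    also have "\<dots> < 0" using m \<epsilon> by simp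
    finally have "\<not> nonneg n (sym_form L n (g (1 / real m) \<epsilon>))"
      unfolding nonneg_iff[OF sym_form_polys_in] by (meson not_le)
    moreover have "n \<ge> k" by (simp add: n_def)
    ultimately show "g (1 / real m) \<epsilon> \<notin> nonneg_coeffs L k" by (auto simp: nonneg_coeffs_def)
  next
    fix t :: real assume t: "t > 0" "\<And>k :: nat. real k * t \<noteq> 1"
    obtain e where e: "e > 0" "\<And>(N :: nat set) y. finite N \<Longrightarrow> (\<forall>i\<in>N. 0 \<le> y i) \<Longrightarrow> (\<Sum>i\<in>N. y i) = 1 \<Longrightarrow> e \<le> (\<Sum>i\<in>N. y i * (y i - t)\<^sup>2)"
      using spread_bound[OF t] by blast
    have "poly_eval x (sym_form L n (g t \<epsilon>)) \<ge> 0" if \<epsilon>: "0 < \<epsilon>" "\<epsilon> \<le> e" for n x \<epsilon>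
    proof -
      define q where "q = (\<Sum>i=1..n. x i ^ 2)"
      have q0: "q \<ge> 0" by (simp add: q_def sum_nonneg)
      have "0 \<le> (\<Sum>i=1..n. x i ^ 6) - 2 * t * (\<Sum>i=1..n. x i ^ 4) * q + (t * t - \<epsilon>) * q ^ 3"
      proof (cases "q = 0")
        case True
        then have "x i = 0" if "i \<in> {1..n}" for i using that by (simp add: q_def sum_nonneg_eq_0_iff)
        then show ?thesis using True by simp
      next
        case False
        define y where "y i = x i ^ 2 / q" for i
        have "(\<Sum>i=1..n. y i) = 1" using False by (simp add: y_def q_def sum_divide_distrib[symmetric])
        then have "e \<le> (\<Sum>i=1..n. y i * (y i - t)\<^sup>2)" using q0 by (intro e(2)) (auto simp: y_def)
        then have "\<epsilon> * q ^ 3 \<le> (\<Sum>i=1..n. y i * (y i - t)\<^sup>2) * q ^ 3" using \<epsilon> q0 by (intro mult_right_mono) auto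
        also have "\<dots> = (\<Sum>i=1..n. x i ^ 6 - 2 * t * q * x i ^ 4 + t * t * q ^ 2 * x i ^ 2)"
          unfolding sum_distrib_right using False
          by (intro sum.cong refl) (simp add: y_def power2_eq_square power3_eq_cube field_simps numeral_eq_Suc)
        also have "\<dots> = (\<Sum>i=1..n. x i ^ 6) - 2 * t * q * (\<Sum>i=1..n. x i ^ 4) + t * t * q ^ 2 * q"
          by (simp add: sum.distrib sum_subtractf sum_distrib_left q_def)
        finally show ?thesis by (simp add: algebra_simps power2_eq_square power3_eq_cube)
      qed
      then show ?thesis unfolding val q_def[symmetric] using q0 by simp
    qed
    then have "g t \<epsilon> \<in> nonneg_coeffs L k" if "0 < \<epsilon>" "\<epsilon> \<le> e" for \<epsilon>
      using that unfolding nonneg_coeffs_def nonneg_iff[OF sym_form_polys_in] by (simp add: g_def)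
    then show "\<exists>e>0. \<forall>\<epsilon>. 0 < \<epsilon> \<and> \<epsilon> \<le> e \<longrightarrow> g t \<epsilon> \<in> nonneg_coeffs L k" using e(1) by blast
  qed
qed

text \<open>With p_2 normalized to 1 and s = p_1, a value near -\<epsilon> forces s^2 close to t and
  puts most of the mass of the z_i^2 on indices with z_i close to s. Then these z_i^2 are close to
  t, which \<open>spread_bound\<close> forbids.\<close>

lemma not_semialgebraic_quartic: "\<not> semialgebraic (partitions 4) (nonneg_coeffs (partitions 4) k)"
proof -
  let ?L = "partitions 4"
  have fin: "finite ?L" by (rule finite_partitions)
  have L: "{#4#} \<in> ?L" "{#3, 1#} \<in> ?L" "{#2, 1, 1#} \<in> ?L" "{#1, 1, 1, 1#} \<in> ?L" "{#2, 2#} \<in> ?L"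
    by (simp_all add: partitions_def)
  define g where "g t \<epsilon> = (\<lambda>\<mu>\<in>?L. (if \<mu> = {#4#} then 1 else 0) + ((if \<mu> = {#3, 1#} then - 2 else 0) +
     ((if \<mu> = {#2, 1, 1#} then 1 - 2 * t else 0) + ((if \<mu> = {#1, 1, 1, 1#} then 1 else 0) +
      (if \<mu> = {#2, 2#} then t * t - \<epsilon> else 0)))))" for t \<epsilon> :: real
  define F where "F n x t \<epsilon> = (\<Sum>i=1..n. x i ^ 4) - 2 * (\<Sum>i=1..n. x i ^ 3) * (\<Sum>i=1..n. x i) +
     (\<Sum>i=1..n. x i)\<^sup>2 * (\<Sum>i=1..n. x i ^ 2) + ((\<Sum>i=1..n. x i)\<^sup>2 - t * (\<Sum>i=1..n. x i ^ 2))\<^sup>2 - \<epsilon> * (\<Sum>i=1..n. x i ^ 2)\<^sup>2"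
    for n :: nat and x and t \<epsilon> :: real
  have val: "poly_eval x (sym_form ?L n (g t \<epsilon>)) = F n x t \<epsilon>" for n x t \<epsilon>
  proof -
    let ?p = "\<lambda>\<mu>. power_sum_value {1..n} \<mu> x"
    have "poly_eval x (sym_form ?L n (g t \<epsilon>)) = (\<Sum>\<mu>\<in>?L. (if \<mu> = {#4#} then 1 else 0) * ?p \<mu>) +
      ((\<Sum>\<mu>\<in>?L. (if \<mu> = {#3, 1#} then - 2 else 0) * ?p \<mu>) + ((\<Sum>\<mu>\<in>?L. (if \<mu> = {#2, 1, 1#} then 1 - 2 * t else 0) * ?p \<mu>) +
      ((\<Sum>\<mu>\<in>?L. (if \<mu> = {#1, 1, 1, 1#} then 1 else 0) * ?p \<mu>) + (\<Sum>\<mu>\<in>?L. (if \<mu> = {#2, 2#} then t * t - \<epsilon> else 0) * ?p \<mu>))))"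
      unfolding poly_eval_sym_form sum.distrib[symmetric] distrib_right[symmetric]
      by (intro sum.cong refl) (simp only: g_def restrict_apply if_True)
    also have "\<dots> = 1 * ?p {#4#} + (- 2 * ?p {#3, 1#} + ((1 - 2 * t) * ?p {#2, 1, 1#} + (1 * ?p {#1, 1, 1, 1#} + (t * t - \<epsilon>) * ?p {#2, 2#})))"
      by (simp only: sum_delta_coeff[OF fin L(1)] sum_delta_coeff[OF fin L(2)] sum_delta_coeff[OF fin L(3)]
          sum_delta_coeff[OF fin L(4)] sum_delta_coeff[OF fin L(5)])
    also have "\<dots> = F n x t \<epsilon>" by (simp add: F_def power_sum_value_def power2_eq_square algebra_simps)
    finally show ?thesis .
  qed
  show ?thesis
  proof (rule not_semialgebraic_if_reciprocals_excluded)
    show "g t \<epsilon> \<in> coord_space ?L" for t \<epsilon> by (simp add: g_def)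
    show "(\<lambda>t \<epsilon>. g t \<epsilon> \<mu>) \<in> bipoly" if "\<mu> \<in> ?L" for \<mu>
    proof -
      have "(\<lambda>t \<epsilon>. (if \<mu> = {#4#} then 1 else 0) + ((if \<mu> = {#3, 1#} then - 2 else 0) +
       ((if \<mu> = {#2, 1, 1#} then 1 - 2 * t else 0) + ((if \<mu> = {#1, 1, 1, 1#} then 1 else 0) +
        (if \<mu> = {#2, 2#} then t * t - \<epsilon> else 0))))) \<in> bipoly"
        by (rule bipoly_add bipoly_if bipoly_diff bipoly_mult bipoly_const bipoly_fst bipoly_snd)+
      then show ?thesis using that by (simp only: g_def restrict_apply if_True)
    qed
  next
    text \<open>The point with \<open>m\<close> coordinates \<open>1\<close>, with \<open>N\<close> further tiny coordinates that bring the sum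
      of the coordinates down to \<open>1\<close> and hardly affect the higher power sums.\<close>
    fix m :: nat and \<epsilon> :: real assume m: "m \<ge> 1" and \<epsilon>: "\<epsilon> > 0"
    define r where "r = real m - 1"
    have r: "r \<ge> 0" using m by (simp add: r_def)
    \<comment> \<open>C adds up the numerators of the four error terms below, each of which is at
      most its numerator divided by N; for large N they fall below \<epsilon>.\<close>
    define C where "C = 2 * r ^ 4 + 2 * r ^ 3 + r\<^sup>2"
    obtain N0 :: nat where N0: "C < real N0 * \<epsilon>" using reals_Archimedean3[OF \<epsilon>] by blast
    define N where "N = N0 + k + 1"
    have N: "N \<ge> 1" "C < real N * \<epsilon>"
    proof -
      have "real N0 * \<epsilon> \<le> real N * \<epsilon>" using \<epsilon> by (intro mult_right_mono) (auto simp: N_def)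
      then show "C < real N * \<epsilon>" using N0 by linarith
    qed (simp add: N_def)
    define n where "n = m + N"
    define x where "x i = (if i \<le> m then 1 else - r / N)" for i :: nat
    have ps: "(\<Sum>i=1..n. x i ^ e) = real m + N * (- r / N) ^ e" for e
    proof -
      have "{1..n} = {1..m} \<union> {m + 1..n}" by (auto simp: n_def)
      then have "(\<Sum>i=1..n. x i ^ e) = (\<Sum>i=1..m. x i ^ e) + (\<Sum>i=m + 1..n. x i ^ e)"
        by (simp add: sum.union_disjoint)
      also have "(\<Sum>i=1..m. x i ^ e) = (\<Sum>i=1..m. 1)" by (intro sum.cong) (auto simp: x_def)
      also have "(\<Sum>i=m + 1..n. x i ^ e) = (\<Sum>i=m + 1..n. (- r / N) ^ e)" by (intro sum.cong) (auto simp: x_def)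
      finally show ?thesis by (simp add: n_def)
    qed
    have p1: "(\<Sum>i=1..n. x i) = 1" using ps[of 1] N by (simp add: r_def)
    have p2: "(\<Sum>i=1..n. x i ^ 2) = m + r\<^sup>2 / N" using ps[of 2] N by (simp add: power2_eq_square field_simps)
    have p3: "(\<Sum>i=1..n. x i ^ 3) = m - r ^ 3 / N ^ 2" using ps[of 3] N by (simp add: power2_eq_square power3_eq_cube field_simps)
    have p4: "(\<Sum>i=1..n. x i ^ 4) = m + r ^ 4 / N ^ 3" using ps[of 4] N by (simp add: power2_eq_square power3_eq_cube power4_eq_xxxx field_simps)
    have le: "a / real N ^ Suc j \<le> a / N" if "a \<ge> 0" for a :: real and j
      using that N by (intro divide_left_mono) (auto simp: self_le_power)
    have "F n x (1 / real m) \<epsilon> = r ^ 4 / N ^ 3 + 2 * (r ^ 3 / N ^ 2) + r\<^sup>2 / N + (r\<^sup>2 / N / m)\<^sup>2 - \<epsilon> * (m + r\<^sup>2 / N)\<^sup>2"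
    proof -
      have "1 - 1 / real m * (m + r\<^sup>2 / N) = - (r\<^sup>2 / N / m)" using m by (simp add: field_simps)
      then show ?thesis unfolding F_def p1 p2 p3 p4 by simp
    qed
    also have "\<dots> \<le> C / N - \<epsilon>"
    proof -
      have "r ^ 4 / N ^ 3 \<le> r ^ 4 / N" "2 * (r ^ 3 / N ^ 2) \<le> 2 * r ^ 3 / N"
        using le[of "r ^ 4" 2] le[of "2 * r ^ 3" 1] r by (simp_all add: numeral_eq_Suc)
      moreover have "(r\<^sup>2 / N / m)\<^sup>2 \<le> r ^ 4 / N"
      proof -
        have "r\<^sup>2 / N / m \<le> r\<^sup>2 / N / 1" using m by (intro divide_left_mono) auto
        then have "(r\<^sup>2 / N / m)\<^sup>2 \<le> (r\<^sup>2 / N)\<^sup>2" by (intro power_mono) auto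
        also have "\<dots> = r ^ 4 / N ^ Suc 1" by (simp add: power_divide power2_eq_square power4_eq_xxxx)
        also have "\<dots> \<le> r ^ 4 / N" using le[of "r ^ 4" 1] r by simp
        finally show ?thesis .
      qed
      moreover have "\<epsilon> \<le> \<epsilon> * (m + r\<^sup>2 / N)\<^sup>2"
      proof -
        have "1 \<le> m + r\<^sup>2 / N" using m by (simp add: add_increasing2)
        then have "1 \<le> (m + r\<^sup>2 / N)\<^sup>2" by (rule one_le_power)
        then show ?thesis using \<epsilon> by simp
      qed
      moreover have "C / N = r ^ 4 / N + 2 * r ^ 3 / N + r\<^sup>2 / N + r ^ 4 / N" by (simp add: C_def add_divide_distrib)
      ultimately show ?thesis by linarith
    qed
    also have "\<dots> < 0" using N by (simp add: divide_less_eq mult.commute)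
    finally have "\<not> nonneg n (sym_form ?L n (g (1 / real m) \<epsilon>))"
      unfolding nonneg_iff[OF sym_form_polys_in] val by (meson not_le)
    moreover have "n \<ge> k" by (simp add: n_def N_def)
    ultimately show "g (1 / real m) \<epsilon> \<notin> nonneg_coeffs ?L k" by (auto simp: nonneg_coeffs_def)
  next
    fix t :: real assume t: "t > 0" "\<And>k :: nat. real k * t \<noteq> 1"
    obtain e where e: "e > 0" "\<And>(N :: nat set) y. finite N \<Longrightarrow> (\<forall>i\<in>N. 0 \<le> y i) \<Longrightarrow> (\<Sum>i\<in>N. y i) = 1 \<Longrightarrow> e \<le> (\<Sum>i\<in>N. y i * (y i - t)\<^sup>2)"
      using spread_bound[OF t] by blast
    \<comment> \<open>The bound 1 settles the case (s^2 - t)^2 \<ge> 1. Otherwise s^2 \<le> 1 + t,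
      so (z_i + s)^2 \<le> 2 z_i^2 + 2 s^2 \<le> 4 + 2 t, and estimating (z_i^2 - t)^2 by twice two
      squares doubles this to 8 + 4 t.\<close>
    define e' where "e' = min 1 (e / (8 + 4 * t))"
    have e': "e' > 0" using e(1) t by (simp add: e'_def)
    have normalized: "F n z t \<epsilon> \<ge> 0" if \<epsilon>: "0 < \<epsilon>" "\<epsilon> \<le> e'" and z: "(\<Sum>i=1..n. z i ^ 2) = 1" for n z \<epsilon>
    proof -
      define s where "s = (\<Sum>i=1..n. z i)"
      define a where "a = (\<Sum>i=1..n. z i ^ 2 * (z i - s)\<^sup>2)"
      have a0: "a \<ge> 0" unfolding a_def by (intro sum_nonneg) simp
      have "a = (\<Sum>i=1..n. z i ^ 4 - 2 * s * z i ^ 3 + s\<^sup>2 * z i ^ 2)"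
        unfolding a_def by (intro sum.cong refl) (simp add: power2_eq_square power3_eq_cube power4_eq_xxxx algebra_simps)
      also have "\<dots> = (\<Sum>i=1..n. z i ^ 4) - 2 * s * (\<Sum>i=1..n. z i ^ 3) + s\<^sup>2"
        using z by (simp add: sum.distrib sum_subtractf sum_distrib_left[symmetric])
      finally have a_eq: "a = (\<Sum>i=1..n. z i ^ 4) - 2 * s * (\<Sum>i=1..n. z i ^ 3) + s\<^sup>2" .
      have F: "F n z t \<epsilon> = a + (s\<^sup>2 - t)\<^sup>2 - \<epsilon>"
        unfolding F_def z s_def[symmetric] a_eq by (simp add: mult_ac)
      show ?thesis
      proof (cases "(s\<^sup>2 - t)\<^sup>2 \<ge> 1")
        case True
        then show ?thesis using F a0 \<epsilon> by (simp add: e'_def)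
      next
        case False
        then have "\<bar>s\<^sup>2 - t\<bar> < 1" using abs_square_less_1[of "s\<^sup>2 - t"] by linarith
        then have s2: "s\<^sup>2 \<le> 1 + t" by linarith
        have "e \<le> (\<Sum>i=1..n. z i ^ 2 * (z i ^ 2 - t)\<^sup>2)" using z by (intro e(2)) auto
        also have "\<dots> \<le> (\<Sum>i=1..n. (8 + 4 * t) * (z i ^ 2 * (z i - s)\<^sup>2) + 2 * (s\<^sup>2 - t)\<^sup>2 * z i ^ 2)"
        proof (rule sum_mono)
          fix i assume "i \<in> {1..n}"
          then have "z i ^ 2 \<le> (\<Sum>i=1..n. z i ^ 2)" by (intro member_le_sum) auto
          then have z1: "z i ^ 2 \<le> 1" using z by simp
          have "(z i ^ 2 - t)\<^sup>2 \<le> 2 * (z i ^ 2 - s\<^sup>2)\<^sup>2 + 2 * (s\<^sup>2 - t)\<^sup>2"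
            using zero_le_power2[of "(z i ^ 2 - s\<^sup>2) - (s\<^sup>2 - t)"] by (simp add: power2_eq_square algebra_simps)
          moreover have "(z i ^ 2 - s\<^sup>2)\<^sup>2 \<le> (4 + 2 * t) * (z i - s)\<^sup>2"
          proof -
            have "(z i + s)\<^sup>2 \<le> 2 * z i ^ 2 + 2 * s\<^sup>2" using zero_le_power2[of "z i - s"] by (simp add: power2_eq_square algebra_simps)
            then have "(z i + s)\<^sup>2 \<le> 4 + 2 * t" using z1 s2 by linarith
            then have "(z i + s)\<^sup>2 * (z i - s)\<^sup>2 \<le> (4 + 2 * t) * (z i - s)\<^sup>2" by (intro mult_right_mono) auto
            then show ?thesis by (simp add: power_mult_distrib[symmetric] power2_eq_square algebra_simps)
          qed
          ultimately have "(z i ^ 2 - t)\<^sup>2 \<le> (8 + 4 * t) * (z i - s)\<^sup>2 + 2 * (s\<^sup>2 - t)\<^sup>2" by (simp add: algebra_simps)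
          then have "z i ^ 2 * (z i ^ 2 - t)\<^sup>2 \<le> z i ^ 2 * ((8 + 4 * t) * (z i - s)\<^sup>2 + 2 * (s\<^sup>2 - t)\<^sup>2)"
            by (intro mult_left_mono) auto
          then show "z i ^ 2 * (z i ^ 2 - t)\<^sup>2 \<le> (8 + 4 * t) * (z i ^ 2 * (z i - s)\<^sup>2) + 2 * (s\<^sup>2 - t)\<^sup>2 * z i ^ 2"
            by (simp add: distrib_left mult_ac)
        qed
        also have "\<dots> = (8 + 4 * t) * a + 2 * (s\<^sup>2 - t)\<^sup>2"
          using z by (simp add: sum.distrib sum_distrib_left[symmetric] a_def)
        also have "\<dots> \<le> (8 + 4 * t) * (a + (s\<^sup>2 - t)\<^sup>2)"
          using t mult_right_mono[of 2 "8 + 4 * t" "(s\<^sup>2 - t)\<^sup>2"] by (simp add: distrib_left)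
        finally have "e / (8 + 4 * t) \<le> a + (s\<^sup>2 - t)\<^sup>2" using t by (simp add: divide_le_eq mult.commute)
        then show ?thesis using F \<epsilon> by (simp add: e'_def)
      qed
    qed
    have F_nonneg: "F n x t \<epsilon> \<ge> 0" if \<epsilon>: "0 < \<epsilon>" "\<epsilon> \<le> e'" for n x \<epsilon>
    proof -
      define q where "q = (\<Sum>i=1..n. x i ^ 2)"
      have q0: "q \<ge> 0" by (simp add: q_def sum_nonneg)
      show ?thesis
      proof (cases "q = 0")
        case True
        then have "x i = 0" if "i \<in> {1..n}" for i using that by (simp add: q_def sum_nonneg_eq_0_iff)
        then show ?thesis by (simp add: F_def)
      next
        case False
        define w where "w = sqrt q"
        have w: "w > 0" "w\<^sup>2 = q" using q0 False by (auto simp: w_def)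
        define z where "z i = x i / w" for i
        have x: "x i = w * z i" for i using w by (simp add: z_def)
        have "(\<Sum>i=1..n. z i ^ 2) = q / w\<^sup>2"
          unfolding q_def z_def by (simp add: power_divide sum_divide_distrib)
        then have "(\<Sum>i=1..n. z i ^ 2) = 1" using False w(2) by simp
        then have "F n z t \<epsilon> \<ge> 0" using normalized \<epsilon> by blast
        moreover have "F n x t \<epsilon> = w ^ 4 * F n z t \<epsilon>"
        proof -
          have "(\<Sum>i=1..n. x i ^ j) = w ^ j * (\<Sum>i=1..n. z i ^ j)" for j
            by (simp add: x power_mult_distrib sum_distrib_left)
          from this[of 1] this[of 2] this[of 3] this[of 4] show ?thesis unfolding F_def
            by (simp add: power2_eq_square power3_eq_cube power4_eq_xxxx algebra_simps)
        qed
        ultimately show ?thesis by simp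
      qed
    qed
    have "g t \<epsilon> \<in> nonneg_coeffs ?L k" if "0 < \<epsilon>" "\<epsilon> \<le> e'" for \<epsilon>
    proof -
      have "g t \<epsilon> \<in> coord_space ?L" by (simp add: g_def)
      then show ?thesis using F_nonneg[OF that] unfolding nonneg_coeffs_def nonneg_iff[OF sym_form_polys_in] by (simp add: val)
    qed
    then show "\<exists>e>0. \<forall>\<epsilon>. 0 < \<epsilon> \<and> \<epsilon> \<le> e \<longrightarrow> g t \<epsilon> \<in> nonneg_coeffs ?L k" using e' by blast
  qed
qed

lemma sextic_partitions:
  assumes "d \<ge> 3"
  shows "replicate_mset d 2 \<in> even_partitions (2 * d)" "add_mset 4 (replicate_mset (d - 2) 2) \<in> even_partitions (2 * d)"
    "add_mset 6 (replicate_mset (d - 3) 2) \<in> even_partitions (2 * d)"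
  using assms by (auto simp: even_partitions_def partitions_def sum_mset_replicate_mset in_replicate_mset)

theorem not_semialgebraic_B_P: "d \<ge> 3 \<Longrightarrow> \<not> semialgebraic (even_partitions (2 * d)) (B_P (2 * d))"
  using not_semialgebraic_nonneg_coeffs[OF finite_even_partitions _ sextic_partitions]
  by (simp add: B_P_def nonneg_coeffs_def)

text \<open>From degree 6 on the even form is available among all symmetric forms; only degree 4
  calls for a form that involves odd power sums.\<close>

theorem not_semialgebraic_S_P:
  assumes "d \<ge> 2" shows "\<not> semialgebraic (partitions (2 * d)) (S_P (2 * d))"
proof (cases "d = 2")
  case True
  then show ?thesis using not_semialgebraic_quartic[of 4] by (simp add: S_P_def nonneg_coeffs_def)
next
  case False
  then have d: "d \<ge> 3" using assms by simp
  have "\<not> semialgebraic (partitions (2 * d)) (nonneg_coeffs (partitions (2 * d)) (2 * d))"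
    by (rule not_semialgebraic_nonneg_coeffs[OF finite_partitions d]) (use sextic_partitions[OF d] even_partitions_subset in blast)+
  then show ?thesis by (simp add: S_P_def nonneg_coeffs_def)
qed

section \<open>The inclusions and the theorem\<close>

lemma S_Sigma_subset: "S_Sigma k \<subseteq> S_P k"
  by (auto simp: S_Sigma_def S_P_def nonneg_iff[OF sym_form_polys_in] intro: sum_of_squares_imp_nonneg)

lemma B_Sigma_subset: "B_Sigma k \<subseteq> B_P k"
  by (auto simp: B_Sigma_def B_P_def nonneg_iff[OF sym_form_polys_in] intro: sum_of_squares_imp_nonneg)

theorem theorem3p12:
  shows "(\<forall>d::nat. 2 * d \<ge> 4 \<longrightarrow> S_Sigma (2 * d) \<subset> S_P (2 * d)) \<and>
    (\<forall>d::nat. 2 * d \<ge> 6 \<longrightarrow> B_Sigma (2 * d) \<subset> B_P (2 * d)) \<and>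
    (\<forall>d::nat. 2 * d \<ge> 4 \<longrightarrow> \<not> semialgebraic (partitions (2 * d)) (S_P (2 * d))) \<and>
    (\<forall>d::nat. 2 * d \<ge> 6 \<longrightarrow> \<not> semialgebraic (even_partitions (2 * d)) (B_P (2 * d))) \<and>
    (\<forall>d::nat. d \<ge> 1 \<longrightarrow> semialgebraic (partitions (2 * d)) (S_Sigma (2 * d))) \<and>
    (\<forall>d::nat. d \<ge> 1 \<longrightarrow> semialgebraic (even_partitions (2 * d)) (B_Sigma (2 * d)))"
proof (intro conjI allI impI)
  fix d :: nat
  show SP: "\<not> semialgebraic (partitions (2 * d)) (S_P (2 * d))" if "2 * d \<ge> 4"
    using not_semialgebraic_S_P that by simp
  show BP: "\<not> semialgebraic (even_partitions (2 * d)) (B_P (2 * d))" if "2 * d \<ge> 6"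
    using not_semialgebraic_B_P that by simp
  show "S_Sigma (2 * d) \<subset> S_P (2 * d)" if "2 * d \<ge> 4"
    using S_Sigma_subset SP[OF that] semialgebraic_S_Sigma by (metis psubsetI)
  show "B_Sigma (2 * d) \<subset> B_P (2 * d)" if "2 * d \<ge> 6"
    using B_Sigma_subset BP[OF that] semialgebraic_B_Sigma by (metis psubsetI)
qed (rule semialgebraic_S_Sigma, rule semialgebraic_B_Sigma)

end
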